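(* Let $u:G\to\mathcal U\mathcal C$ and $u':G\to\mathcal U\mathcal D$ be unitary representations of a locally compact group $G$ on unital $C^*$-algebras $\mathcal C$ and $\mathcal D$ respectively. Let $E$ be a full Hilbert $C^*$-module over a unital $C^*$-algebra $\mathcal B$, let $F$ be a $C^*$-correspondence from $\mathcal D$ to $\mathcal C$ and let $S$ be a set. For each $\sigma\in S$ let $\mathcal K^\sigma$ be a map from $E$ to $F$. If $(G,\eta,E)$ is a dynamical system on $E$, then the following conditions are equivalent: (i) There is a CPD-kernel $\mathfrak K:S\times S\to B(\mathcal B,\mathcal C)$ such that $\{\mathcal K^\sigma\}_{\sigma\in S}$ is a $\mathfrak K$-family which is $(u',u)$-covariant with respect to the dynamical system $(G,\eta,E)$. (ii) There exist a pair $(\mathcal F,\mathfrak i)$ consisting of a $C^*$-correspondence $\mathcal F$ from $\mathcal B$ to $\mathcal C$, with left action given by a $*$-homomorphism $\pi:\mathcal B\to B^a(\mathcal F)$, and a map $\mathfrak i:S\to\mathcal F$, an isometry $\nu:E\bigodot\mathcal F\to F$ such that $$\nu(x\odot\mathfrak i(\sigma))=\mathcal K^\sigma(x)\quad\text{for all }x\in E,\ \sigma\in S,$$ and unitary representations $v:G\to\mathcal U B^a(\mathcal F)$ and $w':G\to\mathcal U B^a(E\bigodot\mathcal F)$ such that (a) $\pi(\alpha^\eta_t(b))=v_t\pi(b)v_t^*$ for all $b\in\mathcal B$, $t\in G$; (b) $v_t\mathfrak i(\sigma)=\mathfrak i(\sigma)u_t$ for all $t\in G$, $\sigma\in S$;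 (c) $w'_t(x\odot b\,\mathfrak i(\sigma)c)=\eta_t(x)\odot v_t(b\,\mathfrak i(\sigma)c)$ for all $b\in\mathcal B$, $c\in\mathcal C$, $x\in E$, $\sigma\in S$, $t\in G$; (d) $\nu w'_t=u'_t\nu$ for all $t\in G$.
   Context: Inner products on Hilbert $C^*$-modules are linear in the second variable. $B(\mathcal B,\mathcal C)$ is the set of bounded linear maps from $\mathcal B$ to $\mathcal C$; $B^a(M)$ is the algebra of adjointable operators on a Hilbert module $M$; $\mathcal U\mathcal A$ is the unitary group of a unital $C^*$-algebra $\mathcal A$. A kernel $\mathfrak K:S\times S\to B(\mathcal B,\mathcal C)$ is a CPD-kernel (completely positive definite) if $\sum_{i,j}c_i^*\mathfrak K^{\sigma_i,\sigma_j}(b_i^*b_j)c_j\ge0$ for all finite choices of $\sigma_i\in S$, $b_i\in\mathcal B$, $c_i\in\mathcal C$. A family $\{\mathcal K^\sigma\}_{\sigma\in S}$ of maps from $E$ to $F$ is a $\mathfrak K$-family if $\langle\mathcal K^\sigma(x),\mathcal K^{\sigma'}(x')\rangle=\mathfrak K^{\sigma,\sigma'}(\langle x,x'\rangle)$ for all $x,x'\in E$, $\sigma,\sigma'\in S$. A $C^*$-correspondence from $\mathcal A$ to $\mathcal B$ is a Hilbert $\mathcal B$-module $M$ with a $*$-homomorphism $\phi:\mathcal A\to B^a(M)$; $ay:=\phi(a)y$. In particular $u'_t\in\mathcal D$ acts on $F$ through the left action. $E\bigodot\mathcal F$ is the interior tensor product over $\mathcal B$ with $\langle x\odot f,x'\odot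 f'\rangle=\langle f,\langle x,x'\rangle f'\rangle$. An isometry is a linear map preserving the $\mathcal C$-valued inner products. $E$ is full if the closed linear span of $\{\langle x,y\rangle:x,y\in E\}$ is $\mathcal B$. $\mathrm{Aut}(E)$ is the group of bijections $\Psi:E\to E$ such that both $\Psi$ and $\Psi^{-1}$ are morphisms, where $\Psi$ is a morphism if there is a $*$-homomorphism $\psi:\mathcal B\to\mathcal B$ with $\langle\Psi(x),\Psi(y)\rangle=\psi(\langle x,y\rangle)$ for all $x,y\in E$. A dynamical system $(G,\eta,E)$ on a full Hilbert $\mathcal B$-module $E$ is a group homomorphism $t\mapsto\eta_t$ from the locally compact group $G$ to $\mathrm{Aut}(E)$ with $t\mapsto\eta_t(x)$ continuous for each $x\in E$. It determines a unique $C^*$-dynamical system $(G,\alpha^\eta,\mathcal B)$ with $\alpha^\eta_t(\langle x,y\rangle)=\langle\eta_t(x),\eta_t(y)\rangle$; moreover $\eta_t(xb)=\eta_t(x)\alpha^\eta_t(b)$. The family $\{\mathcal K^\sigma\}$ is $(u',u)$-covariant with respect to $(G,\eta,E)$ if $\mathcal K^\sigma(\eta_t(x))=u'_t\mathcal K^\sigma(x)u_t^*$ for all $t\in G$, $\sigma\in S$, $x\in E$. Unitary representations of $G$ are group homomorphisms into the unitary group which are norm continuous for values in $\mathcal U\mathcal C$, $\mathcal U\mathcal D$, and strictly continuous for values in $\mathcal U B^a(M)$ (i.e. $t\mapsto v_tm$ is continuous for each $m\in M$). *)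

theory Defs
  imports "HOL-Analysis.Analysis"
begin

section \<open>Unital C*-algebras\<close>

class scaleC = scaleR +
  fixes scaleC :: "complex \<Rightarrow> 'a \<Rightarrow> 'a"  (infixr \<open>*\<^sub>C\<close> 75)
  assumes scaleR_scaleC: "r *\<^sub>R x = complex_of_real r *\<^sub>C x"

class complex_vector = scaleC + ab_group_add +
  assumes scaleC_add_right: "a *\<^sub>C (x + y) = a *\<^sub>C x + a *\<^sub>C y"
    and scaleC_add_left: "(a + b) *\<^sub>C x = a *\<^sub>C x + b *\<^sub>C x"
    and scaleC_scaleC: "a *\<^sub>C b *\<^sub>C x = (a * b) *\<^sub>C x"
    and scaleC_one: "1 *\<^sub>C x = x"

text \<open>The zero algebra is admitted: \<^term>\<open>1 \<noteq> 0\<close> is not required, whence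
  \<^class>\<open>monoid_mult\<close> in place of \<^class>\<open>ring_1\<close>.\<close>

class unital_cstar_algebra = complex_vector + real_normed_algebra + banach + monoid_mult +
  fixes star :: "'a \<Rightarrow> 'a"
  assumes scaleC_mult_left: "(c *\<^sub>C x) * y = c *\<^sub>C (x * y)"
    and scaleC_mult_right: "x * (c *\<^sub>C y) = c *\<^sub>C (x * y)"
    and norm_scaleC: "norm (c *\<^sub>C x) = cmod c * norm x"
    and star_add: "star (x + y) = star x + star y"
    and star_scaleC: "star (c *\<^sub>C x) = cnj c *\<^sub>C star x"
    and star_mult: "star (x * y) = star y * star x"
    and star_star: "star (star x) = x"
    and cstar_identity: "norm (star x * x) = (norm x)\<^sup>2"

global_interpretation complex_vector:
  vector_space "scaleC :: complex \<Rightarrow> 'a \<Rightarrow> 'a::complex_vector"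
  defines cspan = complex_vector.span
  by unfold_locales
    (simp_all add: scaleC_add_right scaleC_add_left scaleC_scaleC scaleC_one)

definition positive :: "'a::unital_cstar_algebra \<Rightarrow> bool" where
  "positive a \<longleftrightarrow> (\<exists>x. a = star x * x)"

definition unitary :: "'a::unital_cstar_algebra \<Rightarrow> bool" where
  "unitary a \<longleftrightarrow> star a * a = 1 \<and> a * star a = 1"

definition star_hom :: "('a::unital_cstar_algebra \<Rightarrow> 'b::unital_cstar_algebra) \<Rightarrow> bool" where
  "star_hom \<psi> \<longleftrightarrow>
     (\<forall>x y. \<psi> (x + y) = \<psi> x + \<psi> y) \<and> (\<forall>c x. \<psi> (c *\<^sub>C x) = c *\<^sub>C \<psi> x) \<and>
     (\<forall>x y. \<psi> (x * y) = \<psi> x * \<psi> y) \<and> (\<forall>x. \<psi> (star x) = star (\<psi> x))"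

definition bounded_clinear ::
    "('a::unital_cstar_algebra \<Rightarrow> 'b::unital_cstar_algebra) \<Rightarrow> bool" where
  "bounded_clinear f \<longleftrightarrow> bounded_linear f \<and> (\<forall>c x. f (c *\<^sub>C x) = c *\<^sub>C f x)"


section \<open>Hilbert modules\<close>

text \<open>Hilbert modules are records with an explicit carrier, so that they can be quantified over
  inside a formula. The same record type also serves for semi-inner product modules before
  separation and completion. Functions on a module matter only on its carrier.\<close>

record ('m, 'a) hmod =
  mcarrier :: "'m set"
  madd :: "'m \<Rightarrow> 'm \<Rightarrow> 'm"
  mzero :: "'m"
  mscale :: "complex \<Rightarrow> 'm \<Rightarrow> 'm"
  mact :: "'m \<Rightarrow> 'a \<Rightarrow> 'm"
  minner :: "'m \<Rightarrow> 'm \<Rightarrow> 'a"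

definition mnorm :: "('m, 'a::unital_cstar_algebra) hmod \<Rightarrow> 'm \<Rightarrow> real" where
  "mnorm M x = sqrt (norm (minner M x x))"

definition mdist :: "('m, 'a::unital_cstar_algebra) hmod \<Rightarrow> 'm \<Rightarrow> 'm \<Rightarrow> real" where
  "mdist M x y = mnorm M (madd M x (mscale M (-1) y))"

definition mcauchy :: "('m, 'a::unital_cstar_algebra) hmod \<Rightarrow> (nat \<Rightarrow> 'm) \<Rightarrow> bool" where
  "mcauchy M X \<longleftrightarrow> range X \<subseteq> mcarrier M \<and>
     (\<forall>e>0. \<exists>N. \<forall>m\<ge>N. \<forall>n\<ge>N. mdist M (X m) (X n) < e)"

definition mcontinuous ::
    "('m, 'a::unital_cstar_algebra) hmod \<Rightarrow> ('t::topological_space \<Rightarrow> 'm) \<Rightarrow> bool" where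
  "mcontinuous M g \<longleftrightarrow> (\<forall>t0. ((\<lambda>t. mdist M (g t) (g t0)) \<longlongrightarrow> 0) (at t0))"

locale hilbert_module =
  fixes M :: "('m, 'a::unital_cstar_algebra) hmod"
  assumes add_closed: "\<lbrakk>x \<in> mcarrier M; y \<in> mcarrier M\<rbrakk> \<Longrightarrow> madd M x y \<in> mcarrier M"
    and zero_closed: "mzero M \<in> mcarrier M"
    and scale_closed: "x \<in> mcarrier M \<Longrightarrow> mscale M c x \<in> mcarrier M"
    and act_closed: "x \<in> mcarrier M \<Longrightarrow> mact M x a \<in> mcarrier M"
    and add_assoc: "\<lbrakk>x \<in> mcarrier M; y \<in> mcarrier M; z \<in> mcarrier M\<rbrakk>
      \<Longrightarrow> madd M (madd M x y) z = madd M x (madd M y z)"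
    and add_commute: "\<lbrakk>x \<in> mcarrier M; y \<in> mcarrier M\<rbrakk> \<Longrightarrow> madd M x y = madd M y x"
    and add_zero: "x \<in> mcarrier M \<Longrightarrow> madd M x (mzero M) = x"
    and add_neg: "x \<in> mcarrier M \<Longrightarrow> madd M x (mscale M (-1) x) = mzero M"
    and scale_add_right: "\<lbrakk>x \<in> mcarrier M; y \<in> mcarrier M\<rbrakk>
      \<Longrightarrow> mscale M c (madd M x y) = madd M (mscale M c x) (mscale M c y)"
    and scale_add_left: "x \<in> mcarrier M
      \<Longrightarrow> mscale M (c + d) x = madd M (mscale M c x) (mscale M d x)"
    and scale_scale: "x \<in> mcarrier M \<Longrightarrow> mscale M c (mscale M d x) = mscale M (c * d) x"
    and scale_one: "x \<in> mcarrier M \<Longrightarrow> mscale M 1 x = x"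
    and act_add_left: "\<lbrakk>x \<in> mcarrier M; y \<in> mcarrier M\<rbrakk>
      \<Longrightarrow> mact M (madd M x y) a = madd M (mact M x a) (mact M y a)"
    and act_add_right: "x \<in> mcarrier M
      \<Longrightarrow> mact M x (a + b) = madd M (mact M x a) (mact M x b)"
    and act_act: "x \<in> mcarrier M \<Longrightarrow> mact M (mact M x a) b = mact M x (a * b)"
    and act_one: "x \<in> mcarrier M \<Longrightarrow> mact M x 1 = x"
    and act_scale_left: "x \<in> mcarrier M \<Longrightarrow> mact M (mscale M c x) a = mscale M c (mact M x a)"
    and act_scale_right: "x \<in> mcarrier M \<Longrightarrow> mact M x (c *\<^sub>C a) = mscale M c (mact M x a)"
    and inner_add: "\<lbrakk>x \<in> mcarrier M; y \<in> mcarrier M; z \<in> mcarrier M\<rbrakk>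
      \<Longrightarrow> minner M x (madd M y z) = minner M x y + minner M x z"
    and inner_scale: "\<lbrakk>x \<in> mcarrier M; y \<in> mcarrier M\<rbrakk>
      \<Longrightarrow> minner M x (mscale M c y) = c *\<^sub>C minner M x y"
    and inner_act: "\<lbrakk>x \<in> mcarrier M; y \<in> mcarrier M\<rbrakk>
      \<Longrightarrow> minner M x (mact M y a) = minner M x y * a"
    and inner_star: "\<lbrakk>x \<in> mcarrier M; y \<in> mcarrier M\<rbrakk>
      \<Longrightarrow> star (minner M x y) = minner M y x"
    and inner_positive: "x \<in> mcarrier M \<Longrightarrow> positive (minner M x x)"
    and inner_definite: "\<lbrakk>x \<in> mcarrier M; minner M x x = 0\<rbrakk> \<Longrightarrow> x = mzero M"
    and complete: "mcauchy M X \<Longrightarrow> \<exists>x\<in>mcarrier M. (\<lambda>n. mdist M (X n) x) \<longlonglongrightarrow> 0"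

definition full :: "('m, 'a::unital_cstar_algebra) hmod \<Rightarrow> bool" where
  "full M \<longleftrightarrow> closure (cspan {minner M x y | x y. x \<in> mcarrier M \<and> y \<in> mcarrier M}) = UNIV"

definition is_adjoint ::
    "('m, 'a::unital_cstar_algebra) hmod \<Rightarrow> ('m \<Rightarrow> 'm) \<Rightarrow> ('m \<Rightarrow> 'm) \<Rightarrow> bool" where
  "is_adjoint M T T' \<longleftrightarrow>
     T \<in> mcarrier M \<rightarrow> mcarrier M \<and> T' \<in> mcarrier M \<rightarrow> mcarrier M \<and>
     (\<forall>x\<in>mcarrier M. \<forall>y\<in>mcarrier M. minner M (T x) y = minner M x (T' y))"

definition adjointable :: "('m, 'a::unital_cstar_algebra) hmod \<Rightarrow> ('m \<Rightarrow> 'm) \<Rightarrow> bool" where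
  "adjointable M T \<longleftrightarrow> (\<exists>T'. is_adjoint M T T')"

definition adj :: "('m, 'a::unital_cstar_algebra) hmod \<Rightarrow> ('m \<Rightarrow> 'm) \<Rightarrow> 'm \<Rightarrow> 'm" where
  "adj M T y = (THE z. z \<in> mcarrier M \<and> (\<forall>x\<in>mcarrier M. minner M (T x) y = minner M x z))"

definition unitary_op :: "('m, 'a::unital_cstar_algebra) hmod \<Rightarrow> ('m \<Rightarrow> 'm) \<Rightarrow> bool" where
  "unitary_op M T \<longleftrightarrow> adjointable M T \<and>
     (\<forall>x\<in>mcarrier M. adj M T (T x) = x \<and> T (adj M T x) = x)"

text \<open>The operations on \<open>B\<^sup>a(M)\<close> are pointwise addition and scaling, composition, and passage to
  the adjoint.\<close>

definition left_action ::
    "('m, 'c::unital_cstar_algebra) hmod \<Rightarrow> ('a::unital_cstar_algebra \<Rightarrow> 'm \<Rightarrow> 'm) \<Rightarrow> bool" where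
  "left_action M \<phi> \<longleftrightarrow>
     (\<forall>a. adjointable M (\<phi> a)) \<and>
     (\<forall>x\<in>mcarrier M.
        (\<forall>a b. \<phi> (a + b) x = madd M (\<phi> a x) (\<phi> b x)) \<and>
        (\<forall>c a. \<phi> (c *\<^sub>C a) x = mscale M c (\<phi> a x)) \<and>
        (\<forall>a b. \<phi> (a * b) x = \<phi> a (\<phi> b x)) \<and>
        (\<forall>a. \<phi> (star a) x = adj M (\<phi> a) x))"

definition cstar_correspondence ::
    "('m, 'c::unital_cstar_algebra) hmod \<Rightarrow> ('a::unital_cstar_algebra \<Rightarrow> 'm \<Rightarrow> 'm) \<Rightarrow> bool" where
  "cstar_correspondence M \<phi> \<longleftrightarrow> hilbert_module M \<and> left_action M \<phi>"

definition isometry_on ::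
    "('m, 'c::unital_cstar_algebra) hmod \<Rightarrow> ('n, 'c) hmod \<Rightarrow> ('m \<Rightarrow> 'n) \<Rightarrow> bool" where
  "isometry_on M N \<nu> \<longleftrightarrow>
     \<nu> \<in> mcarrier M \<rightarrow> mcarrier N \<and>
     (\<forall>x\<in>mcarrier M. \<forall>y\<in>mcarrier M. \<nu> (madd M x y) = madd N (\<nu> x) (\<nu> y)) \<and>
     (\<forall>c. \<forall>x\<in>mcarrier M. \<nu> (mscale M c x) = mscale N c (\<nu> x)) \<and>
     (\<forall>x\<in>mcarrier M. \<forall>y\<in>mcarrier M. minner N (\<nu> x) (\<nu> y) = minner M x y)"


section \<open>The interior tensor product\<close>

text \<open>The separated completion of a semi-inner product module, realised by equivalence classes of
  Cauchy sequences.\<close>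

definition seq_class :: "('p, 'a::unital_cstar_algebra) hmod \<Rightarrow> (nat \<Rightarrow> 'p) \<Rightarrow> (nat \<Rightarrow> 'p) set" where
  "seq_class P X = {Y. mcauchy P Y \<and> (\<lambda>n. mdist P (X n) (Y n)) \<longlonglongrightarrow> 0}"

definition seq_rep :: "(nat \<Rightarrow> 'p) set \<Rightarrow> nat \<Rightarrow> 'p" where
  "seq_rep A = (SOME X. X \<in> A)"

definition completion ::
    "('p, 'a::unital_cstar_algebra) hmod \<Rightarrow> ((nat \<Rightarrow> 'p) set, 'a) hmod" where
  "completion P =
    \<lparr>mcarrier = seq_class P ` {X. mcauchy P X},
     madd = (\<lambda>A B. seq_class P (\<lambda>n. madd P (seq_rep A n) (seq_rep B n))),
     mzero = seq_class P (\<lambda>_. mzero P),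
     mscale = (\<lambda>c A. seq_class P (\<lambda>n. mscale P c (seq_rep A n))),
     mact = (\<lambda>A a. seq_class P (\<lambda>n. mact P (seq_rep A n) a)),
     minner = (\<lambda>A B. lim (\<lambda>n. minner P (seq_rep A n) (seq_rep B n)))\<rparr>"

text \<open>The list \<open>[(x\<^sub>1, f\<^sub>1), \<dots>, (x\<^sub>n, f\<^sub>n)]\<close> stands for \<open>\<Sum>\<^sub>i x\<^sub>i \<odot> f\<^sub>i\<close>. The relations of the algebraic
  tensor product over the algebra acting on the left of the second factor, bilinearity and
  \<open>x b \<odot> f = x \<odot> b f\<close>, are imposed by the separation in the completion, as differences of the two
  sides are null vectors for the semi-inner product.\<close>

definition formal_tensors ::
    "('e, 'b::unital_cstar_algebra) hmod \<Rightarrow> ('m, 'c::unital_cstar_algebra) hmod \<Rightarrow>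
     ('b \<Rightarrow> 'm \<Rightarrow> 'm) \<Rightarrow> (('e \<times> 'm) list, 'c) hmod" where
  "formal_tensors E M \<pi> =
    \<lparr>mcarrier = lists (mcarrier E \<times> mcarrier M),
     madd = (@),
     mzero = [],
     mscale = (\<lambda>c. map (\<lambda>(x, f). (x, mscale M c f))),
     mact = (\<lambda>s a. map (\<lambda>(x, f). (x, mact M f a)) s),
     minner = (\<lambda>s t. \<Sum>(x, f)\<leftarrow>s. \<Sum>(x', f')\<leftarrow>t. minner M f (\<pi> (minner E x x') f'))\<rparr>"

definition interior_tensor ::
    "('e, 'b::unital_cstar_algebra) hmod \<Rightarrow> ('m, 'c::unital_cstar_algebra) hmod \<Rightarrow>
     ('b \<Rightarrow> 'm \<Rightarrow> 'm) \<Rightarrow> ((nat \<Rightarrow> ('e \<times> 'm) list) set, 'c) hmod" where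
  "interior_tensor E M \<pi> = completion (formal_tensors E M \<pi>)"

definition elem_tensor ::
    "('e, 'b::unital_cstar_algebra) hmod \<Rightarrow> ('m, 'c::unital_cstar_algebra) hmod \<Rightarrow>
     ('b \<Rightarrow> 'm \<Rightarrow> 'm) \<Rightarrow> 'e \<Rightarrow> 'm \<Rightarrow> (nat \<Rightarrow> ('e \<times> 'm) list) set" where
  "elem_tensor E M \<pi> x f = seq_class (formal_tensors E M \<pi>) (\<lambda>_. [(x, f)])"


section \<open>Representations and dynamical systems\<close>

text \<open>The group is a type of class \<^class>\<open>topological_group_add\<close>, the topological groups of the
  library. These are written additively but need not be commutative.\<close>

definition unitary_rep ::
    "('g::topological_group_add \<Rightarrow> 'a::unital_cstar_algebra) \<Rightarrow> bool" where
  "unitary_rep u \<longleftrightarrow>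
     (\<forall>t. unitary (u t)) \<and> (\<forall>s t. u (s + t) = u s * u t) \<and> continuous_on UNIV u"

definition unitary_rep_on ::
    "('m, 'a::unital_cstar_algebra) hmod \<Rightarrow> ('g::topological_group_add \<Rightarrow> 'm \<Rightarrow> 'm) \<Rightarrow> bool" where
  "unitary_rep_on M v \<longleftrightarrow>
     (\<forall>t. unitary_op M (v t)) \<and>
     (\<forall>s t. \<forall>m\<in>mcarrier M. v (s + t) m = v s (v t m)) \<and>
     (\<forall>m\<in>mcarrier M. mcontinuous M (\<lambda>t. v t m))"

definition hmod_morphism :: "('e, 'b::unital_cstar_algebra) hmod \<Rightarrow> ('e \<Rightarrow> 'e) \<Rightarrow> bool" where
  "hmod_morphism E \<Psi> \<longleftrightarrow> \<Psi> \<in> mcarrier E \<rightarrow> mcarrier E \<and>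
     (\<exists>\<psi>. star_hom \<psi> \<and>
       (\<forall>x\<in>mcarrier E. \<forall>y\<in>mcarrier E. minner E (\<Psi> x) (\<Psi> y) = \<psi> (minner E x y)))"

definition hmod_aut :: "('e, 'b::unital_cstar_algebra) hmod \<Rightarrow> ('e \<Rightarrow> 'e) \<Rightarrow> bool" where
  "hmod_aut E \<Psi> \<longleftrightarrow> bij_betw \<Psi> (mcarrier E) (mcarrier E) \<and>
     hmod_morphism E \<Psi> \<and> hmod_morphism E (inv_into (mcarrier E) \<Psi>)"

definition dynamical_system ::
    "('g::topological_group_add \<Rightarrow> 'e \<Rightarrow> 'e) \<Rightarrow> ('e, 'b::unital_cstar_algebra) hmod \<Rightarrow> bool" where
  "dynamical_system \<eta> E \<longleftrightarrow>
     (\<forall>t. hmod_aut E (\<eta> t)) \<and>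
     (\<forall>s t. \<forall>x\<in>mcarrier E. \<eta> (s + t) x = \<eta> s (\<eta> t x)) \<and>
     (\<forall>x\<in>mcarrier E. mcontinuous E (\<lambda>t. \<eta> t x))"

definition cstar_dynamical_system ::
    "('g::topological_group_add \<Rightarrow> 'b::unital_cstar_algebra \<Rightarrow> 'b) \<Rightarrow> bool" where
  "cstar_dynamical_system \<alpha> \<longleftrightarrow>
     (\<forall>t. star_hom (\<alpha> t) \<and> bij (\<alpha> t)) \<and>
     (\<forall>s t b. \<alpha> (s + t) b = \<alpha> s (\<alpha> t b)) \<and>
     (\<forall>b. continuous_on UNIV (\<lambda>t. \<alpha> t b))"

definition induced_system ::
    "('g::topological_group_add \<Rightarrow> 'e \<Rightarrow> 'e) \<Rightarrow> ('e, 'b::unital_cstar_algebra) hmod \<Rightarrow>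
     'g \<Rightarrow> 'b \<Rightarrow> 'b" where
  "induced_system \<eta> E = (THE \<alpha>. cstar_dynamical_system \<alpha> \<and>
     (\<forall>t. \<forall>x\<in>mcarrier E. \<forall>y\<in>mcarrier E.
        \<alpha> t (minner E x y) = minner E (\<eta> t x) (\<eta> t y)))"


section \<open>Kernels, families and covariant dilations\<close>

definition cpd_kernel ::
    "'s set \<Rightarrow> ('s \<Rightarrow> 's \<Rightarrow> 'b::unital_cstar_algebra \<Rightarrow> 'c::unital_cstar_algebra) \<Rightarrow> bool" where
  "cpd_kernel S \<KK> \<longleftrightarrow>
     (\<forall>\<sigma>\<in>S. \<forall>\<sigma>'\<in>S. bounded_clinear (\<KK> \<sigma> \<sigma>')) \<and>
     (\<forall>(n::nat) \<sigma> b c. (\<forall>i<n. \<sigma> i \<in> S) \<longrightarrow>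
        positive (\<Sum>i<n. \<Sum>j<n. star (c i) * \<KK> (\<sigma> i) (\<sigma> j) (star (b i) * b j) * c j))"

definition kernel_family ::
    "'s set \<Rightarrow> ('s \<Rightarrow> 's \<Rightarrow> 'b::unital_cstar_algebra \<Rightarrow> 'c::unital_cstar_algebra) \<Rightarrow>
     ('e, 'b) hmod \<Rightarrow> ('f, 'c) hmod \<Rightarrow> ('s \<Rightarrow> 'e \<Rightarrow> 'f) \<Rightarrow> bool" where
  "kernel_family S \<KK> E F K \<longleftrightarrow>
     (\<forall>\<sigma>\<in>S. \<forall>\<sigma>'\<in>S. \<forall>x\<in>mcarrier E. \<forall>x'\<in>mcarrier E.
        minner F (K \<sigma> x) (K \<sigma>' x') = \<KK> \<sigma> \<sigma>' (minner E x x'))"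

definition covariant_family ::
    "('g \<Rightarrow> 'd::unital_cstar_algebra) \<Rightarrow> ('g \<Rightarrow> 'c::unital_cstar_algebra) \<Rightarrow>
     ('g \<Rightarrow> 'e \<Rightarrow> 'e) \<Rightarrow> 's set \<Rightarrow> ('e, 'b::unital_cstar_algebra) hmod \<Rightarrow>
     ('f, 'c) hmod \<Rightarrow> ('d \<Rightarrow> 'f \<Rightarrow> 'f) \<Rightarrow> ('s \<Rightarrow> 'e \<Rightarrow> 'f) \<Rightarrow> bool" where
  "covariant_family u' u \<eta> S E F \<phi> K \<longleftrightarrow>
     (\<forall>t. \<forall>\<sigma>\<in>S. \<forall>x\<in>mcarrier E. K \<sigma> (\<eta> t x) = mact F (\<phi> (u' t) (K \<sigma> x)) (star (u t)))"

definition covariant_dilation ::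
    "('g::topological_group_add \<Rightarrow> 'd::unital_cstar_algebra) \<Rightarrow>
     ('g \<Rightarrow> 'c::unital_cstar_algebra) \<Rightarrow> ('g \<Rightarrow> 'e \<Rightarrow> 'e) \<Rightarrow> 's set \<Rightarrow>
     ('e, 'b::unital_cstar_algebra) hmod \<Rightarrow> ('f, 'c) hmod \<Rightarrow> ('d \<Rightarrow> 'f \<Rightarrow> 'f) \<Rightarrow>
     ('s \<Rightarrow> 'e \<Rightarrow> 'f) \<Rightarrow>
     ('m, 'c) hmod \<Rightarrow> ('b \<Rightarrow> 'm \<Rightarrow> 'm) \<Rightarrow> ('s \<Rightarrow> 'm) \<Rightarrow>
     ((nat \<Rightarrow> ('e \<times> 'm) list) set \<Rightarrow> 'f) \<Rightarrow> ('g \<Rightarrow> 'm \<Rightarrow> 'm) \<Rightarrow>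
     ('g \<Rightarrow> (nat \<Rightarrow> ('e \<times> 'm) list) set \<Rightarrow> (nat \<Rightarrow> ('e \<times> 'm) list) set) \<Rightarrow> bool" where
  "covariant_dilation u' u \<eta> S E F \<phi> K \<F> \<pi> \<ii> \<nu> v w' \<longleftrightarrow>
     (let T = interior_tensor E \<F> \<pi>; tens = elem_tensor E \<F> \<pi>; \<alpha> = induced_system \<eta> E in
       cstar_correspondence \<F> \<pi> \<and>
       \<ii> \<in> S \<rightarrow> mcarrier \<F> \<and>
       isometry_on T F \<nu> \<and>
       (\<forall>x\<in>mcarrier E. \<forall>\<sigma>\<in>S. \<nu> (tens x (\<ii> \<sigma>)) = K \<sigma> x) \<and>
       unitary_rep_on \<F> v \<and>
       unitary_rep_on T w' \<and>
       (\<forall>b t. \<forall>f\<in>mcarrier \<F>. \<pi> (\<alpha> t b) f = v t (\<pi> b (adj \<F> (v t) f))) \<and>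
       (\<forall>t. \<forall>\<sigma>\<in>S. v t (\<ii> \<sigma>) = mact \<F> (\<ii> \<sigma>) (u t)) \<and>
       (\<forall>b c t. \<forall>x\<in>mcarrier E. \<forall>\<sigma>\<in>S.
          w' t (tens x (mact \<F> (\<pi> b (\<ii> \<sigma>)) c)) =
          tens (\<eta> t x) (v t (mact \<F> (\<pi> b (\<ii> \<sigma>)) c))) \<and>
       (\<forall>t. \<forall>z\<in>mcarrier T. \<nu> (w' t z) = \<phi> (u' t) (\<nu> z)))"

text \<open>A formula of HOL cannot quantify over the type underlying a module. The following type is
  large enough for the completion of the space of formal sums of terms \<open>b \<ii>(\<sigma>) c\<close>, and hence for the
  closed subcorrespondence generated by \<open>\<ii>(S)\<close> in any correspondence.\<close>

type_synonym ('b, 's, 'c) dilation_space = "(nat \<Rightarrow> ('b \<times> 's \<times> 'c) list) set"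

end

theory Submission
  imports Defs
begin

text \<open>If \<open>\<nu>\<close> is an isometry with \<open>\<nu> (x \<odot> \<ii> \<sigma>) = \<K>\<^sup>\<sigma> x\<close>, then \<open>b \<mapsto> \<langle>\<ii> \<sigma>, b \<ii> \<sigma>'\<rangle>\<close> is the required kernel.
  Conversely, a kernel turns the formal sums of terms \<open>b \<ii>(\<sigma>) c\<close> into a semi-inner product module,
  whose completion is \<open>\<F>\<close>. As \<open>E\<close> is full, covariance of the family gives
  \<open>\<KK>(\<alpha>\<^sub>t(b)) = u\<^sub>t \<KK>(b) u\<^sub>t\<^sup>*\<close>, so that \<open>b \<ii>(\<sigma>) c \<mapsto> \<alpha>\<^sub>t(b) \<ii>(\<sigma>) u\<^sub>t c\<close>, \<open>x \<odot> b \<ii>(\<sigma>) c \<mapsto> \<K>\<^sup>\<sigma>(x b) c\<close> and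
  \<open>x \<odot> f \<mapsto> \<eta>\<^sub>t(x) \<odot> v\<^sub>t f\<close> preserve the inner products and extend by continuity. Actions need not
  be unital: \<open>\<phi>(1)\<close> fixes the range of \<open>\<K>\<close> by covariance at \<open>t = 0\<close>, and \<open>x \<odot> f = x \<odot> \<pi>(1) f\<close>.\<close>

section \<open>Positive elements of C*-algebras\<close>

lemma star_one [simp]: "star (1 :: 'a::unital_cstar_algebra) = 1"
proof -
  have "star (star 1 * 1) = star 1 * star (star (1::'a))" by (simp only: star_mult)
  then show ?thesis by (simp add: star_star)
qed

lemma star_zero [simp]: "star (0 :: 'a::unital_cstar_algebra) = 0"
  using star_add[of "0::'a" 0] by simp

lemma star_minus: "star (- x) = - star (x :: 'a::unital_cstar_algebra)"
  using star_add[of x "-x"] by (simp add: minus_unique)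

lemma star_diff: "star (x - y) = star x - star (y :: 'a::unital_cstar_algebra)"
  using star_add[of x "-y"] by (simp add: star_minus)

lemma star_scaleR: "star (r *\<^sub>R x) = r *\<^sub>R star (x :: 'a::unital_cstar_algebra)"
  by (simp add: scaleR_scaleC star_scaleC)

lemma norm_star [simp]: "norm (star x) = norm (x :: 'a::unital_cstar_algebra)"
proof -
  have *: "norm y \<le> norm (star y)" for y :: 'a
  proof -
    have "norm y * norm y \<le> norm (star y) * norm y"
      using cstar_identity[of y] norm_mult_ineq[of "star y" y] by (simp add: power2_eq_square)
    then show ?thesis by (cases "norm y = 0") (auto simp: mult_le_cancel_right)
  qed
  show ?thesis using *[of x] *[of "star x"] by (simp add: star_star)
qed

lemma bounded_linear_star: "bounded_linear (star :: 'a::unital_cstar_algebra \<Rightarrow> 'a)"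
  by (rule bounded_linear_intro[of _ 1]) (auto simp: star_add star_scaleR)

lemmas tendsto_star = bounded_linear.tendsto[OF bounded_linear_star]

lemma norm_one_le: "norm (1 :: 'a::unital_cstar_algebra) \<le> 1"
proof -
  have "norm (1::'a) = (norm (1::'a))\<^sup>2" using cstar_identity[of "1::'a"] by simp
  then show ?thesis by (metis eq_iff power2_eq_square mult_cancel_left1 norm_ge_zero zero_le_one mult_1_right)
qed

lemma norm_scaleR_one_le: "norm (r *\<^sub>R (1 :: 'a::unital_cstar_algebra)) \<le> \<bar>r\<bar>"
  using norm_one_le[where 'a = 'a] by (simp add: mult_left_le)

lemma norm_selfadjoint_power:
  fixes h :: "'a::unital_cstar_algebra"
  assumes "star h = h"
  shows "norm (h ^ (2 ^ k)) = norm h ^ (2 ^ k)"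
proof (induction k)
  case (Suc k)
  have sa: "star (h ^ n) = h ^ n" for n
    by (induction n) (auto simp: star_mult assms power_commutes)
  have "h ^ (2 ^ Suc k) = star (h ^ (2 ^ k)) * h ^ (2 ^ k)"
    unfolding sa power_add[symmetric] by (simp add: mult_2)
  then have "norm (h ^ (2 ^ Suc k)) = (norm (h ^ (2 ^ k)))\<^sup>2" by (simp only: cstar_identity)
  then show ?case using Suc by (simp add: power_mult[symmetric] mult.commute)
qed simp

text \<open>\<open>z = lim z\<^sub>n\<close> solves \<open>2 z = w + z\<^sup>2\<close>, so \<open>1 - z\<close> is a square root of \<open>1 - w\<close>. The increments are
  dominated by those of the same iteration for the number \<open>1\<close>.\<close>

fun sqrt_seq :: "nat \<Rightarrow> real" where
  "sqrt_seq 0 = 0"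
| "sqrt_seq (Suc n) = (1 + (sqrt_seq n)\<^sup>2) / 2"

lemma sqrt_seq_bounds: "0 \<le> sqrt_seq n \<and> sqrt_seq n \<le> 1"
proof (induction n)
  case (Suc n)
  then have "(sqrt_seq n)\<^sup>2 \<le> 1" by (simp add: power_le_one)
  then show ?case by simp
qed simp

lemma sqrt_seq_incr: "sqrt_seq n \<le> sqrt_seq (Suc n)"
proof -
  have "0 \<le> (1 - sqrt_seq n)\<^sup>2" by simp
  then show ?thesis by (simp add: power2_diff field_simps)
qed

lemma sqrt_seq_convergent: "convergent sqrt_seq"
proof (rule Bseq_mono_convergent)
  show "Bseq sqrt_seq" by (rule BseqI'[of _ 1]) (simp add: sqrt_seq_bounds)
  show "\<forall>n. \<forall>m\<ge>n. sqrt_seq n \<le> sqrt_seq m"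
    using incseq_SucI[of sqrt_seq, OF sqrt_seq_incr] by (simp add: incseq_def)
qed

fun sqrt_iter :: "'a::unital_cstar_algebra \<Rightarrow> nat \<Rightarrow> 'a" where
  "sqrt_iter w 0 = 0"
| "sqrt_iter w (Suc n) = (1/2) *\<^sub>R (w + sqrt_iter w n * sqrt_iter w n)"

lemma sqrt_iter_commute: "y * w = w * y \<Longrightarrow> y * sqrt_iter w n = sqrt_iter w n * y"
proof (induction n)
  case (Suc n)
  then have "y * (sqrt_iter w n * sqrt_iter w n) = sqrt_iter w n * sqrt_iter w n * y"
    by (metis mult.assoc)
  then show ?case by (simp add: ring_distribs Suc)
qed simp

lemma star_sqrt_iter: "star w = w \<Longrightarrow> star (sqrt_iter w n) = sqrt_iter w n"
  by (induction n) (auto simp: star_scaleR star_add star_mult)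

lemma norm_sqrt_iter:
  assumes "norm w \<le> 1"
  shows "norm (sqrt_iter w n) \<le> sqrt_seq n"
proof (induction n)
  case (Suc n)
  have "norm (w + sqrt_iter w n * sqrt_iter w n) \<le> 1 + sqrt_seq n * sqrt_seq n"
    by (intro norm_triangle_le add_mono assms order_trans[OF norm_mult_ineq] mult_mono Suc)
      (auto simp: sqrt_seq_bounds)
  then show ?case by (simp add: power2_eq_square)
qed simp

lemma norm_sqrt_iter_increment:
  assumes "norm w \<le> 1"
  shows "norm (sqrt_iter w (Suc n) - sqrt_iter w n) \<le> sqrt_seq (Suc n) - sqrt_seq n"
proof (induction n)
  case (Suc n)
  let ?z = "sqrt_iter w" and ?s = sqrt_seq
  have c: "?z n * ?z (Suc n) = ?z (Suc n) * ?z n"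
    by (rule sqrt_iter_commute, rule sqrt_iter_commute[symmetric]) simp
  have e: "?z (Suc (Suc n)) - ?z (Suc n) = (1/2) *\<^sub>R ((?z (Suc n) - ?z n) * (?z (Suc n) + ?z n))"
  proof -
    have "?z (Suc (Suc n)) - ?z (Suc n)
        = (1/2) *\<^sub>R ((w + ?z (Suc n) * ?z (Suc n)) - (w + ?z n * ?z n))"
      by (simp only: sqrt_iter.simps scaleR_diff_right)
    also have "(w + ?z (Suc n) * ?z (Suc n)) - (w + ?z n * ?z n)
        = (?z (Suc n) - ?z n) * (?z (Suc n) + ?z n)"
      using c by (simp add: ring_distribs del: sqrt_iter.simps)
    finally show ?thesis .
  qed
  have "norm ((?z (Suc n) - ?z n) * (?z (Suc n) + ?z n)) \<le> (?s (Suc n) - ?s n) * (?s (Suc n) + ?s n)"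
    by (intro order_trans[OF norm_mult_ineq] mult_mono Suc norm_triangle_le add_mono
        norm_sqrt_iter assms) (use sqrt_seq_incr[of n] in auto)
  also have "\<dots> = 2 * (?s (Suc (Suc n)) - ?s (Suc n))"
    by (simp add: power2_eq_square field_simps)
  finally have "norm ((1/2) *\<^sub>R ((?z (Suc n) - ?z n) * (?z (Suc n) + ?z n))) \<le> ?s (Suc (Suc n)) - ?s (Suc n)"
    unfolding norm_scaleR by (simp del: sqrt_seq.simps sqrt_iter.simps)
  then show ?case unfolding e .
qed (use assms in simp)

lemma sqrt_exists:
  fixes y :: "'a::unital_cstar_algebra"
  assumes "star y = y" "norm (1 - y) \<le> 1"
  obtains s where "star s = s" "s * s = y" "norm (1 - s) \<le> 1"
    "\<And>x. x * y = y * x \<Longrightarrow> x * s = s * x"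
proof -
  define w where "w = 1 - y"
  let ?z = "sqrt_iter w"
  have w: "norm w \<le> 1" "star w = w" using assms by (auto simp: w_def star_diff)
  have mono: "norm (?z (n + k) - ?z n) \<le> sqrt_seq (n + k) - sqrt_seq n" for n k
  proof (induction k)
    case (Suc k)
    have "norm (?z (Suc (n + k)) - ?z n)
        \<le> norm (?z (Suc (n + k)) - ?z (n + k)) + norm (?z (n + k) - ?z n)"
      using norm_triangle_ineq[of "?z (Suc (n + k)) - ?z (n + k)" "?z (n + k) - ?z n"] by simp
    then show ?case using Suc norm_sqrt_iter_increment[OF w(1), of "n + k"] by simp
  qed simp
  have "Cauchy ?z"
  proof (rule metric_CauchyI)
    fix e :: real assume "e > 0"
    moreover have "Cauchy sqrt_seq" using sqrt_seq_convergent by (rule convergent_Cauchy)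
    ultimately obtain N where N: "\<And>m n. m \<ge> N \<Longrightarrow> n \<ge> N \<Longrightarrow> dist (sqrt_seq m) (sqrt_seq n) < e"
      by (meson metric_CauchyD)
    have *: "dist (?z m) (?z n) < e" if "n \<ge> N" "m \<ge> n" for m n
      using mono[of n "m - n"] N[of m n] that by (auto simp: dist_norm)
    show "\<exists>N. \<forall>m\<ge>N. \<forall>n\<ge>N. dist (?z m) (?z n) < e"
      by (intro exI[of _ N]) (metis * dist_commute nle_le)
  qed
  then obtain z where z: "?z \<longlonglongrightarrow> z" using Cauchy_convergent convergent_def by blast
  have "(\<lambda>n. ?z (Suc n)) \<longlonglongrightarrow> (1/2) *\<^sub>R (w + z * z)"
    unfolding sqrt_iter.simps by (intro tendsto_intros z)
  then have "z = (1/2) *\<^sub>R (w + z * z)" using LIMSEQ_Suc[OF z] LIMSEQ_unique by blast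
  then have "z + z = w + z * z" by (metis scaleR_half_double scaleR_right_distrib)
  then have sq: "(1 - z) * (1 - z) = y" by (simp add: ring_distribs w_def algebra_simps)
  have "star z = z"
    using tendsto_star[OF z] z LIMSEQ_unique unfolding star_sqrt_iter[OF w(2)] by blast
  moreover have "norm z \<le> 1"
    by (rule LIMSEQ_le_const2[OF tendsto_norm[OF z]])
      (meson norm_sqrt_iter[OF w(1)] order_trans sqrt_seq_bounds)
  moreover have "x * z = z * x" if "x * y = y * x" for x
  proof -
    have "x * w = w * x" using that by (simp add: w_def ring_distribs)
    then have "x * ?z n = ?z n * x" for n by (rule sqrt_iter_commute)
    then have "(\<lambda>n. ?z n * x) \<longlonglongrightarrow> x * z"
      using tendsto_mult[OF tendsto_const z, of x] by simp
    then show ?thesis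
      using LIMSEQ_unique tendsto_mult[OF z tendsto_const, of x] by blast
  qed
  ultimately show ?thesis
    by (intro that[of "1 - z"] sq) (simp_all add: star_diff right_diff_distrib left_diff_distrib)
qed

definition pos_cone :: "'a::unital_cstar_algebra set" where
  "pos_cone = {a. star a = a \<and> (\<exists>r\<ge>0. norm (r *\<^sub>R 1 - a) \<le> r)}"

lemma pos_cone_star: "a \<in> pos_cone \<Longrightarrow> star a = a"
  by (simp add: pos_cone_def)

lemma pos_cone_larger:
  assumes "norm (r *\<^sub>R 1 - a) \<le> r" "r \<le> r'"
  shows "norm (r' *\<^sub>R 1 - (a :: 'a::unital_cstar_algebra)) \<le> r'"
proof -
  have "r' *\<^sub>R 1 - a = (r' - r) *\<^sub>R 1 + (r *\<^sub>R 1 - a)" by (simp add: scaleR_left_diff_distrib)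
  then have "norm (r' *\<^sub>R 1 - a) \<le> norm ((r' - r) *\<^sub>R (1::'a)) + norm (r *\<^sub>R 1 - a)"
    by (metis norm_triangle_ineq)
  then show ?thesis using norm_scaleR_one_le[of "r' - r", where 'a = 'a] assms by linarith
qed

lemma pos_cone_add:
  assumes "a \<in> pos_cone" "b \<in> pos_cone" shows "a + b \<in> pos_cone"
proof -
  obtain r s where *: "r \<ge> 0" "norm (r *\<^sub>R 1 - a) \<le> r" "s \<ge> 0" "norm (s *\<^sub>R 1 - b) \<le> s"
    using assms by (auto simp: pos_cone_def)
  have "(r + s) *\<^sub>R 1 - (a + b) = (r *\<^sub>R 1 - a) + (s *\<^sub>R 1 - b)" by (simp add: scaleR_add_left)
  then have "norm ((r + s) *\<^sub>R 1 - (a + b)) \<le> r + s" using * norm_triangle_mono by metis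
  then show ?thesis using assms * unfolding pos_cone_def by (auto simp: star_add intro!: exI[of _ "r + s"])
qed

lemma pos_cone_scaleR:
  assumes "a \<in> pos_cone" "c \<ge> 0" shows "c *\<^sub>R a \<in> pos_cone"
proof -
  obtain r where *: "r \<ge> 0" "norm (r *\<^sub>R 1 - a) \<le> r" using assms by (auto simp: pos_cone_def)
  have "norm ((c * r) *\<^sub>R 1 - c *\<^sub>R a) = c * norm (r *\<^sub>R 1 - a)"
    by (metis abs_of_nonneg assms(2) norm_scaleR scaleR_diff_right scaleR_scaleR)
  then have "norm ((c * r) *\<^sub>R 1 - c *\<^sub>R a) \<le> c * r" using * assms by (simp add: mult_left_mono)
  then show ?thesis using assms * unfolding pos_cone_def
    by (auto simp: star_scaleR intro!: exI[of _ "c * r"])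
qed

lemma pos_cone_sqrt:
  fixes a :: "'a::unital_cstar_algebra"
  assumes "a \<in> pos_cone"
  obtains s where "star s = s" "s * s = a" "s \<in> pos_cone"
    "\<And>x. x * a = a * x \<Longrightarrow> x * s = s * x"
proof -
  obtain r where r: "r > 0" "norm (r *\<^sub>R 1 - a) \<le> r"
  proof -
    obtain r where "r \<ge> 0" "norm (r *\<^sub>R 1 - a) \<le> r" using assms by (auto simp: pos_cone_def)
    then show ?thesis using that[of "r + 1"] pos_cone_larger[of r a "r + 1"] by simp
  qed
  define y where "y = (1/r) *\<^sub>R a"
  have "1 - y = (1/r) *\<^sub>R (r *\<^sub>R 1 - a)" using r by (simp add: y_def scaleR_diff_right)
  then have "norm (1 - y) \<le> 1" using r by simp
  moreover have "star y = y" by (simp add: y_def star_scaleR pos_cone_star assms)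
  ultimately obtain s where s: "star s = s" "s * s = y" "norm (1 - s) \<le> 1"
    "\<And>x. x * y = y * x \<Longrightarrow> x * s = s * x" using sqrt_exists[of y] by blast
  have "s \<in> pos_cone" using s(1,3) by (auto simp: pos_cone_def intro!: exI[of _ 1])
  then have "sqrt r *\<^sub>R s \<in> pos_cone" using r(1) by (intro pos_cone_scaleR) auto
  moreover have "x * (sqrt r *\<^sub>R s) = (sqrt r *\<^sub>R s) * x" if "x * a = a * x" for x
  proof -
    have "x * y = y * x" by (simp add: y_def that)
    then have "x * s = s * x" by (rule s(4))
    then show ?thesis by simp
  qed
  moreover have "(sqrt r *\<^sub>R s) * (sqrt r *\<^sub>R s) = a" using r(1) s(2) by (simp add: y_def)
  moreover have "star (sqrt r *\<^sub>R s) = sqrt r *\<^sub>R s" by (simp add: star_scaleR s(1))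
  ultimately show ?thesis by (intro that)
qed

lemma norm_le_one_of_squares:
  fixes s d :: "'a::unital_cstar_algebra"
  assumes "star s = s" "star d = d" "s * d = d * s" "s * s + d * d = 1"
  shows "norm s \<le> 1"
proof -
  define p where "p = s + \<i> *\<^sub>C d"
  have sp: "star p = s + (- \<i>) *\<^sub>C d" by (simp add: p_def star_add star_scaleC assms)
  have "star p * p = (s + (- \<i>) *\<^sub>C d) * p" by (simp only: sp)
  also have "\<dots> = s * s + d * d"
    unfolding p_def
    by (simp add: ring_distribs scaleC_mult_left scaleC_mult_right scaleC_scaleC scaleC_one assms(1-3)
        complex_vector.scale_right_diff_distrib)
  finally have "star p * p = s * s + d * d" .
  then have "(norm p)\<^sup>2 \<le> 1" using cstar_identity[of p] norm_one_le[where 'a = 'a] assms by simp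
  then have p: "norm p \<le> 1" by (simp add: power2_le_iff_abs_le abs_le_square_iff[of _ 1, symmetric] power_le_one_iff)
  have "p + star p = 2 *\<^sub>R s"
    unfolding sp by (simp add: p_def scaleR_2)
  then have "s = (1/2) *\<^sub>R (p + star p)" by simp
  then have "norm s \<le> (1/2) * (norm p + norm (star p))"
    by (metis norm_scaleR norm_triangle_ineq abs_of_nonneg mult_left_mono zero_le_divide_1_iff zero_le_numeral)
  then show ?thesis using p by simp
qed

lemma square_cone_bound:
  fixes s :: "'a::unital_cstar_algebra"
  assumes "star s = s" "(norm s)\<^sup>2 \<le> r"
  shows "norm (r *\<^sub>R 1 - s * s) \<le> r"
proof (cases "r = 0")
  case False
  then have r: "r > 0" using assms(2) order_trans[OF zero_le_power2 assms(2)] by simp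
  define q where "q = (1 / sqrt r) *\<^sub>R s"
  have q: "star q = q" "norm (q * q) \<le> 1" "q * q = (1/r) *\<^sub>R (s * s)"
  proof -
    have "norm (q * q) = (norm s)\<^sup>2 / r"
      using cstar_identity[of q] r
      by (simp add: q_def star_scaleR assms(1) power_divide)
    then show "norm (q * q) \<le> 1" using r assms by simp
  qed (use r in \<open>simp_all add: q_def star_scaleR assms(1)\<close>)
  have "norm (1 - (1 - q * q)) \<le> 1" "star (1 - q * q) = 1 - q * q"
    using q(1,2) by (auto simp: star_diff star_mult)
  then obtain d where d: "star d = d" "d * d = 1 - q * q"
    "\<And>x. x * (1 - q * q) = (1 - q * q) * x \<Longrightarrow> x * d = d * x"
    using sqrt_exists[of "1 - q * q"] by blast
  have "q * d = d * q" by (rule d(3)) (simp add: ring_distribs mult.assoc)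
  then have "norm d \<le> 1" using norm_le_one_of_squares[of d q] d(1,2) q(1) by simp
  then have "norm (d * d) \<le> 1" by (metis mult_le_one norm_ge_zero norm_mult_ineq order_trans)
  moreover have "r *\<^sub>R 1 - s * s = r *\<^sub>R (d * d)"
    using r by (simp add: d(2) q(3) scaleR_diff_right)
  ultimately show ?thesis using r by (simp add: mult_left_le)
qed (use assms in simp)

lemma square_in_pos_cone: "star s = s \<Longrightarrow> s * s \<in> pos_cone"
  using square_cone_bound[of s "(norm s)\<^sup>2"]
  by (auto simp: pos_cone_def star_mult intro!: exI[of _ "(norm s)\<^sup>2"])

lemma pos_cone_bound:
  assumes "a \<in> pos_cone" "norm a \<le> r"
  shows "norm (r *\<^sub>R 1 - a) \<le> r"
proof -
  obtain s where s: "star s = s" "s * s = a" using assms(1) by (rule pos_cone_sqrt)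
  have "(norm s)\<^sup>2 = norm a" using cstar_identity[of s] s by simp
  then show ?thesis using square_cone_bound[of s r] s assms by simp
qed

lemma norm_le_of_pos_cone:
  fixes a :: "'a::unital_cstar_algebra"
  assumes "a \<in> pos_cone" "r *\<^sub>R 1 - a \<in> pos_cone" "r > 0"
  shows "norm a \<le> r"
proof -
  define b where "b = (1/r) *\<^sub>R a"
  have "b \<in> pos_cone" "1 - b \<in> pos_cone"
    using pos_cone_scaleR[OF assms(1), of "1/r"] pos_cone_scaleR[OF assms(2), of "1/r"] assms(3)
    by (auto simp: b_def scaleR_diff_right)
  note b = this
  obtain s where s: "star s = s" "s * s = b" using b(1) by (rule pos_cone_sqrt)
  obtain d where d: "star d = d" "d * d = 1 - b" "\<And>x. x * (1 - b) = (1 - b) * x \<Longrightarrow> x * d = d * x"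
    using pos_cone_sqrt[OF b(2)] by blast
  have "s * (1 - s * s) = (1 - s * s) * s" by (simp add: ring_distribs mult.assoc)
  then have "s * d = d * s" unfolding s(2) by (rule d(3))
  then have "norm s \<le> 1" using norm_le_one_of_squares[of s d] d(1,2) s by simp
  then have "norm b \<le> 1" by (metis mult_le_one norm_ge_zero norm_mult_ineq order_trans s(2))
  then show ?thesis using assms(3) by (simp add: b_def field_simps)
qed

lemma pos_cone_antisym:
  assumes "a \<in> pos_cone" "- a \<in> pos_cone" shows "a = 0"
proof -
  have "norm a \<le> r" if "r > 0" for r
  proof -
    have "r *\<^sub>R 1 = (sqrt r *\<^sub>R 1) * (sqrt r *\<^sub>R (1::'a))" using that by simp
    then have "r *\<^sub>R (1::'a) \<in> pos_cone" using square_in_pos_cone[of "sqrt r *\<^sub>R (1::'a)"] that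
      by (simp add: star_scaleR)
    then have "r *\<^sub>R 1 + (- a) \<in> pos_cone" by (rule pos_cone_add[OF _ assms(2)])
    then show ?thesis using norm_le_of_pos_cone[OF assms(1) _ that] by simp
  qed
  then have "norm a \<le> 0" by (rule dense_ge)
  then show ?thesis by simp
qed

text \<open>For a selfadjoint \<open>h = r + y y\<^sup>*\<close> the norm is the limit of \<open>\<parallel>h\<^sup>n\<parallel>\<^sup>1\<^sup>/\<^sup>n\<close> along \<open>n = 2\<^sup>k\<close>, and
  \<open>h\<^sup>n - r\<^sup>n = y q (y\<^sup>* y) y\<^sup>*\<close> grows at most like \<open>n r\<^sup>n\<close>.\<close>

lemma neg_pos_cone_swap:
  fixes y :: "'a::unital_cstar_algebra"
  assumes "- (star y * y) \<in> pos_cone"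
  shows "- (y * star y) \<in> pos_cone"
proof -
  define r where "r = (norm y)\<^sup>2 + 1"
  define g where "g = r *\<^sub>R 1 + star y * y"
  define h where "h = r *\<^sub>R 1 + y * star y"
  have r: "r > 0" by (simp add: r_def add_nonneg_pos)
  have g: "norm g \<le> r"
    using pos_cone_bound[OF assms, of r] by (simp add: g_def r_def cstar_identity)
  have gn: "norm (g ^ n) \<le> r ^ n" for n
  proof (induction n)
    case 0 show ?case using norm_one_le by simp
  next
    case (Suc n) then show ?case using g r by (auto intro!: order_trans[OF norm_mult_ineq] mult_mono)
  qed
  have hn: "norm (h ^ n - r ^ n *\<^sub>R 1) \<le> real n * r ^ n" for n
  proof -
    have "\<exists>q. h ^ n - r ^ n *\<^sub>R 1 = y * q * star y \<and> norm q \<le> real n * r ^ n / r"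
    proof (induction n)
      case 0 show ?case by (rule exI[of _ 0]) simp
    next
      case (Suc n)
      then obtain q where q: "h ^ n - r ^ n *\<^sub>R 1 = y * q * star y" "norm q \<le> real n * r ^ n / r" by blast
      have hy: "h * y = y * g" by (simp add: h_def g_def ring_distribs mult.assoc)
      have "h ^ Suc n - r ^ Suc n *\<^sub>R 1 = h * (h ^ n - r ^ n *\<^sub>R 1) + r ^ n *\<^sub>R (h - r *\<^sub>R 1)"
        by (simp add: ring_distribs scaleR_diff_right)
      also have "h - r *\<^sub>R 1 = y * star y" by (simp add: h_def)
      also have "h * (h ^ n - r ^ n *\<^sub>R 1) = y * (g * q) * star y"
        by (simp only: q(1) mult.assoc[symmetric] hy)
      also have "y * (g * q) * star y + r ^ n *\<^sub>R (y * star y) = y * (g * q + r ^ n *\<^sub>R 1) * star y"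
        by (simp add: ring_distribs)
      finally have 1: "h ^ Suc n - r ^ Suc n *\<^sub>R 1 = y * (g * q + r ^ n *\<^sub>R 1) * star y" .
      have "norm (g * q) \<le> r * (real n * r ^ n / r)"
        by (intro order_trans[OF norm_mult_ineq] mult_mono g q(2)) (use r in auto)
      moreover have "norm (r ^ n *\<^sub>R (1::'a)) \<le> r ^ n"
        using norm_scaleR_one_le[of "r ^ n", where 'a = 'a] r by simp
      ultimately have "norm (g * q + r ^ n *\<^sub>R 1) \<le> r * (real n * r ^ n / r) + r ^ n"
        by (rule norm_triangle_mono)
      also have "\<dots> = real (Suc n) * r ^ Suc n / r" using r by (simp add: field_simps)
      finally show ?case using 1 by blast
    qed
    then obtain q where q: "h ^ n - r ^ n *\<^sub>R 1 = y * q * star y" "norm q \<le> real n * r ^ n / r" by blast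
    have "norm (y * q * star y) \<le> norm y * (real n * r ^ n / r) * norm y"
      by (intro order_trans[OF norm_mult_ineq] mult_mono q(2)) (use r in auto)
    also have "\<dots> = (norm y)\<^sup>2 * (real n * r ^ n / r)" by (simp add: power2_eq_square)
    also have "\<dots> \<le> r * (real n * r ^ n / r)" by (rule mult_right_mono) (use r in \<open>auto simp: r_def\<close>)
    finally show ?thesis using q(1) r by simp
  qed
  have bound: "norm (h ^ n) \<le> (real n + 1) * r ^ n" for n
  proof -
    have "norm (h ^ n) \<le> norm (h ^ n - r ^ n *\<^sub>R 1) + norm (r ^ n *\<^sub>R (1::'a))"
      by (metis diff_add_cancel norm_triangle_ineq)
    also have "\<dots> \<le> real n * r ^ n + r ^ n"
      using hn[of n] norm_scaleR_one_le[of "r ^ n", where 'a = 'a] zero_le_power[of r n] r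
      by (intro add_mono) linarith+
    finally show ?thesis by (simp add: field_simps)
  qed
  have h_sa: "star h = h" by (simp add: h_def star_add star_scaleR star_mult star_star)
  have "norm h \<le> r"
  proof (rule ccontr)
    assume "\<not> norm h \<le> r"
    then have gt: "norm h > r" by simp
    define x where "x = r / norm h"
    have nh: "norm h > 0" using gt r by linarith
    have x: "0 < x" "x < 1" using gt r nh by (simp_all add: x_def)
    have "(\<lambda>n. real n * x ^ n + x ^ n) \<longlonglongrightarrow> 0 + 0"
      by (intro tendsto_add powser_times_n_limit_0 LIMSEQ_power_zero) (use x in auto)
    moreover have "filterlim (\<lambda>k::nat. 2 ^ k :: nat) at_top sequentially"
      by (rule filterlim_subseq) (auto simp: strict_mono_def)
    ultimately have "(\<lambda>k. real (2 ^ k) * x ^ (2 ^ k) + x ^ (2 ^ k)) \<longlonglongrightarrow> 0 + 0"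
      by (rule filterlim_compose)
    moreover have "1 \<le> real (2 ^ k) * x ^ (2 ^ k) + x ^ (2 ^ k)" for k :: nat
      using bound[of "2 ^ k"] nh
      unfolding norm_selfadjoint_power[OF h_sa] x_def power_divide by (simp add: field_simps)
    ultimately have "1 \<le> 0 + (0::real)" by (intro LIMSEQ_le_const) auto
    then show False by simp
  qed
  then show ?thesis using r
    by (auto simp: pos_cone_def h_def star_mult star_minus star_star intro!: exI[of _ r])
qed

text \<open>With \<open>a = x\<^sup>* x\<close> and \<open>h = \<bar>a\<bar> - a\<close>, the element \<open>y = x h\<close> satisfies \<open>2 y\<^sup>* y = - h\<^sup>3\<close>, and \<open>h\<^sup>3\<close> is
  twice the square of \<open>\<bar>a\<bar>\<^sup>1\<^sup>/\<^sup>2 h\<close>. As \<open>y\<^sup>* y + y y\<^sup>*\<close> is a sum of squares, \<open>y\<^sup>* y\<close> lies in the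
  cone and in its negative, so \<open>h = 0\<close>.\<close>

lemma star_mult_self_in_pos_cone: "star x * x \<in> pos_cone"
proof -
  define a where "a = star x * x"
  have a: "star a = a" by (simp add: a_def star_mult star_star)
  obtain m where m: "star m = m" "m * m = a * a" "m \<in> pos_cone"
    "\<And>z. z * (a * a) = a * a * z \<Longrightarrow> z * m = m * z"
    using pos_cone_sqrt[OF square_in_pos_cone[OF a]] by blast
  have am: "a * m = m * a" by (rule m(4)) (simp add: mult.assoc)
  define h where "h = m - a"
  have h: "star h = h" by (simp add: h_def star_diff a m)
  have hm: "h * m = m * h" by (simp add: h_def ring_distribs am)
  obtain k where k: "star k = k" "k * k = m" "\<And>z. z * m = m * z \<Longrightarrow> z * k = k * z"
    using pos_cone_sqrt[OF m(3)] by blast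
  have hk: "h * k = k * h" by (rule k(3)[OF hm])
  have hh: "h * h = 2 *\<^sub>R (m * h)"
    by (simp add: h_def ring_distribs am m(2) scaleR_2)
  have ah: "a * h = - (1/2) *\<^sub>R (h * h)"
    by (simp add: hh) (simp add: h_def ring_distribs am m(2))
  define y where "y = x * h"
  have yy: "star y * y = - ((k * h) * (k * h))"
  proof -
    have "star y * y = h * (a * h)" by (simp add: y_def a_def star_mult h mult.assoc)
    also have "\<dots> = - (h * (m * h))" by (simp add: ah hh)
    also have "h * (m * h) = (k * h) * (k * h)" by (metis k(2) hk mult.assoc)
    finally show ?thesis .
  qed
  have kh: "star (k * h) = k * h" by (simp add: star_mult h k(1) hk)
  have neg: "- (star y * y) \<in> pos_cone" using square_in_pos_cone[OF kh] by (simp add: yy)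
  have sum: "star y * y + y * star y \<in> pos_cone"
  proof -
    define p where "p = (1/2) *\<^sub>R (y + star y)"
    define q where "q = (- \<i> / 2) *\<^sub>C (y - star y)"
    have p: "star p = p" by (simp add: p_def star_scaleR star_add star_star add.commute)
    have q: "star q = q"
      by (simp add: q_def star_scaleC star_diff star_star complex_vector.scale_right_diff_distrib)
    have pp: "p * p = (1/4) *\<^sub>R ((y + star y) * (y + star y))" by (simp add: p_def)
    have qq: "q * q = - (1/4) *\<^sub>R ((y - star y) * (y - star y))"
      by (simp add: q_def scaleC_mult_left scaleC_mult_right scaleC_scaleC scaleR_scaleC)
    have "2 *\<^sub>R (p * p + q * q) = (1/2) *\<^sub>R ((y + star y) * (y + star y) - (y - star y) * (y - star y))"
      unfolding pp qq by (simp add: scaleR_diff_right scaleR_add_right)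
    also have "(y + star y) * (y + star y) - (y - star y) * (y - star y) = 2 *\<^sub>R (star y * y + y * star y)"
      by (simp add: ring_distribs scaleR_2)
    finally have "star y * y + y * star y = 2 *\<^sub>R (p * p + q * q)" by simp
    then show ?thesis using p q by (metis square_in_pos_cone pos_cone_add pos_cone_scaleR zero_le_numeral)
  qed
  have "star y * y \<in> pos_cone"
    using pos_cone_add[OF sum neg_pos_cone_swap[OF neg]] by simp
  then have yz: "star y * y = 0" using neg pos_cone_antisym by blast
  then have "(k * h) * (k * h) = 0" using yy by simp
  then have "k * h = 0" using cstar_identity[of "k * h"] kh by simp
  then have "h * h = 0" using hh k(2) by (metis mult.assoc mult_zero_right scaleR_zero_right)
  then have "h = 0" using cstar_identity[of h] h by simp
  then show ?thesis using m(3) by (simp add: h_def a_def)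
qed

lemma positive_iff_pos_cone: "positive a \<longleftrightarrow> a \<in> pos_cone"
proof
  assume "a \<in> pos_cone"
  then obtain s where "star s = s" "s * s = a" by (rule pos_cone_sqrt)
  then show "positive a" unfolding positive_def by metis
qed (auto simp: positive_def star_mult_self_in_pos_cone)

lemma positive_star_mult [simp]: "positive (star x * x)"
  by (auto simp: positive_def)

lemma positive_zero [simp]: "positive 0"
  using positive_star_mult[of 0] by simp

lemma positive_star: "positive a \<Longrightarrow> star a = a"
  by (auto simp: positive_def star_mult star_star)

lemma positive_add: "positive a \<Longrightarrow> positive b \<Longrightarrow> positive (a + b)"
  by (simp add: positive_iff_pos_cone pos_cone_add)

lemma positive_scaleR: "positive a \<Longrightarrow> 0 \<le> r \<Longrightarrow> positive (r *\<^sub>R a)"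
  by (simp add: positive_iff_pos_cone pos_cone_scaleR)

lemma positive_conj: "positive a \<Longrightarrow> positive (star y * a * y)"
  unfolding positive_def by (metis mult.assoc star_mult)

lemma positive_norm_diff:
  assumes "positive a" "norm a \<le> r" shows "positive (r *\<^sub>R 1 - a)"
proof -
  have "norm (r *\<^sub>R 1 - (r *\<^sub>R 1 - a)) \<le> r" "0 \<le> r"
    using assms(2) norm_ge_zero[of a] by (simp, linarith)
  then show ?thesis using assms(1)
    by (auto simp: positive_iff_pos_cone pos_cone_def star_diff star_scaleR intro!: exI[of _ r])
qed

lemma positive_norm_square_diff: "positive ((norm a)\<^sup>2 *\<^sub>R 1 - star a * a)"
  by (rule positive_norm_diff) (simp_all add: cstar_identity)

lemma positive_norm_mono:
  assumes "positive a" "positive (b - a)"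
  shows "norm a \<le> norm b"
proof (rule field_le_epsilon)
  fix e :: real assume e: "e > 0"
  have "positive b" using positive_add[OF assms] by simp
  then have "positive ((norm b + e) *\<^sub>R 1 - b)" using e by (intro positive_norm_diff) auto
  then have "positive ((norm b + e) *\<^sub>R 1 - a)" using positive_add[OF _ assms(2)] by fastforce
  then show "norm a \<le> norm b + e"
    using norm_le_of_pos_cone[of a "norm b + e"] assms(1) e
    by (simp add: positive_iff_pos_cone add_nonneg_pos)
qed

lemma positive_closed: "closed {a. positive a}"
  unfolding closed_sequential_limits
proof (intro allI impI, elim conjE)
  fix f and a :: 'a
  assume f: "\<forall>n. f n \<in> {a. positive a}" "f \<longlonglongrightarrow> a"
  obtain r where r: "\<And>n. norm (f n) \<le> r"
    using f(2) by (meson Bseq_def convergentI convergent_imp_Bseq)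
  have "norm (r *\<^sub>R 1 - f n) \<le> r" for n using f(1) r
    by (auto simp: positive_iff_pos_cone intro: pos_cone_bound)
  then have "norm (r *\<^sub>R 1 - a) \<le> r"
    by (intro LIMSEQ_le_const2[OF tendsto_norm[OF tendsto_diff[OF tendsto_const f(2)]]]) auto
  moreover have "star a = a"
    using tendsto_star[OF f(2)] f by (simp add: positive_star) (metis LIMSEQ_unique)
  moreover have "r \<ge> 0" using r norm_ge_zero order_trans by blast
  ultimately show "a \<in> {a. positive a}" by (auto simp: positive_iff_pos_cone pos_cone_def)
qed

lemma positive_tendsto:
  assumes "(f \<longlongrightarrow> a) F" "F \<noteq> bot" "\<forall>\<^sub>F n in F. positive (f n)"
  shows "positive a"
  using Lim_in_closed_set[OF positive_closed _ assms(2,1)] assms(3) by simp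

lemma star_hom_norm_le:
  assumes "star_hom \<psi>" shows "norm (\<psi> a) \<le> norm a"
proof -
  have add: "\<psi> (x + y) = \<psi> x + \<psi> y" and mult: "\<psi> (x * y) = \<psi> x * \<psi> y"
    and scale: "\<psi> (c *\<^sub>C x) = c *\<^sub>C \<psi> x" and st: "\<psi> (star x) = star (\<psi> x)" for x y c
    using assms by (auto simp: star_hom_def)
  have proj: "norm (\<psi> 1) \<le> 1"
  proof -
    have "star (\<psi> 1) * \<psi> 1 = \<psi> 1" by (metis mult st star_one mult_1)
    then have "norm (\<psi> 1) = norm (\<psi> 1) * norm (\<psi> 1)"
      using cstar_identity[of "\<psi> 1"] by (simp add: power2_eq_square)
    then show ?thesis by (cases "norm (\<psi> 1) = 0") auto
  qed
  obtain d where d: "(norm a)\<^sup>2 *\<^sub>R 1 - star a * a = star d * d"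
    using positive_norm_square_diff[of a] by (auto simp: positive_def)
  then have "\<psi> ((norm a)\<^sup>2 *\<^sub>R 1) = star (\<psi> d) * \<psi> d + star (\<psi> a) * \<psi> a"
    by (metis add mult st diff_add_cancel)
  then have "(norm a)\<^sup>2 *\<^sub>R \<psi> 1 - star (\<psi> a) * \<psi> a = star (\<psi> d) * \<psi> d"
    by (simp add: scaleR_scaleC scale)
  then have "norm (star (\<psi> a) * \<psi> a) \<le> norm ((norm a)\<^sup>2 *\<^sub>R \<psi> 1)"
    by (intro positive_norm_mono) auto
  also have "\<dots> \<le> (norm a)\<^sup>2" using proj by (simp add: mult_left_le)
  finally show ?thesis by (simp add: cstar_identity power2_le_iff_abs_le)
qed

section \<open>Semi-inner product modules\<close>

text \<open>Only the closure properties and the form are axiomatised: on formal sums the module laws hold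
  merely up to null vectors, which is what \<open>mdist_eq_0I\<close> expresses.\<close>

locale semi_inner_module =
  fixes M :: "('m, 'a::unital_cstar_algebra) hmod"
  assumes si_add_closed [simp, intro]: "\<lbrakk>x \<in> mcarrier M; y \<in> mcarrier M\<rbrakk> \<Longrightarrow> madd M x y \<in> mcarrier M"
    and si_zero_closed [simp, intro]: "mzero M \<in> mcarrier M"
    and si_scale_closed [simp, intro]: "x \<in> mcarrier M \<Longrightarrow> mscale M c x \<in> mcarrier M"
    and si_act_closed [simp, intro]: "x \<in> mcarrier M \<Longrightarrow> mact M x a \<in> mcarrier M"
    and si_add: "\<lbrakk>x \<in> mcarrier M; y \<in> mcarrier M; z \<in> mcarrier M\<rbrakk>
      \<Longrightarrow> minner M x (madd M y z) = minner M x y + minner M x z"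
    and si_scale: "\<lbrakk>x \<in> mcarrier M; y \<in> mcarrier M\<rbrakk>
      \<Longrightarrow> minner M x (mscale M c y) = c *\<^sub>C minner M x y"
    and si_act: "\<lbrakk>x \<in> mcarrier M; y \<in> mcarrier M\<rbrakk>
      \<Longrightarrow> minner M x (mact M y a) = minner M x y * a"
    and si_zero: "x \<in> mcarrier M \<Longrightarrow> minner M x (mzero M) = 0"
    and si_star: "\<lbrakk>x \<in> mcarrier M; y \<in> mcarrier M\<rbrakk>
      \<Longrightarrow> star (minner M x y) = minner M y x"
    and si_positive: "x \<in> mcarrier M \<Longrightarrow> positive (minner M x x)"

sublocale hilbert_module \<subseteq> semi_inner_module
proof
  fix x assume x: "x \<in> mcarrier M"
  have "minner M x (mzero M) = minner M x (madd M (mzero M) (mzero M))"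
    by (simp add: add_zero zero_closed)
  then show "minner M x (mzero M) = 0" by (simp add: inner_add x zero_closed)
qed (simp_all add: add_closed zero_closed scale_closed act_closed inner_add inner_scale inner_act
    inner_star inner_positive)

definition mtends :: "('m, 'a::unital_cstar_algebra) hmod \<Rightarrow> ('i \<Rightarrow> 'm) \<Rightarrow> 'm \<Rightarrow> 'i filter \<Rightarrow> bool" where
  "mtends M f l F \<longleftrightarrow> l \<in> mcarrier M \<and> (\<forall>i. f i \<in> mcarrier M) \<and> ((\<lambda>i. mdist M (f i) l) \<longlongrightarrow> 0) F"

context semi_inner_module
begin

definition sub where "sub x y = madd M x (mscale M (-1) y)"

lemma sub_closed [simp, intro]: "x \<in> mcarrier M \<Longrightarrow> y \<in> mcarrier M \<Longrightarrow> sub x y \<in> mcarrier M"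
  by (simp add: sub_def)

lemma si_add_left: "\<lbrakk>x \<in> mcarrier M; y \<in> mcarrier M; z \<in> mcarrier M\<rbrakk>
    \<Longrightarrow> minner M (madd M x y) z = minner M x z + minner M y z"
  by (simp add: si_add star_add si_star flip: si_star[of z "madd M x y"])

lemma si_scale_left: "\<lbrakk>x \<in> mcarrier M; y \<in> mcarrier M\<rbrakk>
    \<Longrightarrow> minner M (mscale M c x) y = cnj c *\<^sub>C minner M x y"
  by (simp add: si_scale star_scaleC si_star flip: si_star[of y "mscale M c x"])

lemma si_act_left: "\<lbrakk>x \<in> mcarrier M; y \<in> mcarrier M\<rbrakk>
    \<Longrightarrow> minner M (mact M x a) y = star a * minner M x y"
  by (simp add: si_act star_mult si_star flip: si_star[of y "mact M x a"])

lemma si_zero_left: "x \<in> mcarrier M \<Longrightarrow> minner M (mzero M) x = 0"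
  by (simp add: si_zero flip: si_star[of x "mzero M"])

lemma scaleC_minus_one: "(-1) *\<^sub>C a = - (a :: 'z::complex_vector)"
  using complex_vector.scale_minus_left[of 1 a] by (simp add: scaleC_one)

lemma si_sub: "\<lbrakk>x \<in> mcarrier M; y \<in> mcarrier M; z \<in> mcarrier M\<rbrakk>
    \<Longrightarrow> minner M x (sub y z) = minner M x y - minner M x z"
  by (simp add: sub_def si_add si_scale scaleC_minus_one)

lemma si_sub_left: "\<lbrakk>x \<in> mcarrier M; y \<in> mcarrier M; z \<in> mcarrier M\<rbrakk>
    \<Longrightarrow> minner M (sub x y) z = minner M x z - minner M y z"
  by (simp add: sub_def si_add_left si_scale_left scaleC_minus_one)

lemma mnorm_nonneg [simp]: "0 \<le> mnorm M x"
  by (simp add: mnorm_def)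

lemma mnorm_square: "(mnorm M x)\<^sup>2 = norm (minner M x x)"
  by (simp add: mnorm_def)

lemma mnorm_le_iff: "0 \<le> r \<Longrightarrow> mnorm M x \<le> r \<longleftrightarrow> norm (minner M x x) \<le> r\<^sup>2"
  using real_sqrt_le_iff[of "norm (minner M x x)" "r\<^sup>2"] by (simp add: mnorm_def)

lemma cauchy_schwarz_order:
  assumes "x \<in> mcarrier M" "y \<in> mcarrier M" "norm (minner M x x) \<le> r" "r > 0"
  shows "positive (r *\<^sub>R minner M y y - star (minner M x y) * minner M x y)"
proof -
  define a where "a = minner M x y"
  define z where "z = sub (mact M x a) (mscale M (complex_of_real r) y)"
  have yx: "minner M y x = star a" using assms by (simp add: a_def si_star)
  have "minner M z z = star a * minner M x x * a - r *\<^sub>R (star a * a) - (r *\<^sub>R (star a * a) - r *\<^sub>R r *\<^sub>R minner M y y)"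
    using assms(1,2)
    by (simp add: z_def si_sub si_sub_left si_act si_act_left si_scale si_scale_left yx
        a_def[symmetric] mult.assoc scaleC_mult_left scaleC_mult_right left_diff_distrib
        scaleR_diff_right flip: scaleR_scaleC)
  moreover have "positive (minner M z z)" using assms by (intro si_positive) (simp add: z_def)
  moreover have "positive (star a * (r *\<^sub>R 1 - minner M x x) * a)"
    using assms by (intro positive_conj positive_norm_diff si_positive)
  ultimately have "positive (star a * minner M x x * a - r *\<^sub>R (star a * a) - (r *\<^sub>R (star a * a) - r *\<^sub>R r *\<^sub>R minner M y y)
      + star a * (r *\<^sub>R 1 - minner M x x) * a)"
    using positive_add by metis
  also have "star a * minner M x x * a - r *\<^sub>R (star a * a) - (r *\<^sub>R (star a * a) - r *\<^sub>R r *\<^sub>R minner M y y)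
      + star a * (r *\<^sub>R 1 - minner M x x) * a = r *\<^sub>R (r *\<^sub>R minner M y y - star a * a)"
    by (simp add: left_diff_distrib right_diff_distrib scaleR_diff_right)
  finally have "positive ((1/r) *\<^sub>R (r *\<^sub>R (r *\<^sub>R minner M y y - star a * a)))"
    by (rule positive_scaleR) (use assms(4) in simp)
  moreover have "(1/r) *\<^sub>R (r *\<^sub>R z) = z" for z :: 'a using assms(4) by simp
  ultimately show ?thesis by (simp only: a_def)
qed

lemma cauchy_schwarz:
  assumes "x \<in> mcarrier M" "y \<in> mcarrier M"
  shows "norm (minner M x y) \<le> mnorm M x * mnorm M y"
proof -
  have "(norm (minner M x y))\<^sup>2 \<le> norm (minner M x x) * norm (minner M y y) + e" if e: "e > 0" for e
  proof -
    define d where "d = e / (norm (minner M y y) + 1)"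
    have n: "norm (minner M y y) + 1 > 0" by (simp add: add_nonneg_pos)
    have d: "d > 0" "d * norm (minner M y y) \<le> e"
      using e n by (simp_all add: d_def pos_divide_le_eq)
    define r where "r = norm (minner M x x) + d"
    have r: "r > 0" using d by (simp add: r_def add_nonneg_pos)
    have "norm (star (minner M x y) * minner M x y) \<le> norm (r *\<^sub>R minner M y y)"
      by (rule positive_norm_mono) (use assms r d in \<open>auto intro!: cauchy_schwarz_order simp: r_def\<close>)
    then have "(norm (minner M x y))\<^sup>2 \<le> r * norm (minner M y y)" using r by (simp add: cstar_identity)
    then show ?thesis using d by (simp add: r_def distrib_right)
  qed
  then have "(norm (minner M x y))\<^sup>2 \<le> norm (minner M x x) * norm (minner M y y)"
    by (rule field_le_epsilon)
  then have "(norm (minner M x y))\<^sup>2 \<le> (mnorm M x * mnorm M y)\<^sup>2"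
    by (simp add: power_mult_distrib mnorm_square)
  then show ?thesis by (rule power2_le_imp_le) simp
qed

lemma mnorm_le_of_inner:
  assumes "x \<in> mcarrier M" "y \<in> mcarrier M" "minner M y y = minner M x y"
  shows "mnorm M y \<le> mnorm M x"
proof -
  have "(mnorm M y)\<^sup>2 \<le> mnorm M x * mnorm M y"
    using cauchy_schwarz[OF assms(1,2)] assms(3) by (simp add: mnorm_square)
  then have "mnorm M y = 0 \<or> mnorm M y \<le> mnorm M x"
    using mnorm_nonneg[of y] by (force simp: power2_eq_square mult_le_cancel_right)
  then show ?thesis by auto
qed

lemma mnorm_triangle:
  assumes "x \<in> mcarrier M" "y \<in> mcarrier M"
  shows "mnorm M (madd M x y) \<le> mnorm M x + mnorm M y"
proof (subst mnorm_le_iff)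
  have "minner M (madd M x y) (madd M x y)
      = (minner M x x + minner M x y) + (minner M y x + minner M y y)"
    using assms by (simp add: si_add si_add_left algebra_simps)
  also have "norm \<dots> \<le> (mnorm M x * mnorm M x + mnorm M x * mnorm M y)
      + (mnorm M y * mnorm M x + mnorm M y * mnorm M y)"
    using assms by (intro norm_triangle_mono cauchy_schwarz)
  finally show "norm (minner M (madd M x y) (madd M x y)) \<le> (mnorm M x + mnorm M y)\<^sup>2"
    by (simp add: power2_eq_square algebra_simps)
qed simp

lemma mnorm_scale:
  assumes "x \<in> mcarrier M" shows "mnorm M (mscale M c x) = cmod c * mnorm M x"
  using assms by (simp add: mnorm_def si_scale si_scale_left norm_scaleC real_sqrt_mult
      complex_vector.scale_scale norm_mult)

lemma mnorm_act_le:
  assumes "x \<in> mcarrier M" shows "mnorm M (mact M x a) \<le> mnorm M x * norm a"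
proof (subst mnorm_le_iff)
  have "norm (minner M (mact M x a) (mact M x a)) \<le> norm a * norm (minner M x x) * norm a"
    using assms unfolding si_act[OF si_act_closed[OF assms] assms] si_act_left[OF assms assms]
    by (intro order_trans[OF norm_mult_ineq] mult_right_mono) (simp_all add: order_trans[OF norm_mult_ineq])
  then show "norm (minner M (mact M x a) (mact M x a)) \<le> (mnorm M x * norm a)\<^sup>2"
    by (simp add: power_mult_distrib mnorm_square) (simp add: power2_eq_square mult_ac)
qed simp

lemma mdist_sub: "mdist M x y = mnorm M (sub x y)"
  by (simp add: mdist_def sub_def)

lemma mdist_nonneg [simp]: "0 \<le> mdist M x y"
  by (simp add: mdist_sub)

lemma mdist_square:
  assumes "x \<in> mcarrier M" "y \<in> mcarrier M"
  shows "(mdist M x y)\<^sup>2 = norm (minner M x x - minner M x y - minner M y x + minner M y y)"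
  using assms by (simp add: mdist_sub mnorm_square si_sub si_sub_left algebra_simps)

lemma mdist_eq_0I:
  assumes "x \<in> mcarrier M" "y \<in> mcarrier M"
    and "\<And>z. z \<in> mcarrier M \<Longrightarrow> minner M z x = minner M z y"
  shows "mdist M x y = 0"
proof -
  have "minner M (sub x y) (sub x y) = 0" using assms by (simp add: si_sub[of "sub x y"])
  then show ?thesis by (simp add: mdist_sub mnorm_def)
qed

lemma mnorm_cong:
  assumes "x \<in> mcarrier M" "y \<in> mcarrier M"
    and "\<And>z. z \<in> mcarrier M \<Longrightarrow> minner M z x = minner M z y"
  shows "mnorm M x = mnorm M y"
  using assms si_star by (metis mnorm_def)

lemma mdist_self: "x \<in> mcarrier M \<Longrightarrow> mdist M x x = 0"
  by (rule mdist_eq_0I) auto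

lemma mdist_commute:
  assumes "x \<in> mcarrier M" "y \<in> mcarrier M" shows "mdist M x y = mdist M y x"
  using mdist_square[OF assms] mdist_square[OF assms(2,1)] mdist_nonneg
  by (metis (no_types, lifting) add.commute diff_diff_eq diff_add_eq power2_eq_imp_eq)

lemma mdist_triangle:
  assumes "x \<in> mcarrier M" "y \<in> mcarrier M" "z \<in> mcarrier M"
  shows "mdist M x z \<le> mdist M x y + mdist M y z"
proof -
  have "mnorm M (sub x z) = mnorm M (madd M (sub x y) (sub y z))"
    using assms by (intro mnorm_cong) (auto simp: si_sub si_add)
  then show ?thesis using mnorm_triangle[of "sub x y" "sub y z"] assms by (simp add: mdist_sub)
qed

lemma mdist_add_le:
  assumes "x \<in> mcarrier M" "y \<in> mcarrier M" "x' \<in> mcarrier M" "y' \<in> mcarrier M"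
  shows "mdist M (madd M x y) (madd M x' y') \<le> mdist M x x' + mdist M y y'"
proof -
  have "mnorm M (sub (madd M x y) (madd M x' y')) = mnorm M (madd M (sub x x') (sub y y'))"
    using assms by (intro mnorm_cong) (auto simp: si_sub si_add)
  then show ?thesis using mnorm_triangle[of "sub x x'" "sub y y'"] assms by (simp add: mdist_sub)
qed

lemma mdist_scale:
  assumes "x \<in> mcarrier M" "x' \<in> mcarrier M"
  shows "mdist M (mscale M c x) (mscale M c x') = cmod c * mdist M x x'"
proof -
  have "mnorm M (sub (mscale M c x) (mscale M c x')) = mnorm M (mscale M c (sub x x'))"
    using assms
    by (intro mnorm_cong) (auto simp: si_sub si_scale complex_vector.scale_right_diff_distrib)
  then show ?thesis using assms by (simp add: mdist_sub mnorm_scale)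
qed

lemma mdist_act_le:
  assumes "x \<in> mcarrier M" "x' \<in> mcarrier M"
  shows "mdist M (mact M x a) (mact M x' a) \<le> mdist M x x' * norm a"
proof -
  have "mnorm M (sub (mact M x a) (mact M x' a)) = mnorm M (mact M (sub x x') a)"
    using assms by (intro mnorm_cong) (auto simp: si_sub si_act left_diff_distrib)
  then show ?thesis using assms mnorm_act_le[of "sub x x'"] by (simp add: mdist_sub)
qed

lemma mnorm_diff_le_mdist:
  assumes "x \<in> mcarrier M" "y \<in> mcarrier M"
  shows "\<bar>mnorm M x - mnorm M y\<bar> \<le> mdist M x y"
proof -
  have *: "mnorm M x \<le> mnorm M y + mdist M x y" if "x \<in> mcarrier M" "y \<in> mcarrier M" for x y
  proof -
    have "mnorm M x = mnorm M (madd M y (sub x y))"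
      using that by (intro mnorm_cong) (auto simp: si_sub si_add)
    then show ?thesis using mnorm_triangle[of y "sub x y"] that by (simp add: mdist_sub)
  qed
  show ?thesis using *[of x y] *[of y x] assms mdist_commute[OF assms] by linarith
qed

lemma inner_diff_le:
  assumes "x \<in> mcarrier M" "y \<in> mcarrier M" "x' \<in> mcarrier M" "y' \<in> mcarrier M"
  shows "norm (minner M x y - minner M x' y') \<le> mdist M x x' * mnorm M y + mnorm M x' * mdist M y y'"
proof -
  have "minner M x y - minner M x' y' = minner M (sub x x') y + minner M x' (sub y y')"
    using assms by (simp add: si_sub si_sub_left)
  then show ?thesis using assms
    by (simp add: mdist_sub norm_triangle_mono cauchy_schwarz)
qed

lemma mtends_carrier: "mtends M f l F \<Longrightarrow> l \<in> mcarrier M" "mtends M f l F \<Longrightarrow> f i \<in> mcarrier M"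
  by (auto simp: mtends_def)

lemma mtends_const: "x \<in> mcarrier M \<Longrightarrow> mtends M (\<lambda>_. x) x F"
  by (simp add: mtends_def mdist_self)

lemma mtends_bound:
  assumes "l \<in> mcarrier M" "\<And>i. f i \<in> mcarrier M" "(g \<longlongrightarrow> 0) F" "\<And>i. mdist M (f i) l \<le> g i"
  shows "mtends M f l F"
  unfolding mtends_def
  using assms by (auto intro!: tendsto_sandwich[OF _ _ tendsto_const assms(3)])

lemma mtends_add:
  assumes "mtends M f x F" "mtends M g y F"
  shows "mtends M (\<lambda>i. madd M (f i) (g i)) (madd M x y) F"
proof (rule mtends_bound)
  show "((\<lambda>i. mdist M (f i) x + mdist M (g i) y) \<longlongrightarrow> 0) F"
    using assms by (auto simp: mtends_def intro: tendsto_add_zero)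
qed (use assms in \<open>auto simp: mtends_def intro: mdist_add_le\<close>)

lemma mtends_scale:
  assumes "mtends M f x F"
  shows "mtends M (\<lambda>i. mscale M c (f i)) (mscale M c x) F"
proof (rule mtends_bound)
  show "((\<lambda>i. cmod c * mdist M (f i) x) \<longlongrightarrow> 0) F"
    using assms by (auto simp: mtends_def intro: tendsto_mult_right_zero)
qed (use assms in \<open>auto simp: mtends_def mdist_scale\<close>)

lemma mtends_act:
  assumes "mtends M f x F"
  shows "mtends M (\<lambda>i. mact M (f i) a) (mact M x a) F"
proof (rule mtends_bound)
  show "((\<lambda>i. mdist M (f i) x * norm a) \<longlongrightarrow> 0) F"
    using assms by (auto simp: mtends_def intro: tendsto_mult_left_zero)
qed (use assms in \<open>auto simp: mtends_def mdist_act_le\<close>)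

lemma mtends_mnorm:
  assumes "mtends M f x F" shows "((\<lambda>i. mnorm M (f i)) \<longlongrightarrow> mnorm M x) F"
proof -
  have "((\<lambda>i. mnorm M (f i) - mnorm M x) \<longlongrightarrow> 0) F"
    by (rule Lim_null_comparison[where g = "\<lambda>i. mdist M (f i) x"])
      (use assms in \<open>simp_all add: mtends_def mnorm_diff_le_mdist\<close>)
  then show ?thesis by (simp add: LIM_zero_iff)
qed

lemma mtends_inner:
  assumes "mtends M f x F" "mtends M g y F"
  shows "((\<lambda>i. minner M (f i) (g i)) \<longlongrightarrow> minner M x y) F"
proof -
  have "((\<lambda>i. mdist M (f i) x * mnorm M (g i) + mnorm M x * mdist M (g i) y) \<longlongrightarrow> 0 * mnorm M y + mnorm M x * 0) F"
    using assms by (intro tendsto_intros mtends_mnorm) (auto simp: mtends_def)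
  then have "((\<lambda>i. mdist M (f i) x * mnorm M (g i) + mnorm M x * mdist M (g i) y) \<longlongrightarrow> 0) F" by simp
  then have "((\<lambda>i. minner M (f i) (g i) - minner M x y) \<longlongrightarrow> 0) F"
    by (rule Lim_null_comparison[rotated])
      (use assms in \<open>simp add: mtends_def inner_diff_le\<close>)
  then show ?thesis by (simp add: LIM_zero_iff)
qed

lemma mtends_of_inner:
  assumes "l \<in> mcarrier M" "\<And>i. f i \<in> mcarrier M"
    and "((\<lambda>i. minner M (f i) (f i)) \<longlongrightarrow> minner M l l) F"
    and "((\<lambda>i. minner M l (f i)) \<longlongrightarrow> minner M l l) F"
  shows "mtends M f l F"
proof -
  have "((\<lambda>i. minner M (f i) l) \<longlongrightarrow> minner M l l) F"
    using tendsto_star[OF assms(4)] assms(1,2) by (simp add: si_star)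
  then have "((\<lambda>i. norm (minner M (f i) (f i) - minner M (f i) l - minner M l (f i) + minner M l l))
      \<longlongrightarrow> norm (minner M l l - minner M l l - minner M l l + minner M l l)) F"
    by (intro tendsto_intros assms(3,4))
  then have "((\<lambda>i. (mdist M (f i) l)\<^sup>2) \<longlongrightarrow> 0) F"
    using assms(1,2) by (simp add: mdist_square)
  then have "((\<lambda>i. sqrt ((mdist M (f i) l)\<^sup>2)) \<longlongrightarrow> sqrt 0) F" by (rule tendsto_real_sqrt)
  then show ?thesis using assms(1,2) by (simp add: mtends_def)
qed

lemma mcauchy_bounded:
  assumes "mcauchy M X"
  obtains B where "B > 0" "\<And>n. mnorm M (X n) \<le> B"
proof -
  have X: "X n \<in> mcarrier M" for n using assms by (auto simp: mcauchy_def)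
  have "Cauchy (\<lambda>n. mnorm M (X n))"
  proof (rule metric_CauchyI)
    fix e :: real assume "e > 0"
    then obtain N where "\<And>m n. m \<ge> N \<Longrightarrow> n \<ge> N \<Longrightarrow> mdist M (X m) (X n) < e"
      using assms unfolding mcauchy_def by meson
    then show "\<exists>N. \<forall>m\<ge>N. \<forall>n\<ge>N. dist (mnorm M (X m)) (mnorm M (X n)) < e"
      using mnorm_diff_le_mdist[OF X X] unfolding dist_real_def by (meson order_le_less_trans)
  qed
  then obtain B where "B > 0" "\<And>n. norm (mnorm M (X n)) \<le> B"
    using Cauchy_Bseq by (metis BseqE)
  then show ?thesis by (intro that[of B]) auto
qed

lemma mcauchy_inner_Cauchy:
  assumes X: "mcauchy M X" and Y: "mcauchy M Y"
  shows "Cauchy (\<lambda>n. minner M (X n) (Y n))"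
proof -
  have XY: "X n \<in> mcarrier M" "Y n \<in> mcarrier M" for n using X Y by (auto simp: mcauchy_def)
  obtain B where B: "B > 0" "\<And>n. mnorm M (X n) \<le> B" using mcauchy_bounded[OF X] by blast
  obtain C where C: "C > 0" "\<And>n. mnorm M (Y n) \<le> C" using mcauchy_bounded[OF Y] by blast
  show ?thesis
  proof (rule metric_CauchyI)
    fix e :: real assume e: "e > 0"
    have "e / (2 * C) > 0" "e / (2 * B) > 0" using e B(1) C(1) by auto
    then obtain N1 N2 where N: "\<And>m n. m \<ge> N1 \<Longrightarrow> n \<ge> N1 \<Longrightarrow> mdist M (X m) (X n) < e / (2 * C)"
      "\<And>m n. m \<ge> N2 \<Longrightarrow> n \<ge> N2 \<Longrightarrow> mdist M (Y m) (Y n) < e / (2 * B)"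
      using X Y unfolding mcauchy_def by meson
    have "dist (minner M (X m) (Y m)) (minner M (X n) (Y n)) < e" if "m \<ge> max N1 N2" "n \<ge> max N1 N2" for m n
    proof -
      have "dist (minner M (X m) (Y m)) (minner M (X n) (Y n))
          \<le> mdist M (X m) (X n) * mnorm M (Y m) + mnorm M (X n) * mdist M (Y m) (Y n)"
        unfolding dist_norm by (intro inner_diff_le XY)
      also have "\<dots> \<le> mdist M (X m) (X n) * C + B * mdist M (Y m) (Y n)"
        by (intro add_mono mult_left_mono mult_right_mono B C) auto
      also have "\<dots> < e / (2 * C) * C + B * (e / (2 * B))"
        by (intro add_strict_mono mult_strict_right_mono mult_strict_left_mono N B(1) C(1)) (use that in auto)
      also have "\<dots> = e" using B(1) C(1) by simp
      finally show ?thesis .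
    qed
    then show "\<exists>N. \<forall>m\<ge>N. \<forall>n\<ge>N. dist (minner M (X m) (Y m)) (minner M (X n) (Y n)) < e" by blast
  qed
qed

end

context hilbert_module
begin

lemma mdist_eq_0_iff:
  assumes "x \<in> mcarrier M" "y \<in> mcarrier M"
  shows "mdist M x y = 0 \<longleftrightarrow> x = y"
proof
  assume "mdist M x y = 0"
  then have "sub x y = mzero M"
    using assms by (intro inner_definite) (auto simp: mdist_sub mnorm_def)
  moreover have "madd M (sub x y) y = x"
  proof -
    have "madd M (sub x y) y = madd M x (madd M y (mscale M (-1) y))"
      using assms by (simp add: sub_def add_assoc add_commute[of "mscale M (-1) y" y])
    then show ?thesis using assms by (simp add: add_neg add_zero)
  qed
  ultimately show "x = y" using assms add_commute[of "mzero M" y] by (simp add: add_zero)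
qed (use assms in \<open>auto simp: mdist_self\<close>)

lemma inner_eqI:
  assumes "x \<in> mcarrier M" "y \<in> mcarrier M"
    and "\<And>z. z \<in> mcarrier M \<Longrightarrow> minner M z x = minner M z y"
  shows "x = y"
  using mdist_eq_0I[OF assms] mdist_eq_0_iff[OF assms(1,2)] by simp

lemma mtends_unique:
  assumes "mtends M f x F" "mtends M f y F" "F \<noteq> bot"
  shows "x = y"
proof -
  have c: "x \<in> mcarrier M" "y \<in> mcarrier M" "f i \<in> mcarrier M" for i
    using assms by (auto simp: mtends_def)
  have "((\<lambda>i. mdist M (f i) x + mdist M (f i) y) \<longlongrightarrow> 0) F"
    using assms by (intro tendsto_add_zero) (auto simp: mtends_def)
  moreover have "mdist M x y \<le> mdist M (f i) x + mdist M (f i) y" for i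
    using mdist_triangle[OF c(1,3,2)] mdist_commute[OF c(1,3)] by simp
  ultimately have "mdist M x y \<le> 0"
    using assms(3) by (intro tendsto_lowerbound[where F = F]) auto
  then show ?thesis using mdist_eq_0_iff[OF c(1,2)] mdist_nonneg[of x y] by linarith
qed

end

section \<open>Completions\<close>

lemma tendsto_0_squeeze:
  assumes "(g \<longlongrightarrow> (0::real)) F" "\<And>n. 0 \<le> f n" "\<And>n. f n \<le> g n"
  shows "(f \<longlongrightarrow> 0) F"
  by (rule tendsto_sandwich[OF _ _ tendsto_const assms(1)]) (auto simp: assms(2,3))

context semi_inner_module
begin

lemma mcauchyD: "mcauchy M X \<Longrightarrow> X n \<in> mcarrier M"
  by (auto simp: mcauchy_def)

lemma mcauchyE:
  assumes "mcauchy M X" "e > 0"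
  obtains N where "\<And>m n. m \<ge> N \<Longrightarrow> n \<ge> N \<Longrightarrow> mdist M (X m) (X n) < e"
  using assms unfolding mcauchy_def by meson

lemma mcauchy_const: "x \<in> mcarrier M \<Longrightarrow> mcauchy M (\<lambda>_. x)"
  by (auto simp: mcauchy_def mdist_self)

lemma mcauchy_lipschitz2:
  assumes "mcauchy M X" "mcauchy M Y" "\<And>n. Z n \<in> mcarrier M'" "C \<ge> 0" "D \<ge> 0"
    and "\<And>m n. mdist M' (Z m) (Z n) \<le> C * mdist M (X m) (X n) + D * mdist M (Y m) (Y n)"
  shows "mcauchy M' Z"
  unfolding mcauchy_def
proof (intro conjI allI impI)
  fix e :: real assume e: "e > 0"
  then have "e / (2 * (C + 1)) > 0" "e / (2 * (D + 1)) > 0" using assms(4,5) by auto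
  then obtain N1 N2 where N: "\<And>m n. m \<ge> N1 \<Longrightarrow> n \<ge> N1 \<Longrightarrow> mdist M (X m) (X n) < e / (2 * (C + 1))"
    "\<And>m n. m \<ge> N2 \<Longrightarrow> n \<ge> N2 \<Longrightarrow> mdist M (Y m) (Y n) < e / (2 * (D + 1))"
    using assms(1,2) unfolding mcauchy_def by meson
  have "mdist M' (Z m) (Z n) < e" if mn: "m \<ge> max N1 N2" "n \<ge> max N1 N2" for m n
  proof -
    have "mdist M' (Z m) (Z n) \<le> C * mdist M (X m) (X n) + D * mdist M (Y m) (Y n)" by (rule assms)
    also have "\<dots> \<le> (C + 1) * mdist M (X m) (X n) + (D + 1) * mdist M (Y m) (Y n)"
      by (intro add_mono mult_right_mono) auto
    also have "\<dots> < (C + 1) * (e / (2 * (C + 1))) + (D + 1) * (e / (2 * (D + 1)))"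
      by (intro add_strict_mono mult_strict_left_mono N) (use mn assms(4,5) in auto)
    also have "\<dots> = e"
    proof -
      have "(a + 1) * (e / (2 * (a + 1))) = e / 2" if "a \<ge> 0" for a :: real using that by (simp add: divide_simps)
      from this[OF assms(4)] this[OF assms(5)] show ?thesis by linarith
    qed
    finally show ?thesis .
  qed
  then show "\<exists>N. \<forall>m\<ge>N. \<forall>n\<ge>N. mdist M' (Z m) (Z n) < e" by blast
qed (use assms(3) in auto)

lemma mcauchy_lipschitz:
  assumes "mcauchy M X" "\<And>n. Z n \<in> mcarrier M'" "C \<ge> 0"
    and "\<And>m n. mdist M' (Z m) (Z n) \<le> C * mdist M (X m) (X n)"
  shows "mcauchy M' Z"
  using mcauchy_lipschitz2[OF assms(1,1,2,3), of 0] assms(4) by simp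

lemma mcauchy_add:
  assumes "mcauchy M X" "mcauchy M Y" shows "mcauchy M (\<lambda>n. madd M (X n) (Y n))"
  by (rule mcauchy_lipschitz2[OF assms, of _ _ 1 1])
    (use assms in \<open>auto simp: mcauchyD intro!: mdist_add_le\<close>)

lemma mcauchy_scale:
  assumes "mcauchy M X" shows "mcauchy M (\<lambda>n. mscale M c (X n))"
  by (rule mcauchy_lipschitz[OF assms, of _ _ "cmod c"]) (use assms in \<open>auto simp: mcauchyD mdist_scale\<close>)

lemma mcauchy_act:
  assumes "mcauchy M X" shows "mcauchy M (\<lambda>n. mact M (X n) a)"
  by (rule mcauchy_lipschitz[OF assms, of _ _ "norm a"])
    (use assms in \<open>auto simp: mcauchyD mult.commute[of "norm a"] intro!: mdist_act_le\<close>)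

lemma seq_class_eqI:
  assumes "mcauchy M X" "mcauchy M Y" "(\<lambda>n. mdist M (X n) (Y n)) \<longlonglongrightarrow> 0"
  shows "seq_class M X = seq_class M Y"
proof -
  have *: "seq_class M X \<subseteq> seq_class M Y"
    if XY: "mcauchy M X" "mcauchy M Y" "(\<lambda>n. mdist M (X n) (Y n)) \<longlonglongrightarrow> 0" for X Y
  proof
    fix Z assume "Z \<in> seq_class M X"
    then have Z: "mcauchy M Z" "(\<lambda>n. mdist M (X n) (Z n)) \<longlonglongrightarrow> 0" by (auto simp: seq_class_def)
    have "(\<lambda>n. mdist M (X n) (Y n) + mdist M (X n) (Z n)) \<longlonglongrightarrow> 0"
      by (rule tendsto_add_zero[OF XY(3) Z(2)])
    moreover have "mdist M (Y n) (Z n) \<le> mdist M (X n) (Y n) + mdist M (X n) (Z n)" for n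
      using mdist_triangle[of "Y n" "X n" "Z n"] mdist_commute[of "X n" "Y n"] XY Z
      by (simp add: mcauchyD)
    ultimately have "(\<lambda>n. mdist M (Y n) (Z n)) \<longlonglongrightarrow> 0"
      by (rule tendsto_0_squeeze[OF _ mdist_nonneg])
    then show "Z \<in> seq_class M Y" using Z by (simp add: seq_class_def)
  qed
  have "(\<lambda>n. mdist M (Y n) (X n)) \<longlonglongrightarrow> 0"
    using assms by (simp add: mdist_commute[of "Y _"] mcauchyD)
  then show ?thesis using *[OF assms] *[OF assms(2,1)] by blast
qed

lemma mem_seq_class: "mcauchy M X \<Longrightarrow> X \<in> seq_class M X"
  by (simp add: seq_class_def mdist_self mcauchyD)

lemma seq_rep_seq_class:
  assumes "mcauchy M X"
  shows "mcauchy M (seq_rep (seq_class M X))"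
    "(\<lambda>n. mdist M (X n) (seq_rep (seq_class M X) n)) \<longlonglongrightarrow> 0"
proof -
  have "seq_rep (seq_class M X) \<in> seq_class M X"
    unfolding seq_rep_def by (rule someI[of "\<lambda>X'. X' \<in> seq_class M X", OF mem_seq_class[OF assms]])
  then show "mcauchy M (seq_rep (seq_class M X))"
    "(\<lambda>n. mdist M (X n) (seq_rep (seq_class M X) n)) \<longlonglongrightarrow> 0"
    by (auto simp: seq_class_def)
qed

abbreviation "cM \<equiv> completion M"

lemma completion_carrier: "mcarrier cM = seq_class M ` {X. mcauchy M X}"
  by (simp add: completion_def)

lemma completionE:
  assumes "z \<in> mcarrier cM" obtains X where "mcauchy M X" "z = seq_class M X"
  using assms by (auto simp: completion_carrier)

lemma seq_class_closed [simp]: "mcauchy M X \<Longrightarrow> seq_class M X \<in> mcarrier cM"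
  by (auto simp: completion_carrier)

lemma completion_madd:
  assumes X: "mcauchy M X" and Y: "mcauchy M Y"
  shows "madd cM (seq_class M X) (seq_class M Y) = seq_class M (\<lambda>n. madd M (X n) (Y n))"
proof -
  let ?X = "seq_rep (seq_class M X)" and ?Y = "seq_rep (seq_class M Y)"
  note r = seq_rep_seq_class[OF X] seq_rep_seq_class[OF Y]
  have "(\<lambda>n. mdist M (madd M (X n) (Y n)) (madd M (?X n) (?Y n))) \<longlonglongrightarrow> 0"
    by (rule tendsto_0_squeeze[OF tendsto_add_zero[OF r(2,4)]])
      (use X Y r in \<open>auto simp: mcauchyD intro!: mdist_add_le\<close>)
  then have "seq_class M (\<lambda>n. madd M (X n) (Y n)) = seq_class M (\<lambda>n. madd M (?X n) (?Y n))"
    by (intro seq_class_eqI mcauchy_add X Y r)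
  then show ?thesis by (simp add: completion_def)
qed

lemma seq_class_seq_rep:
  assumes X: "mcauchy M X" and "C \<ge> 0"
    and h: "\<And>x. x \<in> mcarrier M \<Longrightarrow> h x \<in> mcarrier M"
      "\<And>x y. x \<in> mcarrier M \<Longrightarrow> y \<in> mcarrier M \<Longrightarrow> mdist M (h x) (h y) \<le> C * mdist M x y"
  shows "seq_class M (\<lambda>n. h (seq_rep (seq_class M X) n)) = seq_class M (\<lambda>n. h (X n))"
proof -
  note r = seq_rep_seq_class[OF X]
  have "mcauchy M (\<lambda>n. h (Y n))" if "mcauchy M Y" for Y
    by (rule mcauchy_lipschitz[OF that _ assms(2)]) (use that in \<open>auto simp: mcauchyD h\<close>)
  moreover have "(\<lambda>n. mdist M (h (X n)) (h (seq_rep (seq_class M X) n))) \<longlonglongrightarrow> 0"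
    by (rule tendsto_0_squeeze[OF tendsto_mult_right_zero[OF r(2), of C]])
      (use X r in \<open>auto simp: mcauchyD h\<close>)
  ultimately show ?thesis using X r by (intro seq_class_eqI[symmetric])
qed

lemma completion_mscale:
  assumes X: "mcauchy M X"
  shows "mscale cM c (seq_class M X) = seq_class M (\<lambda>n. mscale M c (X n))"
  using seq_class_seq_rep[OF X, of "cmod c" "mscale M c"] by (simp add: completion_def mdist_scale)

lemma completion_mact:
  assumes X: "mcauchy M X"
  shows "mact cM (seq_class M X) a = seq_class M (\<lambda>n. mact M (X n) a)"
  using seq_class_seq_rep[OF X, of "norm a" "\<lambda>x. mact M x a"] mdist_act_le[of _ _ a]
  by (simp add: completion_def mult.commute)

lemma completion_minner:
  assumes X: "mcauchy M X" and Y: "mcauchy M Y"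
  shows "(\<lambda>n. minner M (X n) (Y n)) \<longlonglongrightarrow> minner cM (seq_class M X) (seq_class M Y)"
proof -
  let ?X = "seq_rep (seq_class M X)" and ?Y = "seq_rep (seq_class M Y)"
  note r = seq_rep_seq_class[OF X] seq_rep_seq_class[OF Y]
  have lim: "(\<lambda>n. minner M (?X n) (?Y n)) \<longlonglongrightarrow> minner cM (seq_class M X) (seq_class M Y)"
    using Cauchy_convergent[OF mcauchy_inner_Cauchy[OF r(1,3)]]
    by (simp add: completion_def convergent_LIMSEQ_iff)
  obtain B where B: "B > 0" "\<And>n. mnorm M (Y n) \<le> B" using mcauchy_bounded[OF Y] by blast
  obtain C where C: "C > 0" "\<And>n. mnorm M (?X n) \<le> C" using mcauchy_bounded[OF r(1)] by blast
  have "(\<lambda>n. mdist M (X n) (?X n) * B + C * mdist M (Y n) (?Y n)) \<longlonglongrightarrow> 0"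
    by (intro tendsto_add_zero tendsto_mult_left_zero tendsto_mult_right_zero r)
  moreover have "norm (minner M (X n) (Y n) - minner M (?X n) (?Y n))
      \<le> mdist M (X n) (?X n) * B + C * mdist M (Y n) (?Y n)" for n
    by (rule order_trans[OF inner_diff_le])
      (use X Y r B C in \<open>auto simp: mcauchyD intro!: add_mono mult_left_mono mult_right_mono\<close>)
  ultimately have "(\<lambda>n. minner M (X n) (Y n) - minner M (?X n) (?Y n)) \<longlonglongrightarrow> 0"
    by (rule Lim_null_comparison[rotated, OF _ always_eventually[OF allI]])
  from tendsto_add[OF this lim] show ?thesis by simp
qed

lemma seq_class_eq_of_null:
  assumes "mcauchy M X" "mcauchy M Y"
    and "\<And>n z. z \<in> mcarrier M \<Longrightarrow> minner M z (X n) = minner M z (Y n)"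
  shows "seq_class M X = seq_class M Y"
proof (rule seq_class_eqI[OF assms(1,2)])
  have "mdist M (X n) (Y n) = 0" for n
    by (intro mdist_eq_0I) (use assms in \<open>auto simp: mcauchyD\<close>)
  then show "(\<lambda>n. mdist M (X n) (Y n)) \<longlonglongrightarrow> 0" by simp
qed

lemma completion_mdist:
  assumes X: "mcauchy M X" and Y: "mcauchy M Y"
  shows "(\<lambda>n. mdist M (X n) (Y n)) \<longlonglongrightarrow> mdist cM (seq_class M X) (seq_class M Y)"
proof -
  have "(\<lambda>n. minner M (madd M (X n) (mscale M (-1) (Y n))) (madd M (X n) (mscale M (-1) (Y n))))
      \<longlonglongrightarrow> minner cM (madd cM (seq_class M X) (mscale cM (-1) (seq_class M Y)))
            (madd cM (seq_class M X) (mscale cM (-1) (seq_class M Y)))"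
    by (simp add: completion_mscale completion_madd completion_minner mcauchy_add mcauchy_scale X Y)
  then show ?thesis unfolding mdist_def mnorm_def by (intro tendsto_intros)
qed

lemma const_class_tends:
  assumes X: "mcauchy M X"
  shows "(\<lambda>k. mdist cM (seq_class M (\<lambda>_. X k)) (seq_class M X)) \<longlonglongrightarrow> 0"
  unfolding LIMSEQ_def
proof (intro allI impI)
  fix e :: real assume "e > 0"
  then have "e / 2 > 0" by simp
  then obtain N where N: "\<And>m n. m \<ge> N \<Longrightarrow> n \<ge> N \<Longrightarrow> mdist M (X m) (X n) < e / 2"
    using mcauchyE[OF X] by metis
  have "mdist cM (seq_class M (\<lambda>_. X k)) (seq_class M X) \<le> e / 2" if "k \<ge> N" for k
    by (rule LIMSEQ_le_const2[OF completion_mdist[OF mcauchy_const X]])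
      (use N that mcauchyD[OF X] in \<open>auto intro!: exI[of _ N] less_imp_le\<close>)
  moreover have "0 \<le> mdist cM (seq_class M (\<lambda>_. X k)) (seq_class M X)" for k
    by (simp add: mdist_def mnorm_def)
  ultimately show "\<exists>no. \<forall>n\<ge>no. dist (mdist cM (seq_class M (\<lambda>_. X n)) (seq_class M X)) 0 < e"
    using \<open>e > 0\<close> by (intro exI[of _ N]) (force simp: dist_real_def)
qed

lemma completion_semi_inner: "semi_inner_module cM"
proof
  show "madd cM x y \<in> mcarrier cM" if "x \<in> mcarrier cM" "y \<in> mcarrier cM" for x y
    using that by (auto elim!: completionE simp: completion_madd mcauchy_add)
  show "mzero cM \<in> mcarrier cM" by (simp add: completion_def) (auto intro: mcauchy_const)
  show "mscale cM c x \<in> mcarrier cM" if "x \<in> mcarrier cM" for c x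
    using that by (auto elim!: completionE simp: completion_mscale mcauchy_scale)
  show "mact cM x a \<in> mcarrier cM" if "x \<in> mcarrier cM" for a x
    using that by (auto elim!: completionE simp: completion_mact mcauchy_act)
next
  fix x y assume "x \<in> mcarrier cM" "y \<in> mcarrier cM"
  then obtain X Y where XY: "mcauchy M X" "x = seq_class M X" "mcauchy M Y" "y = seq_class M Y"
    by (auto elim!: completionE)
  note XY' = mcauchyD[OF XY(1)] mcauchyD[OF XY(3)]
  show "minner cM x (mscale cM c y) = c *\<^sub>C minner cM x y" for c
  proof (rule LIMSEQ_unique)
    show "(\<lambda>n. minner M (X n) (mscale M c (Y n))) \<longlonglongrightarrow> minner cM x (mscale cM c y)"
      by (simp add: XY completion_mscale completion_minner mcauchy_scale)
    have "bounded_linear (\<lambda>a::'a. c *\<^sub>C a)"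
      by (rule bounded_linear_intro[of _ "cmod c"])
        (auto simp: scaleC_add_right scaleR_scaleC scaleC_scaleC norm_scaleC mult.commute)
    from bounded_linear.tendsto[OF this completion_minner[OF XY(1,3)]]
    show "(\<lambda>n. minner M (X n) (mscale M c (Y n))) \<longlonglongrightarrow> c *\<^sub>C minner cM x y"
      by (simp add: XY' si_scale XY(2,4))
  qed
  show "minner cM x (mact cM y a) = minner cM x y * a" for a
  proof (rule LIMSEQ_unique)
    show "(\<lambda>n. minner M (X n) (mact M (Y n) a)) \<longlonglongrightarrow> minner cM x (mact cM y a)"
      by (simp add: XY completion_mact completion_minner mcauchy_act)
    show "(\<lambda>n. minner M (X n) (mact M (Y n) a)) \<longlonglongrightarrow> minner cM x y * a"
      using tendsto_mult[OF completion_minner[OF XY(1,3)] tendsto_const, of a]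
      by (simp add: XY' si_act XY(2,4))
  qed
  show "star (minner cM x y) = minner cM y x"
    using tendsto_star[OF completion_minner[OF XY(1,3)]] completion_minner[OF XY(3,1)]
    by (simp add: XY' si_star XY(2,4) LIMSEQ_unique)
next
  fix x y z assume "x \<in> mcarrier cM" "y \<in> mcarrier cM" "z \<in> mcarrier cM"
  then obtain X Y Z where XY: "mcauchy M X" "x = seq_class M X" "mcauchy M Y" "y = seq_class M Y"
    "mcauchy M Z" "z = seq_class M Z"
    by (auto elim!: completionE)
  show "minner cM x (madd cM y z) = minner cM x y + minner cM x z"
  proof (rule LIMSEQ_unique)
    show "(\<lambda>n. minner M (X n) (madd M (Y n) (Z n))) \<longlonglongrightarrow> minner cM x (madd cM y z)"
      by (simp add: XY completion_madd completion_minner mcauchy_add)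
    show "(\<lambda>n. minner M (X n) (madd M (Y n) (Z n))) \<longlonglongrightarrow> minner cM x y + minner cM x z"
      using tendsto_add[OF completion_minner[OF XY(1,3)] completion_minner[OF XY(1,5)]]
      by (simp add: mcauchyD[OF XY(1)] mcauchyD[OF XY(3)] mcauchyD[OF XY(5)] si_add XY(2,4,6))
  qed
next
  fix x assume "x \<in> mcarrier cM"
  then obtain X where X: "mcauchy M X" "x = seq_class M X" by (auto elim!: completionE)
  show "minner cM x (mzero cM) = 0"
    using completion_minner[OF X(1) mcauchy_const[OF si_zero_closed]]
    by (simp add: X(2) mcauchyD[OF X(1)] si_zero completion_def LIMSEQ_const_iff)
  show "positive (minner cM x x)"
    using positive_tendsto[OF completion_minner[OF X(1,1)]] by (simp add: X(2) mcauchyD[OF X(1)] si_positive)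
qed

lemma completion_complete:
  assumes "mcauchy cM A"
  shows "\<exists>x\<in>mcarrier cM. (\<lambda>n. mdist cM (A n) x) \<longlonglongrightarrow> 0"
proof -
  interpret c: semi_inner_module cM by (rule completion_semi_inner)
  have "\<forall>k. \<exists>X. mcauchy M X \<and> A k = seq_class M X"
    using assms by (metis c.mcauchyD completionE)
  then obtain X where X: "\<And>k. mcauchy M (X k)" "\<And>k. A k = seq_class M (X k)" by metis
  have "\<forall>k. \<exists>N. \<forall>m\<ge>N. \<forall>n\<ge>N. mdist M (X k m) (X k n) < inverse (real (Suc k))"
    using X(1) unfolding mcauchy_def by (metis inverse_positive_iff_positive of_nat_0_less_iff zero_less_Suc)
  then obtain N where N: "\<And>k m n. m \<ge> N k \<Longrightarrow> n \<ge> N k \<Longrightarrow> mdist M (X k m) (X k n) < inverse (real (Suc k))"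
    by metis
  define Y where "Y = (\<lambda>k. X k (N k))"
  have Yc: "Y k \<in> mcarrier M" for k using X(1) by (auto simp: Y_def mcauchyD)
  note YC = mcauchy_const[OF Yc]
  have near: "mdist cM (A k) (seq_class M (\<lambda>_. Y k)) \<le> inverse (real (Suc k))" for k
    unfolding X(2)
    by (rule LIMSEQ_le_const2[OF completion_mdist[OF X(1) YC]])
      (use N[of k] in \<open>auto intro!: exI[of _ "N k"] less_imp_le simp: Y_def simp del: of_nat_Suc\<close>)
  have dY: "mdist M (Y k) (Y l) = mdist cM (seq_class M (\<lambda>_. Y k)) (seq_class M (\<lambda>_. Y l))" for k l
    using completion_mdist[OF YC YC, of k l] by (simp add: LIMSEQ_const_iff)
  have tri: "mdist M (Y k) (Y l) \<le> inverse (real (Suc k)) + mdist cM (A k) (A l) + inverse (real (Suc l))" for k l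
  proof -
    have cl: "A k \<in> mcarrier cM" "seq_class M (\<lambda>_. Y k) \<in> mcarrier cM" for k
      using X YC by auto
    have "mdist M (Y k) (Y l) \<le> mdist cM (seq_class M (\<lambda>_. Y k)) (A k)
        + mdist cM (A k) (seq_class M (\<lambda>_. Y l))"
      unfolding dY using cl by (intro c.mdist_triangle)
    moreover have "mdist cM (A k) (seq_class M (\<lambda>_. Y l)) \<le> mdist cM (A k) (A l) + mdist cM (A l) (seq_class M (\<lambda>_. Y l))"
      using cl by (intro c.mdist_triangle)
    ultimately show ?thesis
      using near[of k] near[of l] c.mdist_commute[OF cl(1,2), of k k] by linarith
  qed
  have "mcauchy M Y"
    unfolding mcauchy_def
  proof (intro conjI allI impI)
    fix e :: real assume "e > 0"
    then have e3: "e / 3 > 0" by simp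
    then obtain N1 where N1: "\<And>m n. m \<ge> N1 \<Longrightarrow> n \<ge> N1 \<Longrightarrow> mdist cM (A m) (A n) < e / 3"
      using c.mcauchyE[OF assms] by metis
    obtain N2 where N2: "inverse (real (Suc N2)) < e / 3" using reals_Archimedean[OF e3] by blast
    have N3: "inverse (real (Suc k)) < e / 3" if "k \<ge> N2" for k
      using N2 that by (meson le_less_trans le_imp_inverse_le of_nat_0_less_iff of_nat_mono Suc_le_mono zero_less_Suc)
    have "mdist M (Y m) (Y n) < e" if "m \<ge> max N1 N2" "n \<ge> max N1 N2" for m n
      using tri[of m n] N1[of m n] N3[of m] N3[of n] that by simp
    then show "\<exists>N. \<forall>m\<ge>N. \<forall>n\<ge>N. mdist M (Y m) (Y n) < e" by blast
  qed (use Yc in auto)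
  note Y = this
  note lim = const_class_tends[OF Y]
  have "(\<lambda>k. mdist cM (A k) (seq_class M Y)) \<longlonglongrightarrow> 0"
  proof (rule tendsto_0_squeeze)
    show "(\<lambda>k. inverse (real (Suc k)) + mdist cM (seq_class M (\<lambda>_. Y k)) (seq_class M Y)) \<longlonglongrightarrow> 0"
      by (intro tendsto_add_zero lim LIMSEQ_inverse_real_of_nat)
    show "mdist cM (A k) (seq_class M Y)
        \<le> inverse (real (Suc k)) + mdist cM (seq_class M (\<lambda>_. Y k)) (seq_class M Y)" for k
      using c.mdist_triangle[of "A k" "seq_class M (\<lambda>_. Y k)" "seq_class M Y"] near[of k] X YC Y by simp
  qed auto
  then show ?thesis using Y by auto
qed

theorem completion_hilbert: "hilbert_module cM"
proof -
  interpret c: semi_inner_module cM by (rule completion_semi_inner)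
  have eqI: "x = y" if xy: "x \<in> mcarrier cM" "y \<in> mcarrier cM"
    and eq: "\<And>z. z \<in> mcarrier cM \<Longrightarrow> minner cM z x = minner cM z y" for x y
  proof -
    obtain X Y where X: "mcauchy M X" "x = seq_class M X" and Y: "mcauchy M Y" "y = seq_class M Y"
      using xy by (auto elim!: completionE)
    show ?thesis unfolding X(2) Y(2)
      using completion_mdist[OF X(1) Y(1)] c.mdist_eq_0I[OF xy eq]
      by (intro seq_class_eqI X Y) (simp add: X(2) Y(2))
  qed
  note laws = c.si_add c.si_scale c.si_act c.si_star c.si_positive c.si_zero
        scaleC_minus_one distrib_left distrib_right add.assoc mult.assoc
        scaleC_add_left scaleC_add_right scaleC_scaleC scaleC_one scaleC_mult_left scaleC_mult_right
  show ?thesis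
  proof
    fix x assume x: "x \<in> mcarrier cM" "minner cM x x = 0"
    show "x = mzero cM"
    proof (rule eqI)
      fix z assume z: "z \<in> mcarrier cM"
      have "mnorm cM x = 0" by (simp add: mnorm_def x(2))
      then show "minner cM z x = minner cM z (mzero cM)"
        using c.cauchy_schwarz[OF z x(1)] by (simp add: c.si_zero z)
    qed (use x in auto)
  next
    fix A assume "mcauchy cM A"
    then show "\<exists>x\<in>mcarrier cM. (\<lambda>n. mdist cM (A n) x) \<longlonglongrightarrow> 0" by (rule completion_complete)
  next
    fix x y assume "x \<in> mcarrier cM" "y \<in> mcarrier cM"
    then show "madd cM x y = madd cM y x" by (intro eqI) (auto simp: c.si_add add.commute)
  qed ((rule eqI; simp add: laws) | simp add: laws)+
qed

end

section \<open>Bounded module maps and their extension to completions\<close>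

definition module_map ::
  "('m, 'a::unital_cstar_algebra) hmod \<Rightarrow> ('n, 'a) hmod \<Rightarrow> ('m \<Rightarrow> 'n) \<Rightarrow> real \<Rightarrow> bool" where
  "module_map M N T C \<longleftrightarrow> C \<ge> 0 \<and>
     (\<forall>x\<in>mcarrier M. T x \<in> mcarrier N \<and> mnorm N (T x) \<le> C * mnorm M x \<and>
        (\<forall>c. T (mscale M c x) = mscale N c (T x)) \<and> (\<forall>a. T (mact M x a) = mact N (T x) a) \<and>
        (\<forall>y\<in>mcarrier M. T (madd M x y) = madd N (T x) (T y)))"

lemma module_mapD:
  assumes "module_map M N T C"
  shows "C \<ge> 0" "x \<in> mcarrier M \<Longrightarrow> T x \<in> mcarrier N"
    "x \<in> mcarrier M \<Longrightarrow> mnorm N (T x) \<le> C * mnorm M x"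
    "x \<in> mcarrier M \<Longrightarrow> T (mscale M c x) = mscale N c (T x)"
    "x \<in> mcarrier M \<Longrightarrow> T (mact M x a) = mact N (T x) a"
    "x \<in> mcarrier M \<Longrightarrow> y \<in> mcarrier M \<Longrightarrow> T (madd M x y) = madd N (T x) (T y)"
  using assms by (auto simp: module_map_def)

lemma module_map_comp:
  assumes "module_map M N T C" "module_map N P T' C'"
  shows "module_map M P (\<lambda>x. T' (T x)) (C' * C)"
  unfolding module_map_def
proof (intro conjI ballI allI)
  show "0 \<le> C' * C" using assms by (simp add: module_mapD(1))
  fix x assume x: "x \<in> mcarrier M"
  have "mnorm P (T' (T x)) \<le> C' * mnorm N (T x)"
    using module_mapD(3)[OF assms(2)] module_mapD(2)[OF assms(1) x] .
  also have "\<dots> \<le> C' * (C * mnorm M x)"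
    using module_mapD(1)[OF assms(2)] module_mapD(3)[OF assms(1) x] by (rule mult_left_mono[rotated])
  finally show "mnorm P (T' (T x)) \<le> C' * C * mnorm M x" by simp
qed (auto simp: module_mapD[OF assms(1)] module_mapD[OF assms(2)])

lemma module_map_mdist:
  assumes "semi_inner_module M" "module_map M N T C" "x \<in> mcarrier M" "y \<in> mcarrier M"
  shows "mdist N (T x) (T y) \<le> C * mdist M x y"
proof -
  interpret semi_inner_module M by fact
  have "madd N (T x) (mscale N (-1) (T y)) = T (madd M x (mscale M (-1) y))"
    using assms by (simp add: module_mapD[OF assms(2)])
  then show ?thesis
    using module_mapD(3)[OF assms(2), of "madd M x (mscale M (-1) y)"] assms(3,4)
    by (simp add: mdist_def)
qed

lemma module_map_mtends:
  assumes "semi_inner_module M" "semi_inner_module N" "module_map M N T C" "mtends M f x F"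
  shows "mtends N (\<lambda>i. T (f i)) (T x) F"
proof -
  interpret M: semi_inner_module M by fact
  interpret N: semi_inner_module N by fact
  have c: "x \<in> mcarrier M" "f i \<in> mcarrier M" for i using assms(4) by (auto simp: mtends_def)
  show ?thesis
  proof (rule N.mtends_bound)
    show "((\<lambda>i. C * mdist M (f i) x) \<longlongrightarrow> 0) F"
      using assms(4) by (auto simp: mtends_def intro: tendsto_mult_right_zero)
    show "mdist N (T (f i)) (T x) \<le> C * mdist M (f i) x" for i
      by (rule module_map_mdist[OF assms(1,3) c(2,1)])
  qed (auto simp: module_mapD(2)[OF assms(3)] c)
qed

lemma isometric_module_map:
  assumes "semi_inner_module M" "hilbert_module N" "T \<in> mcarrier M \<rightarrow> mcarrier N"
    and "\<And>x y. x \<in> mcarrier M \<Longrightarrow> y \<in> mcarrier M \<Longrightarrow> minner N (T x) (T y) = minner M x y"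
  shows "module_map M N T 1"
proof -
  interpret M: semi_inner_module M by fact
  interpret N: hilbert_module N by fact
  have T: "T x \<in> mcarrier N" if "x \<in> mcarrier M" for x using assms(3) that by auto
  have null: "x = y" if "x \<in> mcarrier N" "y \<in> mcarrier N"
    "minner N x x = minner N x y" "minner N y x = minner N x y" "minner N y y = minner N x y" for x y
  proof -
    have "(mdist N x y)\<^sup>2 = 0" unfolding N.mdist_square[OF that(1,2)] that(3-5) by simp
    then show ?thesis using N.mdist_eq_0_iff[OF that(1,2)] by simp
  qed
  show ?thesis
    unfolding module_map_def
  proof (intro conjI ballI allI)
    fix x assume x: "x \<in> mcarrier M"
    show "mnorm N (T x) \<le> 1 * mnorm M x" using assms(4)[OF x x] by (simp add: mnorm_def)
    show "T (mscale M c x) = mscale N c (T x)" for c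
      by (rule null)
        (simp_all add: T x N.si_scale N.si_scale_left M.si_scale M.si_scale_left assms(4))
    show "T (mact M x a) = mact N (T x) a" for a
      by (rule null)
        (simp_all add: T x N.si_act N.si_act_left M.si_act M.si_act_left assms(4) mult.assoc)
    show "T (madd M x y) = madd N (T x) (T y)" if y: "y \<in> mcarrier M" for y
      by (rule null)
        (simp_all add: T x y N.si_add N.si_add_left M.si_add M.si_add_left assms(4) add_ac)
  qed (use T in auto)
qed

context semi_inner_module
begin

definition emb where "emb x = seq_class M (\<lambda>_. x)"

lemma emb_closed [simp, intro]: "x \<in> mcarrier M \<Longrightarrow> emb x \<in> mcarrier cM"
  by (simp add: emb_def mcauchy_const)

lemma emb_inner: "x \<in> mcarrier M \<Longrightarrow> y \<in> mcarrier M \<Longrightarrow> minner cM (emb x) (emb y) = minner M x y"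
  using completion_minner[OF mcauchy_const mcauchy_const, of x y]
  by (simp add: emb_def LIMSEQ_const_iff)

lemma emb_module_map: "module_map M cM emb 1"
  by (rule isometric_module_map[OF semi_inner_module_axioms completion_hilbert]) (auto simp: emb_inner)

lemma emb_eqI:
  assumes "x \<in> mcarrier M" "y \<in> mcarrier M"
    and "\<And>z. z \<in> mcarrier M \<Longrightarrow> minner M z x = minner M z y"
  shows "emb x = emb y"
  unfolding emb_def by (intro seq_class_eq_of_null mcauchy_const) (use assms in auto)

lemma emb_tends:
  assumes X: "mcauchy M X"
  shows "mtends cM (\<lambda>n. emb (X n)) (seq_class M X) sequentially"
  using const_class_tends[OF X] X by (auto simp: mtends_def mcauchyD emb_def mcauchy_const)

lemma emb_dense:
  assumes "z \<in> mcarrier cM"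
  obtains X where "mcauchy M X" "z = seq_class M X" "\<And>n. X n \<in> mcarrier M"
    "mtends cM (\<lambda>n. emb (X n)) z sequentially"
  using assms emb_tends by (metis completionE mcauchyD)

lemma completion_eqI:
  assumes "hilbert_module N" "z \<in> mcarrier cM"
    and f: "\<And>X. mtends cM X z sequentially \<Longrightarrow> mtends N (\<lambda>n. f (X n)) (f z) sequentially"
    and g: "\<And>X. mtends cM X z sequentially \<Longrightarrow> mtends N (\<lambda>n. g (X n)) (g z) sequentially"
    and eq: "\<And>s. s \<in> mcarrier M \<Longrightarrow> f (emb s) = g (emb s)"
  shows "f z = g z"
proof -
  obtain X where X: "\<And>n. X n \<in> mcarrier M" "mtends cM (\<lambda>n. emb (X n)) z sequentially"
    using emb_dense[OF assms(2)] by blast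
  show ?thesis
    using hilbert_module.mtends_unique[OF assms(1) f[OF X(2)]] g[OF X(2)] eq[OF X(1)] by simp
qed

definition ext where
  "ext N k z = (SOME y. \<forall>X. mcauchy M X \<longrightarrow> z = seq_class M X \<longrightarrow> mtends N (\<lambda>n. k (X n)) y sequentially)"

lemma ext_module_map:
  assumes "hilbert_module N" and k: "module_map M N k C"
  shows "module_map cM N (ext N k) C" "s \<in> mcarrier M \<Longrightarrow> ext N k (emb s) = k s"
proof -
  interpret N: hilbert_module N by fact
  interpret cM: hilbert_module cM by (rule completion_hilbert)
  have kd: "mdist N (k x) (k y) \<le> C * mdist M x y" if "x \<in> mcarrier M" "y \<in> mcarrier M" for x y
    by (rule module_map_mdist[OF semi_inner_module_axioms k that])
  define L where "L z y \<longleftrightarrow> (\<forall>X. mcauchy M X \<longrightarrow> z = seq_class M X \<longrightarrow> mtends N (\<lambda>n. k (X n)) y sequentially)" for z y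
  have ex: "\<exists>y. L z y" if z: "z \<in> mcarrier cM" for z
  proof -
    obtain X where X: "mcauchy M X" "z = seq_class M X" using z by (rule completionE)
    have "mcauchy N (\<lambda>n. k (X n))"
      by (rule mcauchy_lipschitz[OF X(1) _ module_mapD(1)[OF k]])
        (simp_all add: kd module_mapD(2)[OF k] mcauchyD[OF X(1)])
    then obtain y where y: "y \<in> mcarrier N" "(\<lambda>n. mdist N (k (X n)) y) \<longlonglongrightarrow> 0"
      using N.complete by blast
    have "mtends N (\<lambda>n. k (Y n)) y sequentially" if Y: "mcauchy M Y" "z = seq_class M Y" for Y
    proof (rule N.mtends_bound)
      have "(\<lambda>n. mdist M (Y n) (X n)) \<longlonglongrightarrow> 0"
        using completion_mdist[OF Y(1) X(1)] z by (simp add: Y(2)[symmetric] X(2)[symmetric] cM.mdist_self)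
      then show "(\<lambda>n. C * mdist M (Y n) (X n) + mdist N (k (X n)) y) \<longlonglongrightarrow> 0"
        by (intro tendsto_add_zero tendsto_mult_right_zero y)
      fix n
      show "mdist N (k (Y n)) y \<le> C * mdist M (Y n) (X n) + mdist N (k (X n)) y"
        using N.mdist_triangle[of "k (Y n)" "k (X n)" y] kd[of "Y n" "X n"] y(1)
        by (simp add: module_mapD(2)[OF k] mcauchyD[OF X(1)] mcauchyD[OF Y(1)])
    qed (auto simp: y module_mapD(2)[OF k] mcauchyD[OF Y(1)])
    then show ?thesis unfolding L_def by blast
  qed
  define T where "T = ext N k"
  have T: "mtends N (\<lambda>n. k (X n)) (T (seq_class M X)) sequentially" if "mcauchy M X" for X
    using someI_ex[OF ex[OF seq_class_closed[OF that]]] that unfolding T_def ext_def L_def by blast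
  show "ext N k (emb s) = k s" if "s \<in> mcarrier M" for s
    using N.mtends_unique[OF T[OF mcauchy_const[OF that]]
        N.mtends_const[OF module_mapD(2)[OF k that]]] by (simp add: emb_def T_def)
  show "module_map cM N (ext N k) C"
    unfolding T_def[symmetric] module_map_def
  proof (intro conjI ballI allI)
    fix z assume "z \<in> mcarrier cM"
    then obtain X where X: "mcauchy M X" "z = seq_class M X" by (rule completionE)
    note TX = T[OF X(1)] and cX = mcauchyD[OF X(1)]
    show "T z \<in> mcarrier N" using N.mtends_carrier(1)[OF TX] X by simp
    have "(\<lambda>n. mnorm M (X n)) \<longlonglongrightarrow> mnorm cM z"
      unfolding mnorm_def X(2) by (intro tendsto_intros completion_minner X)
    then show "mnorm N (T z) \<le> C * mnorm cM z"
      unfolding X(2)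
      by (intro LIMSEQ_le[OF N.mtends_mnorm[OF TX] tendsto_mult[OF tendsto_const]])
        (auto simp: module_mapD(3)[OF k] cX)
    show "T (mscale cM c z) = mscale N c (T z)" for c
      using N.mtends_unique[OF T[OF mcauchy_scale[OF X(1)]]] N.mtends_scale[OF TX]
      by (simp add: X(2) completion_mscale[OF X(1)] module_mapD(4)[OF k] cX)
    show "T (mact cM z a) = mact N (T z) a" for a
      using N.mtends_unique[OF T[OF mcauchy_act[OF X(1)]]] N.mtends_act[OF TX]
      by (simp add: X(2) completion_mact[OF X(1)] module_mapD(5)[OF k] cX)
    fix y assume "y \<in> mcarrier cM"
    then obtain Y where Y: "mcauchy M Y" "y = seq_class M Y" by (rule completionE)
    show "T (madd cM z y) = madd N (T z) (T y)"
      using N.mtends_unique[OF T[OF mcauchy_add[OF X(1) Y(1)]]] N.mtends_add[OF TX T[OF Y(1)]]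
      by (simp add: X(2) Y(2) completion_madd[OF X(1) Y(1)] module_mapD(6)[OF k] cX mcauchyD[OF Y(1)])
  qed (rule module_mapD(1)[OF k])
qed

lemma completion_inner_eqI:
  fixes f g :: "(nat \<Rightarrow> 'm) set \<Rightarrow> (nat \<Rightarrow> 'm) set \<Rightarrow> 'z::t2_space"
  assumes y: "y \<in> mcarrier cM" and z: "z \<in> mcarrier cM"
    and f: "\<And>Y Z. mtends cM Y y sequentially \<Longrightarrow> mtends cM Z z sequentially
      \<Longrightarrow> (\<lambda>n. f (Y n) (Z n)) \<longlonglongrightarrow> f y z"
    and g: "\<And>Y Z. mtends cM Y y sequentially \<Longrightarrow> mtends cM Z z sequentially
      \<Longrightarrow> (\<lambda>n. g (Y n) (Z n)) \<longlonglongrightarrow> g y z"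
    and eq: "\<And>s t. s \<in> mcarrier M \<Longrightarrow> t \<in> mcarrier M \<Longrightarrow> f (emb s) (emb t) = g (emb s) (emb t)"
  shows "f y z = g y z"
proof -
  obtain Y where Y: "\<And>n. Y n \<in> mcarrier M" "mtends cM (\<lambda>n. emb (Y n)) y sequentially"
    using emb_dense[OF y] by blast
  obtain Z where Z: "\<And>n. Z n \<in> mcarrier M" "mtends cM (\<lambda>n. emb (Z n)) z sequentially"
    using emb_dense[OF z] by blast
  show ?thesis
    using LIMSEQ_unique[OF f[OF Y(2) Z(2)]] g[OF Y(2) Z(2)] eq[OF Y(1) Z(1)] by simp
qed

end

section \<open>Adjoints and unitary operators\<close>

context hilbert_module
begin

lemma adj_eqI:
  assumes "y \<in> mcarrier M" "z \<in> mcarrier M"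
    and "\<And>x. x \<in> mcarrier M \<Longrightarrow> minner M (T x) y = minner M x z"
  shows "adj M T y = z"
  unfolding adj_def by (rule the_equality) (use assms in \<open>auto intro!: inner_eqI\<close>)

lemma is_adjoint_adj:
  assumes "is_adjoint M T T'" "y \<in> mcarrier M" shows "adj M T y = T' y"
  using assms by (intro adj_eqI) (auto simp: is_adjoint_def)

lemma adjointable_adj:
  assumes "adjointable M T" shows "is_adjoint M T (adj M T)"
proof -
  obtain T' where T': "is_adjoint M T T'" using assms by (auto simp: adjointable_def)
  then show ?thesis using is_adjoint_adj[OF T'] by (auto simp: is_adjoint_def)
qed

lemma is_adjoint_sym:
  assumes "is_adjoint M T T'" shows "is_adjoint M T' T"
  unfolding is_adjoint_def
proof (intro conjI ballI)
  fix x y assume xy: "x \<in> mcarrier M" "y \<in> mcarrier M"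
  then have c: "T' x \<in> mcarrier M" "T y \<in> mcarrier M" and "minner M (T y) x = minner M y (T' x)"
    using assms by (auto simp: is_adjoint_def)
  then have "star (minner M (T y) x) = star (minner M y (T' x))" by simp
  then show "minner M (T' x) y = minner M x (T y)" using xy c by (simp add: si_star)
qed (use assms in \<open>auto simp: is_adjoint_def\<close>)

lemma is_adjoint_module_map:
  assumes "is_adjoint M T T'" "C \<ge> 0" "\<And>x. x \<in> mcarrier M \<Longrightarrow> mnorm M (T x) \<le> C * mnorm M x"
  shows "module_map M M T C"
proof -
  have T: "T x \<in> mcarrier M" "T' x \<in> mcarrier M" if "x \<in> mcarrier M" for x
    using assms(1) that by (auto simp: is_adjoint_def)
  have adj: "minner M x (T y) = minner M (T' x) y" if "x \<in> mcarrier M" "y \<in> mcarrier M" for x y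
    using is_adjoint_sym[OF assms(1)] that by (auto simp: is_adjoint_def)
  show ?thesis unfolding module_map_def
    using assms(2,3) T by (auto intro!: inner_eqI simp: adj si_add si_scale si_act)
qed

lemma unitary_opI:
  assumes "T \<in> mcarrier M \<rightarrow> mcarrier M" "T' \<in> mcarrier M \<rightarrow> mcarrier M"
    and "\<And>x. x \<in> mcarrier M \<Longrightarrow> T' (T x) = x" "\<And>x. x \<in> mcarrier M \<Longrightarrow> T (T' x) = x"
    and "\<And>x y. x \<in> mcarrier M \<Longrightarrow> y \<in> mcarrier M \<Longrightarrow> minner M (T x) (T y) = minner M x y"
  shows "unitary_op M T" "y \<in> mcarrier M \<Longrightarrow> adj M T y = T' y"
proof -
  have c: "T x \<in> mcarrier M" "T' x \<in> mcarrier M" if "x \<in> mcarrier M" for x using assms(1,2) that by auto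
  have a: "is_adjoint M T T'"
    unfolding is_adjoint_def using assms(1,2,4,5) c by (metis)
  show *: "adj M T y = T' y" if "y \<in> mcarrier M" for y
    by (rule is_adjoint_adj[OF a that])
  show "unitary_op M T"
    unfolding unitary_op_def adjointable_def using a c assms(3,4) by (auto simp: *)
qed

lemma unitary_op_isometric:
  assumes "unitary_op M T" "x \<in> mcarrier M" "y \<in> mcarrier M"
  shows "minner M (T x) (T y) = minner M x y"
  using assms adjointable_adj unfolding unitary_op_def is_adjoint_def by (metis PiE)

end

context semi_inner_module
begin

lemma unitary_rep_on_completionI:
  fixes V :: "'g::topological_group_add \<Rightarrow> (nat \<Rightarrow> 'm) set \<Rightarrow> (nat \<Rightarrow> 'm) set"
  assumes V: "\<And>t. module_map cM cM (V t) C"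
    and iso: "\<And>t s s'. s \<in> mcarrier M \<Longrightarrow> s' \<in> mcarrier M \<Longrightarrow>
      minner cM (V t (emb s)) (V t (emb s')) = minner M s s'"
    and zero: "\<And>s. s \<in> mcarrier M \<Longrightarrow> V 0 (emb s) = emb s"
    and add: "\<And>t t' s. s \<in> mcarrier M \<Longrightarrow> V (t + t') (emb s) = V t (V t' (emb s))"
    and cont: "\<And>s t0. s \<in> mcarrier M \<Longrightarrow>
      ((\<lambda>t. minner cM (V t0 (emb s)) (V t (emb s))) \<longlongrightarrow> minner M s s) (at t0)"
  shows "unitary_rep_on cM V" "y \<in> mcarrier cM \<Longrightarrow> adj cM (V t) y = V (- t) y"
proof -
  interpret cM: hilbert_module cM by (rule completion_hilbert)
  note cs = cM.semi_inner_module_axioms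
  note Vt = module_map_mtends[OF cs cs V]
  note Vc = module_mapD(2)[OF V]
  have iso': "minner cM (V t x) (V t y) = minner cM x y"
    if "x \<in> mcarrier cM" "y \<in> mcarrier cM" for x y t
    by (rule completion_inner_eqI[OF that]) (auto intro!: cM.mtends_inner Vt simp: iso emb_inner)
  have zero': "V 0 x = x" if "x \<in> mcarrier cM" for x
    by (rule completion_eqI[OF completion_hilbert that]) (auto intro!: Vt simp: zero)
  have add': "V (t + t') x = V t (V t' x)" if "x \<in> mcarrier cM" for x t t'
    by (rule completion_eqI[OF completion_hilbert that]) (auto intro!: Vt simp: add)
  have inv: "V (- t) (V t x) = x" "V t (V (- t) x) = x" if "x \<in> mcarrier cM" for x t
    using add'[OF that, of "-t" t] add'[OF that, of t "-t"] zero'[OF that] by simp_all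
  note un = cM.unitary_opI[of "V t" "V (- t)" for t, OF _ _ inv iso']
  show "adj cM (V t) y = V (- t) y" if "y \<in> mcarrier cM"
    using un(2)[of t y] Vc that by auto
  have gen: "mtends cM (\<lambda>t. V t (emb s)) (V t0 (emb s)) (at t0)" if s: "s \<in> mcarrier M" for s t0
    using cont[OF s] by (intro cM.mtends_of_inner) (simp_all add: Vc s iso' emb_inner)
  have "mcontinuous cM (\<lambda>t. V t x)" if x: "x \<in> mcarrier cM" for x
    unfolding mcontinuous_def
  proof
    fix t0
    obtain X where X: "\<And>n. X n \<in> mcarrier M" "mtends cM (\<lambda>n. emb (X n)) x sequentially"
      using emb_dense[OF x] by blast
    have Vd: "mdist cM (V t y) (V t z) = mdist cM y z" if "y \<in> mcarrier cM" "z \<in> mcarrier cM" for t y z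
      by (rule power2_eq_imp_eq) (simp_all add: cM.mdist_square that Vc iso')
    show "((\<lambda>t. mdist cM (V t x) (V t0 x)) \<longlongrightarrow> 0) (at t0)"
    proof (rule tendstoI)
      fix e :: real assume e: "e > 0"
      then have e3: "e / 3 > 0" by simp
      then obtain n where n: "mdist cM (emb (X n)) x < e / 3"
        using X(2) unfolding mtends_def LIMSEQ_def dist_real_def
        by (metis abs_of_nonneg cM.mdist_nonneg diff_zero order_refl)
      let ?m = "emb (X n)"
      have m: "?m \<in> mcarrier cM" using X by auto
      have "\<forall>\<^sub>F t in at t0. mdist cM (V t ?m) (V t0 ?m) < e / 3"
        by (rule order_tendstoD(2)[OF _ e3]) (use gen[OF X(1)[of n]] in \<open>simp add: mtends_def\<close>)
      then show "\<forall>\<^sub>F t in at t0. dist (mdist cM (V t x) (V t0 x)) 0 < e"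
      proof (rule eventually_mono)
        fix t assume t: "mdist cM (V t ?m) (V t0 ?m) < e / 3"
        have "mdist cM (V t x) (V t0 x) \<le> mdist cM (V t x) (V t ?m)
            + mdist cM (V t ?m) (V t0 ?m) + mdist cM (V t0 ?m) (V t0 x)"
          using cM.mdist_triangle[of "V t x" "V t ?m" "V t0 x"]
            cM.mdist_triangle[of "V t ?m" "V t0 ?m" "V t0 x"] Vc m x by simp
        also have "\<dots> < e"
          using t n Vd[OF x m] Vd[OF m x] cM.mdist_commute[OF x m] by simp
        finally show "dist (mdist cM (V t x) (V t0 x)) 0 < e" by (simp add: dist_real_def)
      qed
    qed
  qed
  then show "unitary_rep_on cM V"
    unfolding unitary_rep_on_def using un(1) Vc add' by auto
qed

end

section \<open>Modules of formal sums\<close>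

definition list_module ::
  "'p set \<Rightarrow> (complex \<Rightarrow> 'p \<Rightarrow> 'p) \<Rightarrow> ('p \<Rightarrow> 'a \<Rightarrow> 'p) \<Rightarrow> ('p \<Rightarrow> 'p \<Rightarrow> 'a) \<Rightarrow>
    ('p list, 'a::unital_cstar_algebra) hmod" where
  "list_module I sc ac \<kappa> =
    \<lparr>mcarrier = lists I, madd = (@), mzero = [], mscale = (\<lambda>c. map (sc c)),
     mact = (\<lambda>s a. map (\<lambda>p. ac p a) s), minner = (\<lambda>s t. \<Sum>p\<leftarrow>s. \<Sum>q\<leftarrow>t. \<kappa> p q)\<rparr>"

lemma list_module_simps [simp]:
  "mcarrier (list_module I sc ac \<kappa>) = lists I"
  "madd (list_module I sc ac \<kappa>) s t = s @ t"
  "mzero (list_module I sc ac \<kappa>) = []"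
  "mscale (list_module I sc ac \<kappa>) c s = map (sc c) s"
  "mact (list_module I sc ac \<kappa>) s a = map (\<lambda>p. ac p a) s"
  "minner (list_module I sc ac \<kappa>) s t = (\<Sum>p\<leftarrow>s. \<Sum>q\<leftarrow>t. \<kappa> p q)"
  by (simp_all add: list_module_def)

lemma sum_list_cong: "(\<And>x. x \<in> set xs \<Longrightarrow> f x = g x) \<Longrightarrow> (\<Sum>x\<leftarrow>xs. f x) = (\<Sum>x\<leftarrow>xs. g x)"
  by (simp cong: map_cong)

lemma scaleC_sum_list: "c *\<^sub>C (\<Sum>x\<leftarrow>xs. f x) = (\<Sum>x\<leftarrow>xs. c *\<^sub>C (f x :: 'a::unital_cstar_algebra))"
  by (induction xs) (auto simp: scaleC_add_right)

lemma sum_list_swap: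
  "(\<Sum>x\<leftarrow>xs. \<Sum>y\<leftarrow>ys. f x y) = (\<Sum>y\<leftarrow>ys. \<Sum>x\<leftarrow>xs. f x y :: 'a::comm_monoid_add)"
  by (induction xs) (auto simp: sum_list_addf)

lemma star_sum_list_map: "star (\<Sum>x\<leftarrow>xs. f x) = (\<Sum>x\<leftarrow>xs. star (f x :: 'a::unital_cstar_algebra))"
  by (induction xs) (auto simp: star_add)

lemma list_module_semi_inner:
  assumes "\<And>c p. p \<in> I \<Longrightarrow> sc c p \<in> I" "\<And>a p. p \<in> I \<Longrightarrow> ac p a \<in> I"
    and "\<And>c p q. p \<in> I \<Longrightarrow> q \<in> I \<Longrightarrow> \<kappa> p (sc c q) = c *\<^sub>C \<kappa> p q"
    and "\<And>a p q. p \<in> I \<Longrightarrow> q \<in> I \<Longrightarrow> \<kappa> p (ac q a) = \<kappa> p q * a"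
    and "\<And>p q. p \<in> I \<Longrightarrow> q \<in> I \<Longrightarrow> star (\<kappa> p q) = \<kappa> q p"
    and "\<And>s. s \<in> lists I \<Longrightarrow> positive (\<Sum>p\<leftarrow>s. \<Sum>q\<leftarrow>s. \<kappa> p q)"
  shows "semi_inner_module (list_module I sc ac \<kappa>)"
proof
  let ?L = "list_module I sc ac \<kappa>"
  fix s t assume st: "s \<in> mcarrier ?L" "t \<in> mcarrier ?L"
  then have I: "p \<in> set s \<Longrightarrow> p \<in> I" "p \<in> set t \<Longrightarrow> p \<in> I" for p by auto
  show "minner ?L s (mscale ?L c t) = c *\<^sub>C minner ?L s t" for c
    by (simp add: scaleC_sum_list comp_def) (intro sum_list_cong, auto simp: I assms)
  show "minner ?L s (mact ?L t a) = minner ?L s t * a" for a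
    by (simp add: comp_def flip: sum_list_mult_const) (intro sum_list_cong, auto simp: I assms)
  have "star (\<Sum>p\<leftarrow>s. \<Sum>q\<leftarrow>t. \<kappa> p q) = (\<Sum>p\<leftarrow>s. \<Sum>q\<leftarrow>t. \<kappa> q p)"
    unfolding star_sum_list_map by (intro sum_list_cong) (auto simp: I assms)
  then show "star (minner ?L s t) = minner ?L t s"
    by (simp add: sum_list_swap[of _ t s])
qed (use assms in \<open>auto simp: sum_list_addf\<close>)

definition msum_list :: "('m, 'a) hmod \<Rightarrow> 'm list \<Rightarrow> 'm" where
  "msum_list M xs = foldr (madd M) xs (mzero M)"

lemma msum_list_simps [simp]:
  "msum_list M [] = mzero M" "msum_list M (x # xs) = madd M x (msum_list M xs)"
  by (simp_all add: msum_list_def)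

context hilbert_module
begin

lemma msum_list_closed: "set xs \<subseteq> mcarrier M \<Longrightarrow> msum_list M xs \<in> mcarrier M"
  by (induction xs) auto

lemma msum_list_append:
  "set xs \<subseteq> mcarrier M \<Longrightarrow> set ys \<subseteq> mcarrier M \<Longrightarrow>
    msum_list M (xs @ ys) = madd M (msum_list M xs) (msum_list M ys)"
proof (induction xs)
  case Nil
  then show ?case using add_commute[of "msum_list M ys" "mzero M"]
    by (simp add: msum_list_closed add_zero)
qed (simp add: add_assoc msum_list_closed)

lemma inner_msum_list:
  "x \<in> mcarrier M \<Longrightarrow> set ys \<subseteq> mcarrier M \<Longrightarrow> minner M x (msum_list M ys) = (\<Sum>y\<leftarrow>ys. minner M x y)"
  by (induction ys) (auto simp: si_add si_zero msum_list_closed)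

lemma inner_msum_list2:
  "set xs \<subseteq> mcarrier M \<Longrightarrow> set ys \<subseteq> mcarrier M \<Longrightarrow>
    minner M (msum_list M xs) (msum_list M ys) = (\<Sum>x\<leftarrow>xs. \<Sum>y\<leftarrow>ys. minner M x y)"
proof (induction xs)
  case Nil
  then show ?case using si_zero_left[OF msum_list_closed[of ys]] by simp
next
  case (Cons x xs)
  then show ?case
    using si_add_left[OF _ msum_list_closed msum_list_closed, of x xs ys]
      inner_msum_list[of x ys] by simp
qed

lemma list_module_map:
  assumes g: "\<And>p. p \<in> I \<Longrightarrow> g p \<in> mcarrier M"
    and sc: "\<And>c p. p \<in> I \<Longrightarrow> g (sc c p) = mscale M c (g p)"
    and ac: "\<And>a p. p \<in> I \<Longrightarrow> g (ac p a) = mact M (g p) a"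
    and C: "C \<ge> 0" "\<And>s. s \<in> lists I \<Longrightarrow>
      mnorm M (msum_list M (map g s)) \<le> C * mnorm (list_module I sc ac \<kappa>) s"
  shows "module_map (list_module I sc ac \<kappa>) M (\<lambda>s. msum_list M (map g s)) C"
proof -
  have sub: "set (map g s) \<subseteq> mcarrier M" if "s \<in> lists I" for s using that g by auto
  have 1: "msum_list M (map g (map (sc c) s)) = mscale M c (msum_list M (map g s))" if "s \<in> lists I" for c s
    using that
  proof (induction s)
    case Nil
    show ?case by simp (rule inner_eqI, auto simp: si_zero si_scale)
  next
    case (Cons p s)
    then have "msum_list M (map g s) \<in> mcarrier M" by (intro msum_list_closed sub) auto
    with Cons show ?case by (auto simp: sc g scale_add_right)
  qed
  have 2: "msum_list M (map g (map (\<lambda>p. ac p a) s)) = mact M (msum_list M (map g s)) a" if "s \<in> lists I" for a s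
    using that
  proof (induction s)
    case Nil
    show ?case by simp (rule inner_eqI, auto simp: si_zero si_act)
  next
    case (Cons p s)
    then have "msum_list M (map g s) \<in> mcarrier M" by (intro msum_list_closed sub) auto
    with Cons show ?case by (auto simp: ac g act_add_left)
  qed
  show ?thesis unfolding module_map_def
    using C sub 1 2 by (auto simp: msum_list_closed msum_list_append simp del: map_map)
qed

end

section \<open>Positivity of the interior tensor product\<close>

lemma positive_regularised_inverse:
  fixes a :: "'a::unital_cstar_algebra"
  assumes a: "positive a" and e: "e > 0"
  obtains g where "star g = g" "g * (a + e *\<^sub>R 1) = 1" "(a + e *\<^sub>R 1) * g = 1"
proof -
  define r where "r = norm a + e"
  have r: "r > 0" "e \<le> r" using e by (auto simp: r_def add_nonneg_pos)
  define w where "w = 1 - (1/r) *\<^sub>R (a + e *\<^sub>R 1)"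
  have "w = (1/r) *\<^sub>R (norm a *\<^sub>R 1 - a)"
  proof -
    have "w = (1/r) *\<^sub>R (r *\<^sub>R 1 - (a + e *\<^sub>R 1))" using r by (simp add: w_def scaleR_diff_right)
    then show ?thesis by (simp add: r_def scaleR_add_left)
  qed
  moreover have "norm (norm a *\<^sub>R 1 - a) \<le> norm a"
    using a by (intro pos_cone_bound) (auto simp: positive_iff_pos_cone)
  ultimately have w: "norm w \<le> norm a / r" using r by (simp add: divide_right_mono)
  have "\<exists>!g. 1 + w * g = g"
  proof (rule banach_fix_type)
    show "norm a / r < 1" using r e by (simp add: r_def)
    show "\<forall>x y. dist (1 + w * x) (1 + w * y) \<le> norm a / r * dist x y"
    proof (intro allI)
      fix x y
      have "dist (1 + w * x) (1 + w * y) = norm (w * (x - y))" by (simp add: dist_norm right_diff_distrib)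
      also have "\<dots> \<le> norm w * norm (x - y)" by (rule norm_mult_ineq)
      also have "\<dots> \<le> norm a / r * norm (x - y)" using w by (rule mult_right_mono) simp
      finally show "dist (1 + w * x) (1 + w * y) \<le> norm a / r * dist x y" by (simp add: dist_norm)
    qed
  qed (use r in auto)
  then obtain g where "1 + w * g = g" by blast
  then have g: "((1/r) *\<^sub>R (a + e *\<^sub>R 1)) * g = 1"
    by (simp add: w_def left_diff_distrib algebra_simps)
  define h where "h = (1/r) *\<^sub>R g"
  have h: "(a + e *\<^sub>R 1) * h = 1" using g by (simp add: h_def)
  have "star ((a + e *\<^sub>R 1) * h) = 1" by (simp add: h)
  then have h': "star h * (a + e *\<^sub>R 1) = 1"
    by (simp add: star_mult star_add star_scaleR positive_star[OF a])
  have "star h = star h * ((a + e *\<^sub>R 1) * h)" by (simp add: h)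
  also have "\<dots> = h" by (simp only: mult.assoc[symmetric] h' mult_1)
  finally have "star h = h" .
  then show ?thesis using h h' that[of h] by simp
qed

lemma regularised_inverse_bound:
  fixes a :: "'a::unital_cstar_algebra"
  assumes a: "positive a" and e: "e > 0"
    and g: "star g = g" "g * (a + e *\<^sub>R 1) = 1" "(a + e *\<^sub>R 1) * g = 1"
  shows "norm ((e *\<^sub>R g) * a * (e *\<^sub>R g)) \<le> e"
proof -
  have ag: "a * g = 1 - e *\<^sub>R g" using g(3) by (simp add: distrib_right eq_diff_eq)
  have ga: "g * a = 1 - e *\<^sub>R g" using g(2) by (simp add: distrib_left eq_diff_eq)
  have pos1: "positive (g * (a * a + e *\<^sub>R a) * g)"
    using positive_conj[OF positive_add[OF positive_star_mult[of a] positive_scaleR[OF a, of e]], of g] e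
    by (simp add: g positive_star[OF a])
  have "g * (a * a + e *\<^sub>R a) * g = (g * (a + e *\<^sub>R 1)) * (a * g)"
    by (simp add: distrib_left distrib_right mult.assoc)
  then have p: "positive (a * g)" using pos1 by (simp add: g)
  have "positive (star g * (a + e *\<^sub>R 1) * g)"
    using e positive_scaleR[OF positive_star_mult[of "1::'a"], of e]
    by (intro positive_conj positive_add a) auto
  then have "positive g" by (simp add: g)
  then have eg: "positive (e *\<^sub>R g)" using e by (intro positive_scaleR) auto
  have n1: "norm (e *\<^sub>R g) \<le> 1" "norm (a * g) \<le> 1"
    using positive_norm_mono[OF eg, of 1] positive_norm_mono[OF p, of 1] p eg norm_one_le[where 'a = 'a]
    by (simp_all add: ag)
  have "(e *\<^sub>R g) * a * (e *\<^sub>R g) = e *\<^sub>R ((e *\<^sub>R g) * (a * g))" by (simp add: mult.assoc)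
  also have "norm \<dots> \<le> e * (1 * 1)"
    unfolding norm_scaleR
    by (intro mult_mono order_trans[OF norm_mult_ineq] n1) (use e in auto)
  finally show ?thesis by simp
qed

lemma left_action_adjoint:
  assumes "hilbert_module M" "left_action M \<pi>"
  shows "is_adjoint M (\<pi> a) (\<pi> (star a))"
proof -
  interpret hilbert_module M by fact
  have "is_adjoint M (\<pi> a) (adj M (\<pi> a))"
    using assms(2) by (intro adjointable_adj) (simp add: left_action_def)
  moreover have "\<pi> (star a) x = adj M (\<pi> a) x" if "x \<in> mcarrier M" for x
    using assms(2) that by (simp add: left_action_def)
  ultimately show ?thesis by (auto simp: is_adjoint_def)
qed

locale left_module = hilbert_module M
  for M :: "('m, 'c::unital_cstar_algebra) hmod" +
  fixes \<pi> :: "'b::unital_cstar_algebra \<Rightarrow> 'm \<Rightarrow> 'm"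
  assumes la: "left_action M \<pi>"
begin

lemma la_closed [simp, intro]: "x \<in> mcarrier M \<Longrightarrow> \<pi> a x \<in> mcarrier M"
  using left_action_adjoint[OF hilbert_module_axioms la, of a] by (auto simp: is_adjoint_def)

lemma la_adj: "x \<in> mcarrier M \<Longrightarrow> y \<in> mcarrier M \<Longrightarrow> minner M (\<pi> a x) y = minner M x (\<pi> (star a) y)"
  using left_action_adjoint[OF hilbert_module_axioms la, of a] by (auto simp: is_adjoint_def)

lemma la_mult: "x \<in> mcarrier M \<Longrightarrow> \<pi> (a * b) x = \<pi> a (\<pi> b x)"
  using la by (simp add: left_action_def)

lemma la_inner_add:
  "x \<in> mcarrier M \<Longrightarrow> y \<in> mcarrier M \<Longrightarrow>
    minner M x (\<pi> (a + b) y) = minner M x (\<pi> a y) + minner M x (\<pi> b y)"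
  using la by (simp add: left_action_def si_add)

lemma la_inner_scaleC:
  "x \<in> mcarrier M \<Longrightarrow> y \<in> mcarrier M \<Longrightarrow> minner M x (\<pi> (c *\<^sub>C a) y) = c *\<^sub>C minner M x (\<pi> a y)"
  using la by (simp add: left_action_def si_scale)

lemma la_inner_diff:
  "x \<in> mcarrier M \<Longrightarrow> y \<in> mcarrier M \<Longrightarrow>
    minner M x (\<pi> (a - b) y) = minner M x (\<pi> a y) - minner M x (\<pi> b y)"
  using la_inner_add[of x y "a - b" b] by simp

lemma la_mnorm:
  assumes x: "x \<in> mcarrier M" shows "mnorm M (\<pi> a x) \<le> norm a * mnorm M x"
proof -
  have one: "mnorm M (\<pi> 1 x) \<le> mnorm M x"
    by (rule mnorm_le_of_inner) (use x in \<open>simp_all add: la_adj flip: la_mult\<close>)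
  obtain d where d: "(norm a)\<^sup>2 *\<^sub>R 1 - star a * a = star d * d"
    using positive_norm_square_diff[of a] by (auto simp: positive_def)
  have "minner M x (\<pi> ((norm a)\<^sup>2 *\<^sub>R 1 - star a * a) x) = minner M (\<pi> d x) (\<pi> d x)"
    unfolding d by (simp add: la_adj la_mult x)
  then have "positive ((norm a)\<^sup>2 *\<^sub>R minner M x (\<pi> 1 x) - minner M (\<pi> a x) (\<pi> a x))"
    using si_positive[OF la_closed[OF x], of d]
    by (simp add: la_inner_diff x la_inner_scaleC scaleR_scaleC la_adj[of x "\<pi> a x"] flip: la_mult)
  then have "norm (minner M (\<pi> a x) (\<pi> a x)) \<le> norm ((norm a)\<^sup>2 *\<^sub>R minner M x (\<pi> 1 x))"
    using x by (intro positive_norm_mono si_positive) auto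
  also have "\<dots> \<le> (norm a)\<^sup>2 * (mnorm M x * mnorm M x)"
    using cauchy_schwarz[of x "\<pi> 1 x"] x one
    by (auto intro!: mult_left_mono elim: order_trans simp: mult_left_mono)
  finally show ?thesis by (subst mnorm_le_iff) (simp_all add: power_mult_distrib power2_eq_square mult_ac)
qed

lemma la_module_map: "module_map M M (\<pi> a) (norm a)"
  by (rule is_adjoint_module_map[OF left_action_adjoint[OF hilbert_module_axioms la]])
    (auto simp: la_mnorm)

lemmas la_mtends = module_map_mtends[OF semi_inner_module_axioms semi_inner_module_axioms la_module_map]

lemma la_inner_bound:
  assumes "x \<in> mcarrier M" "y \<in> mcarrier M"
  shows "norm (minner M x (\<pi> a y)) \<le> mnorm M x * norm a * mnorm M y"
proof -
  have "norm (minner M x (\<pi> a y)) \<le> mnorm M x * mnorm M (\<pi> a y)"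
    using assms by (intro cauchy_schwarz) auto
  also have "\<dots> \<le> mnorm M x * (norm a * mnorm M y)"
    using assms by (intro mult_left_mono la_mnorm) auto
  finally show ?thesis by (simp add: mult.assoc)
qed

end

lemma norm_sum_list_le:
  fixes f :: "'i \<Rightarrow> 'a::real_normed_vector"
  assumes "\<And>x. x \<in> set xs \<Longrightarrow> norm (f x) \<le> g x"
  shows "norm (\<Sum>x\<leftarrow>xs. f x) \<le> (\<Sum>x\<leftarrow>xs. g x)"
  using assms by (induction xs) (auto intro!: norm_triangle_mono)

definition tensor_form where
  "tensor_form E M \<pi> = (\<lambda>(x, f) (x', f'). minner M f (\<pi> (minner E x x') f'))"

lemma formal_tensors_list_module:
  "formal_tensors E M \<pi> = list_module (mcarrier E \<times> mcarrier M) (\<lambda>c (x, f). (x, mscale M c f))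
     (\<lambda>(x, f) a. (x, mact M f a)) (tensor_form E M \<pi>)"
  by (simp add: formal_tensors_def list_module_def tensor_form_def fun_eq_iff case_prod_unfold)

text \<open>Schur complement: subtracting from every \<open>y\<close> its regularised projection onto \<open>x\<close> changes the
  Gram matrix by a positive matrix and makes \<open>x\<close> itself negligible, which allows induction on the
  number of terms.\<close>

lemma tensor_form_positive:
  assumes "semi_inner_module E" "left_module M \<pi>" "s \<in> lists (mcarrier E \<times> mcarrier M)"
  shows "positive (\<Sum>p\<leftarrow>s. \<Sum>q\<leftarrow>s. tensor_form E M \<pi> p q)"
  using assms(3)
proof (induction "length s" arbitrary: s)
  case (Suc n)
  interpret E: semi_inner_module E by fact
  interpret M: left_module M \<pi> by fact
  let ?k = "tensor_form E M \<pi>"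
  obtain x f s' where s: "s = (x, f) # s'" and x: "x \<in> mcarrier E" and f: "f \<in> mcarrier M"
    and s': "s' \<in> lists (mcarrier E \<times> mcarrier M)" and n: "n = length s'"
    using Suc(2,3) by (cases s) auto
  define a where "a = minner E x x"
  have a: "positive a" using x by (simp add: a_def E.si_positive)
  define K where "K = mnorm M f * mnorm M f + (\<Sum>(y, h)\<leftarrow>s'. 2 * (mnorm M f * mnorm E y * mnorm M h))"
  have main: "\<exists>d. norm d \<le> sqrt e * K \<and> positive ((\<Sum>p\<leftarrow>s. \<Sum>q\<leftarrow>s. ?k p q) - d)"
    if e: "0 < e" "e \<le> 1" for e
  proof -
    obtain g where g: "star g = g" "g * (a + e *\<^sub>R 1) = 1" "(a + e *\<^sub>R 1) * g = 1"
      using positive_regularised_inverse[OF a e(1)] by blast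
    have ga: "g * a = 1 - e *\<^sub>R g" using g(2) by (simp add: distrib_left eq_diff_eq)
    have "positive (star g * (a + (e + e) *\<^sub>R 1) * g)"
      using e positive_scaleR[OF positive_star_mult[of "1::'b"], of "e + e"]
      by (intro positive_conj positive_add a) auto
    then obtain r where r: "g * (a + (e + e) *\<^sub>R 1) * g = star r * r" by (auto simp: positive_def g)
    have r': "star r * r = g + g - g * a * g"
    proof -
      have "g * (a + (e + e) *\<^sub>R 1) * g + g * a * g = g * ((a + e *\<^sub>R 1) * g) + g * ((a + e *\<^sub>R 1) * g)"
        by (simp add: distrib_left distrib_right scaleR_add_left mult.assoc)
          (simp flip: scaleR_add_left)
      then show ?thesis unfolding r by (simp add: g eq_diff_eq)
    qed
    define A where "A y = E.sub y (mact E x (g * minner E x y))" for y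
    have A: "A y \<in> mcarrier E" if "y \<in> mcarrier E" for y using that x by (simp add: A_def)
    have AA: "minner E (A y) (A y') = minner E y y' - star (r * minner E x y) * (r * minner E x y')"
      if "y \<in> mcarrier E" "y' \<in> mcarrier E" for y y'
    proof -
      define b b' where "b = minner E x y" and "b' = minner E x y'"
      have "minner E y x = star b" using that x by (simp add: b_def E.si_star)
      then have "minner E (A y) (A y') = minner E y y' - star b * (g * b') - (star b * g * b' - star b * g * (a * (g * b')))"
        using that x
        by (simp add: A_def E.si_sub E.si_sub_left E.si_act E.si_act_left star_mult g mult.assoc
            left_diff_distrib right_diff_distrib flip: a_def b_def b'_def)
      also have "\<dots> = minner E y y' - star b * (g + g - g * a * g) * b'"
        by (simp add: right_diff_distrib left_diff_distrib distrib_left distrib_right mult.assoc)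
      also have "\<dots> = minner E y y' - star (r * b) * (r * b')"
        unfolding r'[symmetric] by (simp add: star_mult mult.assoc)
      finally show ?thesis by (simp add: b_def b'_def)
    qed
    have nA: "mnorm E (A y) \<le> mnorm E y" if "y \<in> mcarrier E" for y
    proof -
      have "norm (minner E (A y) (A y)) \<le> norm (minner E y y)"
        using that by (intro positive_norm_mono E.si_positive A) (auto simp: AA)
      then show ?thesis by (simp add: mnorm_def)
    qed
    have nx: "mnorm E (A x) \<le> sqrt e"
    proof -
      have "minner E (A x) (A x) = (e *\<^sub>R g) * a * (e *\<^sub>R g)"
      proof -
        have "minner E (A x) (A x) = star (1 - g * a) * a * (1 - g * a)"
          using x by (simp add: A_def E.si_sub E.si_sub_left E.si_act E.si_act_left star_diff
              star_mult right_diff_distrib left_diff_distrib mult.assoc flip: a_def)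
        then show ?thesis by (simp add: ga star_scaleR g(1))
      qed
      then show ?thesis using regularised_inverse_bound[OF a e(1) g] by (simp add: mnorm_def)
    qed
    define A' where "A' = (\<lambda>(y, h :: 'c). (A y, h))"
    define G where "G = (\<lambda>(y, h). \<pi> (r * minner E x y) h)"
    have G: "G p \<in> mcarrier M" if "p \<in> mcarrier E \<times> mcarrier M" for p
      using that by (auto simp: G_def)
    have kA: "?k p q = ?k (A' p) (A' q) + minner M (G p) (G q)"
      if "p \<in> mcarrier E \<times> mcarrier M" "q \<in> mcarrier E \<times> mcarrier M" for p q
      using that by (auto simp: tensor_form_def A'_def G_def AA M.la_inner_diff M.la_adj
          star_mult M.la_mult[symmetric])
    have sI: "p \<in> mcarrier E \<times> mcarrier M" if "p \<in> set s" for p using that Suc(3) by auto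
    have "(\<Sum>p\<leftarrow>s. \<Sum>q\<leftarrow>s. ?k p q) = (\<Sum>p\<leftarrow>s. \<Sum>q\<leftarrow>s. ?k (A' p) (A' q) + minner M (G p) (G q))"
      by (intro sum_list_cong kA sI)
    also have "\<dots> = (\<Sum>p\<leftarrow>s. \<Sum>q\<leftarrow>s. ?k (A' p) (A' q)) + (\<Sum>p\<leftarrow>s. \<Sum>q\<leftarrow>s. minner M (G p) (G q))"
      by (simp add: sum_list_addf)
    also have "(\<Sum>p\<leftarrow>s. \<Sum>q\<leftarrow>s. minner M (G p) (G q)) = minner M (msum_list M (map G s)) (msum_list M (map G s))"
      using G sI by (subst M.inner_msum_list2) (auto simp: comp_def)
    finally have 1: "(\<Sum>p\<leftarrow>s. \<Sum>q\<leftarrow>s. ?k p q) = (\<Sum>p\<leftarrow>s. \<Sum>q\<leftarrow>s. ?k (A' p) (A' q))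
      + minner M (msum_list M (map G s)) (msum_list M (map G s))" .
    have mpos: "positive (minner M (msum_list M (map G s)) (msum_list M (map G s)))"
      using G sI by (intro M.si_positive M.msum_list_closed) auto
    define d where "d = ?k (A' (x, f)) (A' (x, f))
      + (\<Sum>q\<leftarrow>s'. ?k (A' (x, f)) (A' q) + ?k (A' q) (A' (x, f)))"
    have 2: "(\<Sum>p\<leftarrow>s. \<Sum>q\<leftarrow>s. ?k (A' p) (A' q)) = d + (\<Sum>p\<leftarrow>map A' s'. \<Sum>q\<leftarrow>map A' s'. ?k p q)"
      by (simp add: s d_def sum_list_addf comp_def)
    have "map A' s' \<in> lists (mcarrier E \<times> mcarrier M)" using s' A by (fastforce simp: A'_def)
    then have "positive (\<Sum>p\<leftarrow>map A' s'. \<Sum>q\<leftarrow>map A' s'. ?k p q)"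
      using n by (intro Suc(1)) auto
    then have "positive ((\<Sum>p\<leftarrow>s. \<Sum>q\<leftarrow>s. ?k p q) - d)"
      using positive_add mpos by (auto simp: 1 2)
    moreover have "norm d \<le> sqrt e * K"
    proof -
      have kb: "norm (?k (A' (y, h)) (A' (y', h'))) \<le> mnorm M h * (mnorm E (A y) * mnorm E (A y')) * mnorm M h'"
        if "y \<in> mcarrier E" "y' \<in> mcarrier E" "h \<in> mcarrier M" "h' \<in> mcarrier M" for y y' h h'
      proof -
        have "norm (?k (A' (y, h)) (A' (y', h'))) \<le> mnorm M h * norm (minner E (A y) (A y')) * mnorm M h'"
          using that by (simp add: tensor_form_def A'_def M.la_inner_bound)
        also have "\<dots> \<le> mnorm M h * (mnorm E (A y) * mnorm E (A y')) * mnorm M h'"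
          using that A by (intro mult_right_mono mult_left_mono E.cauchy_schwarz) auto
        finally show ?thesis .
      qed
      have "norm (?k (A' (x, f)) (A' (x, f))) \<le> sqrt e * (mnorm M f * mnorm M f)"
      proof -
        have "mnorm E (A x) * mnorm E (A x) \<le> sqrt e * 1"
          using nx e by (intro mult_mono) (auto elim: order_trans)
        then have "mnorm M f * (mnorm E (A x) * mnorm E (A x)) * mnorm M f \<le> mnorm M f * (sqrt e * 1) * mnorm M f"
          by (intro mult_right_mono mult_left_mono) auto
        then show ?thesis using kb[OF x x f f] by (simp add: mult_ac)
      qed
      moreover have "norm (\<Sum>q\<leftarrow>s'. ?k (A' (x, f)) (A' q) + ?k (A' q) (A' (x, f)))
          \<le> (\<Sum>(y, h)\<leftarrow>s'. sqrt e * (2 * (mnorm M f * mnorm E y * mnorm M h)))"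
      proof (rule norm_sum_list_le)
        fix q assume "q \<in> set s'"
        then obtain y h where q: "q = (y, h)" and y: "y \<in> mcarrier E" and h: "h \<in> mcarrier M" using s' by auto
        have le: "mnorm E (A x) * mnorm E (A y) \<le> sqrt e * mnorm E y"
          using nx nA[OF y] e by (intro mult_mono) auto
        have "mnorm M f * (mnorm E (A x) * mnorm E (A y)) * mnorm M h \<le> mnorm M f * (sqrt e * mnorm E y) * mnorm M h"
          by (intro mult_right_mono mult_left_mono le) auto
        then have "norm (?k (A' (x, f)) (A' q) + ?k (A' q) (A' (x, f)))
            \<le> mnorm M f * (sqrt e * mnorm E y) * mnorm M h + mnorm M f * (sqrt e * mnorm E y) * mnorm M h"
          using kb[OF x y f h] kb[OF y x h f] unfolding q
          by (intro norm_triangle_mono) (auto simp: mult_ac)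
        then show "norm (?k (A' (x, f)) (A' q) + ?k (A' q) (A' (x, f)))
            \<le> (case q of (y, h) \<Rightarrow> sqrt e * (2 * (mnorm M f * mnorm E y * mnorm M h)))"
          by (simp add: q mult_ac)
      qed
      ultimately have "norm d \<le> sqrt e * (mnorm M f * mnorm M f)
          + (\<Sum>(y, h)\<leftarrow>s'. sqrt e * (2 * (mnorm M f * mnorm E y * mnorm M h)))"
        unfolding d_def by (rule norm_triangle_mono)
      also have "\<dots> = sqrt e * K"
        by (simp add: K_def distrib_left case_prod_unfold flip: sum_list_const_mult)
      finally show ?thesis .
    qed
    ultimately show ?thesis by blast
  qed
  have "\<forall>n. \<exists>d. norm d \<le> sqrt (inverse (real (Suc n))) * K \<and> positive ((\<Sum>p\<leftarrow>s. \<Sum>q\<leftarrow>s. ?k p q) - d)"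
    by (intro allI main) (auto simp: field_simps)
  then obtain d where d: "\<And>n. norm (d n) \<le> sqrt (inverse (real (Suc n))) * K"
    "\<And>n. positive ((\<Sum>p\<leftarrow>s. \<Sum>q\<leftarrow>s. ?k p q) - d n)" by metis
  have "(\<lambda>n. sqrt (inverse (real (Suc n))) * K) \<longlonglongrightarrow> sqrt 0 * K"
    by (intro tendsto_intros LIMSEQ_inverse_real_of_nat)
  then have lim0: "(\<lambda>n. sqrt (inverse (real (Suc n))) * K) \<longlonglongrightarrow> 0" by simp
  have "d \<longlonglongrightarrow> 0"
    by (rule Lim_null_comparison[OF always_eventually[OF allI] lim0]) (rule d(1))
  then have "(\<lambda>n. (\<Sum>p\<leftarrow>s. \<Sum>q\<leftarrow>s. ?k p q) - d n) \<longlonglongrightarrow> (\<Sum>p\<leftarrow>s. \<Sum>q\<leftarrow>s. ?k p q) - 0"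
    by (intro tendsto_diff tendsto_const)
  then show ?case using positive_tendsto d(2) by fastforce
qed simp

lemma formal_tensors_semi_inner:
  assumes "semi_inner_module E" "left_module M \<pi>"
  shows "semi_inner_module (formal_tensors E M \<pi>)"
proof -
  interpret E: semi_inner_module E by fact
  interpret M: left_module M \<pi> by fact
  show ?thesis
    unfolding formal_tensors_list_module
  proof (rule list_module_semi_inner)
    show "positive (\<Sum>p\<leftarrow>s. \<Sum>q\<leftarrow>s. tensor_form E M \<pi> p q)" if "s \<in> lists (mcarrier E \<times> mcarrier M)" for s
      by (rule tensor_form_positive[OF assms that])
  qed (auto simp: tensor_form_def M.si_scale M.si_act M.si_star M.la_adj E.si_star
        module_mapD[OF M.la_module_map])
qed

section \<open>The induced dynamical system\<close>

lemma full_induct: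
  assumes "hilbert_module E" "full E" "closed {b. P b}" "P 0"
    and base: "\<And>x y. x \<in> mcarrier E \<Longrightarrow> y \<in> mcarrier E \<Longrightarrow> P (minner E x y)"
    and add: "\<And>a b. P a \<Longrightarrow> P b \<Longrightarrow> P (a + b)"
  shows "P b"
proof -
  interpret hilbert_module E by fact
  let ?B = "{minner E x y | x y. x \<in> mcarrier E \<and> y \<in> mcarrier E}"
  have "P b" if "b \<in> cspan ?B" for b
    using that
  proof (induction rule: complex_vector.span_induct_alt)
    case base
    show ?case by (rule assms(4))
  next
    case (step c a b)
    then obtain x y where "x \<in> mcarrier E" "y \<in> mcarrier E" "c *\<^sub>C a = minner E x (mscale E c y)"
      by (auto simp: si_scale)
    then show ?case using base add step by simp
  qed
  then have "closure (cspan ?B) \<subseteq> {b. P b}" by (intro closure_minimal assms(3)) auto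
  then show ?thesis using assms(2) unfolding full_def by auto
qed

lemma star_hom_continuous: "star_hom \<psi> \<Longrightarrow> continuous_on UNIV \<psi>"
proof -
  assume h: "star_hom \<psi>"
  have sub: "\<psi> x - \<psi> y = \<psi> (x - y)" for x y
    using h unfolding star_hom_def by (metis add_diff_cancel diff_add_cancel)
  show ?thesis
    unfolding continuous_on_iff dist_norm sub
    using star_hom_norm_le[OF h] by (meson order_le_less_trans)
qed

lemma closed_eq:
  assumes "continuous_on UNIV f" "continuous_on UNIV (g :: 'x::topological_space \<Rightarrow> 'y::t2_space)"
  shows "closed {b. f b = g b}"
  using assms by (rule closed_Collect_eq)

lemma star_hom_0: "star_hom \<psi> \<Longrightarrow> \<psi> 0 = 0"
  unfolding star_hom_def by (metis add_cancel_right_left add_0)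

locale full_dynamical_system = hilbert_module E
  for E :: "('e, 'b::unital_cstar_algebra) hmod" +
  fixes \<eta> :: "'g::{topological_group_add, t2_space} \<Rightarrow> 'e \<Rightarrow> 'e"
  assumes full: "full E" and dyn: "dynamical_system \<eta> E"
begin

definition \<alpha> :: "'g \<Rightarrow> 'b \<Rightarrow> 'b" where "\<alpha> = induced_system \<eta> E"

lemma \<eta>_closed [simp, intro]: "x \<in> mcarrier E \<Longrightarrow> \<eta> t x \<in> mcarrier E"
  using dyn unfolding dynamical_system_def hmod_aut_def hmod_morphism_def by blast

lemma \<eta>_add: "x \<in> mcarrier E \<Longrightarrow> \<eta> (s + t) x = \<eta> s (\<eta> t x)"
  using dyn unfolding dynamical_system_def by blast

lemma \<eta>_0: assumes "x \<in> mcarrier E" shows "\<eta> 0 x = x"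
proof -
  have "inj_on (\<eta> 0) (mcarrier E)"
    using dyn unfolding dynamical_system_def hmod_aut_def bij_betw_def by blast
  moreover have "\<eta> 0 (\<eta> 0 x) = \<eta> 0 x" using \<eta>_add[OF assms, of 0 0] by simp
  ultimately show ?thesis using assms by (auto dest: inj_onD)
qed

lemma \<eta>_inverse: "x \<in> mcarrier E \<Longrightarrow> \<eta> t (\<eta> (- t) x) = x"
  using \<eta>_add[of x t "-t"] \<eta>_0[of x] by simp

lemma \<eta>_mtends: "x \<in> mcarrier E \<Longrightarrow> mtends E (\<lambda>t. \<eta> t x) (\<eta> t0 x) (at t0)"
  using dyn unfolding dynamical_system_def mcontinuous_def mtends_def by auto

lemma induced_system_exists:
  "\<exists>\<alpha>. cstar_dynamical_system \<alpha> \<and>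
     (\<forall>t. \<forall>x\<in>mcarrier E. \<forall>y\<in>mcarrier E. \<alpha> t (minner E x y) = minner E (\<eta> t x) (\<eta> t y))"
proof -
  have "\<forall>t. \<exists>\<psi>. star_hom \<psi> \<and>
      (\<forall>x\<in>mcarrier E. \<forall>y\<in>mcarrier E. minner E (\<eta> t x) (\<eta> t y) = \<psi> (minner E x y))"
    using dyn unfolding dynamical_system_def hmod_aut_def hmod_morphism_def by blast
  then obtain \<alpha> where hom: "\<And>t. star_hom (\<alpha> t)" and
    \<alpha>: "\<And>t x y. x \<in> mcarrier E \<Longrightarrow> y \<in> mcarrier E \<Longrightarrow> \<alpha> t (minner E x y) = minner E (\<eta> t x) (\<eta> t y)"
    by metis
  note cont = star_hom_continuous[OF hom]
  have h_add: "\<alpha> t (a + b) = \<alpha> t a + \<alpha> t b" for t a b using hom[of t] by (simp add: star_hom_def)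
  note h_0 = star_hom_0[OF hom]
  have comp: "\<alpha> (s + t) b = \<alpha> s (\<alpha> t b)" for s t b
  proof (rule full_induct[OF hilbert_module_axioms full, where P = "\<lambda>b. \<alpha> (s + t) b = \<alpha> s (\<alpha> t b)"])
    have "continuous_on UNIV (\<lambda>b. \<alpha> s (\<alpha> t b))"
      by (rule continuous_on_compose2[OF cont cont]) auto
    then show "closed {b. \<alpha> (s + t) b = \<alpha> s (\<alpha> t b)}" by (intro closed_eq cont)
  qed (simp_all add: h_0 h_add \<alpha> \<eta>_add)
  have zero: "\<alpha> 0 b = b" for b
    by (rule full_induct[OF hilbert_module_axioms full, where P = "\<lambda>b. \<alpha> 0 b = b"])
      (simp_all add: h_0 h_add \<alpha> \<eta>_0 closed_eq[OF cont continuous_on_id])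
  have "bij (\<alpha> t)" for t
  proof (rule o_bij[of "\<alpha> (- t)"])
    show "\<alpha> (- t) \<circ> \<alpha> t = id" "\<alpha> t \<circ> \<alpha> (- t) = id"
      by (auto simp: fun_eq_iff zero simp flip: comp)
  qed
  moreover have "continuous_on UNIV (\<lambda>t. \<alpha> t b)" for b
  proof (rule full_induct[OF hilbert_module_axioms full, where P = "\<lambda>b. continuous_on UNIV (\<lambda>t. \<alpha> t b)"])
    show "closed {b. continuous_on UNIV (\<lambda>t. \<alpha> t b)}"
      unfolding closed_sequential_limits
    proof (intro allI impI, elim conjE)
      fix X b assume X: "\<forall>n. X n \<in> {b. continuous_on UNIV (\<lambda>t. \<alpha> t b)}" "X \<longlonglongrightarrow> b"
      have "uniform_limit UNIV (\<lambda>n t. \<alpha> t (X n)) (\<lambda>t. \<alpha> t b) sequentially"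
      proof (rule uniform_limitI)
        fix e :: real assume "e > 0"
        then have "\<forall>\<^sub>F n in sequentially. dist (X n) b < e" using X(2) by (rule tendstoD[rotated])
        then show "\<forall>\<^sub>F n in sequentially. \<forall>t\<in>UNIV. dist (\<alpha> t (X n)) (\<alpha> t b) < e"
        proof (rule eventually_mono)
          fix n assume n: "dist (X n) b < e"
          show "\<forall>t\<in>UNIV. dist (\<alpha> t (X n)) (\<alpha> t b) < e"
          proof
            fix t
            have "\<alpha> t (X n - b) + \<alpha> t b = \<alpha> t (X n)" using h_add[of t "X n - b" b] by simp
            then have "dist (\<alpha> t (X n)) (\<alpha> t b) = norm (\<alpha> t (X n - b))"
              by (simp add: dist_norm eq_diff_eq[symmetric])
            also have "\<dots> \<le> norm (X n - b)" by (rule star_hom_norm_le[OF hom])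
            finally show "dist (\<alpha> t (X n)) (\<alpha> t b) < e" using n by (simp add: dist_norm)
          qed
        qed
      qed
      then have "continuous_on UNIV (\<lambda>t. \<alpha> t b)"
        by (rule uniform_limit_theorem[rotated]) (use X in auto)
      then show "b \<in> {b. continuous_on UNIV (\<lambda>t. \<alpha> t b)}" by simp
    qed
  next
    fix x y assume xy: "x \<in> mcarrier E" "y \<in> mcarrier E"
    show "continuous_on UNIV (\<lambda>t. \<alpha> t (minner E x y))"
      unfolding continuous_on_def using mtends_inner[OF \<eta>_mtends[OF xy(1)] \<eta>_mtends[OF xy(2)]]
      by (simp add: \<alpha> xy)
  qed (auto simp: h_0 h_add intro: continuous_intros)
  ultimately show ?thesis
    unfolding cstar_dynamical_system_def using hom comp \<alpha> by (intro exI[of _ \<alpha>]) auto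
qed

lemma \<alpha>_properties:
  "cstar_dynamical_system \<alpha> \<and>
     (\<forall>t. \<forall>x\<in>mcarrier E. \<forall>y\<in>mcarrier E. \<alpha> t (minner E x y) = minner E (\<eta> t x) (\<eta> t y))"
proof -
  let ?P = "\<lambda>\<alpha>. cstar_dynamical_system \<alpha> \<and>
     (\<forall>t. \<forall>x\<in>mcarrier E. \<forall>y\<in>mcarrier E. \<alpha> t (minner E x y) = minner E (\<eta> t x) (\<eta> t y))"
  have "\<beta> = \<gamma>" if \<beta>: "?P \<beta>" and \<gamma>: "?P \<gamma>" for \<beta> \<gamma>
  proof (intro ext)
    fix t b
    have hom: "star_hom (\<beta> t)" "star_hom (\<gamma> t)" using that by (auto simp: cstar_dynamical_system_def)
    show "\<beta> t b = \<gamma> t b"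
    proof (rule full_induct[OF hilbert_module_axioms full, where P = "\<lambda>b. \<beta> t b = \<gamma> t b"])
      show "closed {b. \<beta> t b = \<gamma> t b}" by (intro closed_eq star_hom_continuous hom)
    qed (use hom that in \<open>auto simp: star_hom_0 star_hom_def\<close>)
  qed
  then have "\<exists>!\<alpha>. ?P \<alpha>" using induced_system_exists by blast
  then show ?thesis unfolding \<alpha>_def induced_system_def by (rule theI'[of ?P])
qed

lemma \<alpha>_inner: "x \<in> mcarrier E \<Longrightarrow> y \<in> mcarrier E \<Longrightarrow> \<alpha> t (minner E x y) = minner E (\<eta> t x) (\<eta> t y)"
  using \<alpha>_properties by blast

lemma \<alpha>_hom: "star_hom (\<alpha> t)"
  using \<alpha>_properties by (auto simp: cstar_dynamical_system_def)

lemma \<alpha>_simps: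
  "\<alpha> t (a + b) = \<alpha> t a + \<alpha> t b" "\<alpha> t (c *\<^sub>C a) = c *\<^sub>C \<alpha> t a" "\<alpha> t (a * b) = \<alpha> t a * \<alpha> t b"
  "\<alpha> t (star a) = star (\<alpha> t a)"
  using \<alpha>_hom[of t] by (auto simp: star_hom_def)

lemma \<alpha>_add: "\<alpha> (s + t) b = \<alpha> s (\<alpha> t b)"
  using \<alpha>_properties by (auto simp: cstar_dynamical_system_def)

lemma \<alpha>_continuous: "((\<lambda>t. \<alpha> t b) \<longlongrightarrow> \<alpha> t0 b) (at t0)"
  using \<alpha>_properties by (auto simp: cstar_dynamical_system_def continuous_on_def)

lemma \<alpha>_0: "\<alpha> 0 b = b"
proof -
  have "bij (\<alpha> 0)" using \<alpha>_properties by (auto simp: cstar_dynamical_system_def)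
  then show ?thesis using \<alpha>_add[of 0 0 b] by (simp add: bij_def inj_eq)
qed

lemma \<alpha>_one: "\<alpha> t 1 = 1"
proof -
  have "\<alpha> t 1 * \<alpha> t (\<alpha> (- t) 1) = \<alpha> t (\<alpha> (- t) 1)" by (simp flip: \<alpha>_simps)
  moreover have "\<alpha> t (\<alpha> (- t) 1) = 1" by (simp add: \<alpha>_0 flip: \<alpha>_add)
  ultimately show ?thesis by simp
qed

lemma \<eta>_act:
  assumes x: "x \<in> mcarrier E"
  shows "\<eta> t (mact E x b) = mact E (\<eta> t x) (\<alpha> t b)"
proof (rule inner_eqI)
  fix z assume z: "z \<in> mcarrier E"
  define y where "y = \<eta> (- t) z"
  have y: "y \<in> mcarrier E" "z = \<eta> t y" using z \<eta>_inverse by (auto simp: y_def)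
  show "minner E z (\<eta> t (mact E x b)) = minner E z (mact E (\<eta> t x) (\<alpha> t b))"
    using x y(1) by (simp add: y(2) si_act \<alpha>_simps flip: \<alpha>_inner)
qed (use x in auto)

end

section \<open>From the dilation to the kernel\<close>

locale tensor_setup = full_dynamical_system E \<eta> + M: left_module M \<pi>
  for E :: "('e, 'b::unital_cstar_algebra) hmod"
    and \<eta> :: "'g::{topological_group_add, t2_space} \<Rightarrow> 'e \<Rightarrow> 'e"
    and M :: "('m, 'c::unital_cstar_algebra) hmod"
    and \<pi> :: "'b \<Rightarrow> 'm \<Rightarrow> 'm"
begin

abbreviation "P \<equiv> formal_tensors E M \<pi>"
abbreviation "T \<equiv> interior_tensor E M \<pi>"
abbreviation "tens \<equiv> elem_tensor E M \<pi>"

lemma P_semi_inner: "semi_inner_module P"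
  by (rule formal_tensors_semi_inner[OF semi_inner_module_axioms M.left_module_axioms])

sublocale P: semi_inner_module P
  by (rule P_semi_inner)

lemma T_eq: "T = P.cM"
  by (simp add: interior_tensor_def)

sublocale T: hilbert_module T
  unfolding T_eq by (rule P.completion_hilbert)

lemma tens_eq: "tens x f = P.emb [(x, f)]"
  by (simp add: elem_tensor_def P.emb_def)

lemma P_carrier: "mcarrier P = lists (mcarrier E \<times> mcarrier M)"
  by (simp add: formal_tensors_def)

lemma P_memD:
  assumes "s \<in> mcarrier P" "(x, f) \<in> set s"
  shows "x \<in> mcarrier E" "f \<in> mcarrier M"
  using assms by (auto simp: P_carrier)

lemma tens_closed [simp, intro]: "x \<in> mcarrier E \<Longrightarrow> f \<in> mcarrier M \<Longrightarrow> tens x f \<in> mcarrier T"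
  by (simp add: tens_eq T_eq P.emb_closed P_carrier)

lemma tens_inner:
  assumes "x \<in> mcarrier E" "f \<in> mcarrier M" "x' \<in> mcarrier E" "f' \<in> mcarrier M"
  shows "minner T (tens x f) (tens x' f') = minner M f (\<pi> (minner E x x') f')"
  using assms by (simp add: tens_eq T_eq P.emb_inner P_carrier) (simp add: formal_tensors_def)

lemma tens_act: "x \<in> mcarrier E \<Longrightarrow> f \<in> mcarrier M \<Longrightarrow> tens x (mact M f c) = mact T (tens x f) c"
  using module_mapD(5)[OF P.emb_module_map, of "[(x, f)]" c]
  by (simp add: tens_eq T_eq P_carrier) (simp add: formal_tensors_def)

lemma tens_eqI:
  assumes "x \<in> mcarrier E" "f \<in> mcarrier M" "x' \<in> mcarrier E" "f' \<in> mcarrier M"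
    and "\<And>y h. y \<in> mcarrier E \<Longrightarrow> h \<in> mcarrier M \<Longrightarrow>
      minner M h (\<pi> (minner E y x) f) = minner M h (\<pi> (minner E y x') f')"
  shows "tens x f = tens x' f'"
  unfolding tens_eq
proof (rule P.emb_eqI)
  fix s assume "s \<in> mcarrier P"
  then show "minner P s [(x, f)] = minner P s [(x', f')]"
    by (simp add: P_carrier) (auto simp: formal_tensors_def case_prod_unfold assms(5) intro!: sum_list_cong)
qed (use assms in \<open>auto simp: P_carrier\<close>)

end

lemma dilation_imp_kernel:
  fixes u :: "'g::{topological_group_add, t2_space} \<Rightarrow> 'c::unital_cstar_algebra"
    and u' :: "'g \<Rightarrow> 'd::unital_cstar_algebra"
    and E :: "('e, 'b::unital_cstar_algebra) hmod"
    and F :: "('f, 'c) hmod"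
    and \<phi> :: "'d \<Rightarrow> 'f \<Rightarrow> 'f"
    and \<F> :: "('m, 'c) hmod"
  assumes u: "unitary_rep u"
    and E: "hilbert_module E" "full E" "dynamical_system \<eta> E"
    and F: "cstar_correspondence F \<phi>"
    and dil: "covariant_dilation u' u \<eta> S E F \<phi> K \<F> \<pi> \<ii> \<nu> v w'"
  shows "\<exists>\<KK>. cpd_kernel S \<KK> \<and> kernel_family S \<KK> E F K \<and> covariant_family u' u \<eta> S E F \<phi> K"
proof -
  have dil': "cstar_correspondence \<F> \<pi>" "\<ii> \<in> S \<rightarrow> mcarrier \<F>"
    "isometry_on (interior_tensor E \<F> \<pi>) F \<nu>"
    "\<And>x \<sigma>. x \<in> mcarrier E \<Longrightarrow> \<sigma> \<in> S \<Longrightarrow> \<nu> (elem_tensor E \<F> \<pi> x (\<ii> \<sigma>)) = K \<sigma> x"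
    "unitary_rep_on \<F> v"
    "\<And>b t f. f \<in> mcarrier \<F> \<Longrightarrow> \<pi> (induced_system \<eta> E t b) f = v t (\<pi> b (adj \<F> (v t) f))"
    "\<And>t \<sigma>. \<sigma> \<in> S \<Longrightarrow> v t (\<ii> \<sigma>) = mact \<F> (\<ii> \<sigma>) (u t)"
    "\<And>b c t x \<sigma>. x \<in> mcarrier E \<Longrightarrow> \<sigma> \<in> S \<Longrightarrow>
        w' t (elem_tensor E \<F> \<pi> x (mact \<F> (\<pi> b (\<ii> \<sigma>)) c)) =
        elem_tensor E \<F> \<pi> (\<eta> t x) (v t (mact \<F> (\<pi> b (\<ii> \<sigma>)) c))"
    "\<And>t z. z \<in> mcarrier (interior_tensor E \<F> \<pi>) \<Longrightarrow> \<nu> (w' t z) = \<phi> (u' t) (\<nu> z)"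
    using dil unfolding covariant_dilation_def Let_def by auto
  interpret tensor_setup E \<eta> \<F> \<pi>
    using E dil'(1)
    by (auto simp: tensor_setup_def full_dynamical_system_def full_dynamical_system_axioms_def
        left_module_def left_module_axioms_def cstar_correspondence_def)
  interpret F: left_module F \<phi>
    using F by (auto simp: left_module_def left_module_axioms_def cstar_correspondence_def)
  have i: "\<ii> \<sigma> \<in> mcarrier \<F>" if "\<sigma> \<in> S" for \<sigma> using dil'(2) that by auto
  have \<nu>: "module_map T F \<nu> 1"
    by (rule isometric_module_map[OF T.semi_inner_module_axioms F.hilbert_module_axioms])
      (use dil'(3) in \<open>auto simp: isometry_on_def\<close>)
  have \<nu>_inner: "minner F (\<nu> y) (\<nu> z) = minner T y z" if "y \<in> mcarrier T" "z \<in> mcarrier T" for y z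
    using dil'(3) that by (auto simp: isometry_on_def)
  define \<KK> where "\<KK> \<sigma> \<sigma>' b = minner \<F> (\<ii> \<sigma>) (\<pi> b (\<ii> \<sigma>'))" for \<sigma> \<sigma>' b
  have "cpd_kernel S \<KK>"
    unfolding cpd_kernel_def
  proof (intro conjI ballI allI impI)
    fix \<sigma> \<sigma>' assume \<sigma>: "\<sigma> \<in> S" "\<sigma>' \<in> S"
    show "bounded_clinear (\<KK> \<sigma> \<sigma>')"
      unfolding bounded_clinear_def
    proof (intro conjI allI)
      show "bounded_linear (\<KK> \<sigma> \<sigma>')"
      proof (rule bounded_linear_intro)
        show "norm (\<KK> \<sigma> \<sigma>' b) \<le> norm b * (mnorm \<F> (\<ii> \<sigma>) * mnorm \<F> (\<ii> \<sigma>'))" for b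
          using M.la_inner_bound[OF i[OF \<sigma>(1)] i[OF \<sigma>(2)], of b] by (simp add: \<KK>_def mult_ac)
      qed (simp_all add: \<KK>_def i \<sigma> M.la_inner_add M.la_inner_scaleC scaleR_scaleC)
    qed (simp add: \<KK>_def i \<sigma> M.la_inner_scaleC)
  next
    fix n :: nat and \<sigma> b c assume \<sigma>: "\<forall>i<n. \<sigma> i \<in> S"
    define g where "g j = mact \<F> (\<pi> (b j) (\<ii> (\<sigma> j))) (c j)" for j
    have g: "g j \<in> mcarrier \<F>" if "j < n" for j using \<sigma> i that by (simp add: g_def)
    have e: "star (c j) * \<KK> (\<sigma> j) (\<sigma> k) (star (b j) * b k) * c k = minner \<F> (g j) (g k)"
      if "j < n" "k < n" for j k
      using \<sigma> i that by (simp add: g_def \<KK>_def M.si_act M.si_act_left M.la_adj M.la_mult mult.assoc)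
    let ?xs = "map g [0..<n]"
    have sub: "set ?xs \<subseteq> mcarrier \<F>" using g by auto
    have "(\<Sum>j<n. \<Sum>k<n. star (c j) * \<KK> (\<sigma> j) (\<sigma> k) (star (b j) * b k) * c k)
        = (\<Sum>j<n. \<Sum>k<n. minner \<F> (g j) (g k))" by (intro sum.cong refl e) auto
    also have "\<dots> = minner \<F> (msum_list \<F> ?xs) (msum_list \<F> ?xs)"
      unfolding M.inner_msum_list2[OF sub sub]
      by (simp add: comp_def interv_sum_list_conv_sum_set_nat atLeast0LessThan)
    finally show "positive (\<Sum>j<n. \<Sum>k<n. star (c j) * \<KK> (\<sigma> j) (\<sigma> k) (star (b j) * b k) * c k)"
      using M.si_positive[OF M.msum_list_closed[OF sub]] by simp
  qed
  moreover have "kernel_family S \<KK> E F K"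
    unfolding kernel_family_def
    by (auto simp: \<KK>_def \<nu>_inner i tens_inner simp flip: dil'(4))
  moreover have "covariant_family u' u \<eta> S E F \<phi> K"
    unfolding covariant_family_def
  proof (intro allI ballI)
    fix t \<sigma> x assume \<sigma>: "\<sigma> \<in> S" and x: "x \<in> mcarrier E"
    note i = i[OF \<sigma>]
    have one: "tens y (\<pi> 1 (\<ii> \<sigma>)) = tens y (\<ii> \<sigma>)" if "y \<in> mcarrier E" for y
      using that i by (intro tens_eqI) (auto simp flip: M.la_mult)
    have vc: "v t f \<in> mcarrier \<F>" "adj \<F> (v t) (v t f) = f" if "f \<in> mcarrier \<F>" for f
      using dil'(5) that unfolding unitary_rep_on_def unitary_op_def adjointable_def is_adjoint_def by auto
    have v1: "v t (\<pi> 1 (\<ii> \<sigma>)) = \<pi> 1 (mact \<F> (\<ii> \<sigma>) (u t))"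
      using dil'(6)[OF vc(1)[OF i], of t 1] vc(2)[OF i] dil'(7)[OF \<sigma>, of t]
      by (simp add: \<alpha>_one flip: \<alpha>_def)
    have "w' t (tens x (\<ii> \<sigma>)) = w' t (tens x (mact \<F> (\<pi> 1 (\<ii> \<sigma>)) 1))"
      using x i by (simp add: M.act_one one)
    also have "\<dots> = tens (\<eta> t x) (v t (\<pi> 1 (\<ii> \<sigma>)))"
      using dil'(8)[OF x \<sigma>, of t 1 1] i by (simp add: M.act_one)
    also have "\<dots> = mact T (tens (\<eta> t x) (\<ii> \<sigma>)) (u t)"
      using x i by (simp add: v1 module_mapD(5)[OF M.la_module_map] tens_act one)
    finally have w: "w' t (tens x (\<ii> \<sigma>)) = mact T (tens (\<eta> t x) (\<ii> \<sigma>)) (u t)" .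
    have uu: "u t * star (u t) = 1" using u by (simp add: unitary_rep_def unitary_def)
    have "\<phi> (u' t) (K \<sigma> x) = \<nu> (w' t (tens x (\<ii> \<sigma>)))"
      using dil'(9)[of "tens x (\<ii> \<sigma>)" t] x i \<sigma> by (simp add: dil'(4))
    also have "\<dots> = mact F (K \<sigma> (\<eta> t x)) (u t)"
      using x i \<sigma> by (simp add: w module_mapD(5)[OF \<nu>] dil'(4))
    finally have "mact F (\<phi> (u' t) (K \<sigma> x)) (star (u t)) = mact F (mact F (K \<sigma> (\<eta> t x)) (u t)) (star (u t))"
      by simp
    moreover have "K \<sigma> (\<eta> t x) \<in> mcarrier F"
      using x i \<sigma> module_mapD(2)[OF \<nu>, of "tens (\<eta> t x) (\<ii> \<sigma>)"] by (simp add: dil'(4))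
    ultimately show "K \<sigma> (\<eta> t x) = mact F (\<phi> (u' t) (K \<sigma> x)) (star (u t))"
      by (simp add: F.act_act uu F.act_one)
  qed
  ultimately show ?thesis by blast
qed

section \<open>From the kernel to the dilation\<close>

lemma module_map_msum_list:
  assumes "hilbert_module N" "hilbert_module N'" "module_map N N' T C" "set xs \<subseteq> mcarrier N"
  shows "T (msum_list N xs) = msum_list N' (map T xs)"
  using assms(4)
proof (induction xs)
  case Nil
  interpret N: hilbert_module N by fact
  interpret N': hilbert_module N' by fact
  have "mnorm N' (T (mzero N)) \<le> C * mnorm N (mzero N)" by (rule module_mapD(3)[OF assms(3)]) simp
  then have "mnorm N' (T (mzero N)) = 0"
    using N'.mnorm_nonneg[of "T (mzero N)"] by (simp add: mnorm_def N.si_zero)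
  then have "T (mzero N) = mzero N'"
    by (intro N'.inner_definite module_mapD(2)[OF assms(3)]) (auto simp: mnorm_def)
  then show ?case by simp
next
  case (Cons x xs)
  interpret N: hilbert_module N by fact
  show ?case using Cons by (simp add: module_mapD(6)[OF assms(3)] N.msum_list_closed)
qed

lemma tendsto_sum_list:
  fixes f :: "'i \<Rightarrow> 'x \<Rightarrow> 'a::real_normed_vector"
  assumes "\<And>i. i \<in> set xs \<Longrightarrow> (f i \<longlongrightarrow> l i) F"
  shows "((\<lambda>x. \<Sum>i\<leftarrow>xs. f i x) \<longlongrightarrow> (\<Sum>i\<leftarrow>xs. l i)) F"
  using assms by (induction xs) (auto intro!: tendsto_add)

lemma sum_list_index: "(\<Sum>p\<leftarrow>s. f p) = (\<Sum>i<length s. f (s ! i))"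
  using sum_list_sum_nth[of "map f s"] by (simp add: atLeast0LessThan)

context left_module
begin

lemmas la_msum_list = module_map_msum_list[OF hilbert_module_axioms hilbert_module_axioms la_module_map]

lemma la_tendsto:
  assumes "h \<in> mcarrier M" "(b \<longlongrightarrow> b0) Q" "mtends M g g0 Q"
  shows "((\<lambda>t. minner M h (\<pi> (b t) (g t))) \<longlongrightarrow> minner M h (\<pi> b0 g0)) Q"
proof -
  have g: "g0 \<in> mcarrier M" "g t \<in> mcarrier M" for t using assms(3) by (auto simp: mtends_def)
  have "((\<lambda>t. minner M (\<pi> (star b0) h) (g t)) \<longlongrightarrow> minner M (\<pi> (star b0) h) g0) Q"
    using assms by (intro mtends_inner mtends_const) auto
  then have 1: "((\<lambda>t. minner M h (\<pi> b0 (g t))) \<longlongrightarrow> minner M h (\<pi> b0 g0)) Q"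
    using assms(1) g by (simp add: la_adj star_star)
  have "((\<lambda>t. mnorm M h * norm (b t - b0) * mnorm M (g t)) \<longlongrightarrow> mnorm M h * norm (b0 - b0) * mnorm M g0) Q"
    by (intro tendsto_intros assms(2) mtends_mnorm[OF assms(3)])
  then have "((\<lambda>t. mnorm M h * norm (b t - b0) * mnorm M (g t)) \<longlongrightarrow> 0) Q" by simp
  then have 2: "((\<lambda>t. minner M h (\<pi> (b t - b0) (g t))) \<longlongrightarrow> 0) Q"
    by (rule Lim_null_comparison[rotated]) (auto simp: la_inner_bound assms(1) g)
  from tendsto_add[OF 2 1] show ?thesis using assms(1) g by (simp add: la_inner_diff)
qed

end

locale covariant_kernel = full_dynamical_system E \<eta> + F: left_module F \<phi>
  for E :: "('e, 'b::unital_cstar_algebra) hmod"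
    and \<eta> :: "'g::{topological_group_add, t2_space} \<Rightarrow> 'e \<Rightarrow> 'e"
    and F :: "('f, 'c::unital_cstar_algebra) hmod"
    and \<phi> :: "'d::unital_cstar_algebra \<Rightarrow> 'f \<Rightarrow> 'f" +
  fixes u :: "'g \<Rightarrow> 'c" and u' :: "'g \<Rightarrow> 'd" and S :: "'s set"
    and K :: "'s \<Rightarrow> 'e \<Rightarrow> 'f" and \<KK> :: "'s \<Rightarrow> 's \<Rightarrow> 'b \<Rightarrow> 'c"
  assumes u: "unitary_rep u" and u': "unitary_rep u'"
    and K_closed: "\<And>\<sigma> x. \<sigma> \<in> S \<Longrightarrow> x \<in> mcarrier E \<Longrightarrow> K \<sigma> x \<in> mcarrier F"
    and cpd: "cpd_kernel S \<KK>" and fam: "kernel_family S \<KK> E F K"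
    and cov: "covariant_family u' u \<eta> S E F \<phi> K"
begin

lemma unitary_rep_0: "unitary_rep w \<Longrightarrow> w 0 = 1" for w :: "'g \<Rightarrow> 'z::unital_cstar_algebra"
proof -
  assume w: "unitary_rep w"
  then have "w 0 = w 0 * w 0" "star (w 0) * w 0 = 1"
    unfolding unitary_rep_def unitary_def by (metis add_0, blast)
  then show ?thesis by (metis mult.assoc mult_1)
qed

lemma u_unitary: "star (u t) * u t = 1" "u t * star (u t) = 1" "star (u' t) * u' t = 1"
  using u u' by (auto simp: unitary_rep_def unitary_def)

lemma u_add: "u (s + t) = u s * u t"
  using u by (simp add: unitary_rep_def)

lemma u_cancel: "star (u t) * (u t * a) = a" "u t * (u (- t) * a) = a"
proof -
  show "star (u t) * (u t * a) = a" by (simp add: u_unitary flip: mult.assoc)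
  show "u t * (u (- t) * a) = a" by (simp add: unitary_rep_0[OF u] flip: mult.assoc u_add)
qed

lemma K_cov: "\<sigma> \<in> S \<Longrightarrow> x \<in> mcarrier E \<Longrightarrow> K \<sigma> (\<eta> t x) = mact F (\<phi> (u' t) (K \<sigma> x)) (star (u t))"
  using cov by (simp add: covariant_family_def)

lemma \<phi>_one: "\<sigma> \<in> S \<Longrightarrow> x \<in> mcarrier E \<Longrightarrow> \<phi> 1 (K \<sigma> x) = K \<sigma> x"
  using K_cov[of \<sigma> x 0] by (simp add: \<eta>_0 unitary_rep_0 u u' F.act_one K_closed)

lemma K_inner: "\<lbrakk>\<sigma> \<in> S; \<sigma>' \<in> S; x \<in> mcarrier E; y \<in> mcarrier E\<rbrakk>
    \<Longrightarrow> minner F (K \<sigma> x) (K \<sigma>' y) = \<KK> \<sigma> \<sigma>' (minner E x y)"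
  using fam by (simp add: kernel_family_def)

lemma \<KK>_bounded: "\<sigma> \<in> S \<Longrightarrow> \<sigma>' \<in> S \<Longrightarrow> bounded_linear (\<KK> \<sigma> \<sigma>')"
  using cpd by (simp add: cpd_kernel_def bounded_clinear_def)

lemma \<KK>_linear:
  assumes "\<sigma> \<in> S" "\<sigma>' \<in> S"
  shows "\<KK> \<sigma> \<sigma>' (a + b) = \<KK> \<sigma> \<sigma>' a + \<KK> \<sigma> \<sigma>' b" "\<KK> \<sigma> \<sigma>' (a - b) = \<KK> \<sigma> \<sigma>' a - \<KK> \<sigma> \<sigma>' b"
    "\<KK> \<sigma> \<sigma>' (r *\<^sub>R a) = r *\<^sub>R \<KK> \<sigma> \<sigma>' a" "\<KK> \<sigma> \<sigma>' (c *\<^sub>C a) = c *\<^sub>C \<KK> \<sigma> \<sigma>' a" "\<KK> \<sigma> \<sigma>' 0 = 0"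
proof -
  interpret bounded_linear "\<KK> \<sigma> \<sigma>'" by (rule \<KK>_bounded[OF assms])
  show "\<KK> \<sigma> \<sigma>' (a + b) = \<KK> \<sigma> \<sigma>' a + \<KK> \<sigma> \<sigma>' b" "\<KK> \<sigma> \<sigma>' (a - b) = \<KK> \<sigma> \<sigma>' a - \<KK> \<sigma> \<sigma>' b"
    "\<KK> \<sigma> \<sigma>' (r *\<^sub>R a) = r *\<^sub>R \<KK> \<sigma> \<sigma>' a" "\<KK> \<sigma> \<sigma>' 0 = 0" by (rule add diff scaleR zero)+
  show "\<KK> \<sigma> \<sigma>' (c *\<^sub>C a) = c *\<^sub>C \<KK> \<sigma> \<sigma>' a" using cpd assms by (simp add: cpd_kernel_def bounded_clinear_def)
qed

lemma \<KK>_continuous: "\<sigma> \<in> S \<Longrightarrow> \<sigma>' \<in> S \<Longrightarrow> continuous_on UNIV (\<KK> \<sigma> \<sigma>')"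
  by (intro linear_continuous_on \<KK>_bounded)

lemma \<KK>_star:
  assumes "\<sigma> \<in> S" "\<sigma>' \<in> S" shows "star (\<KK> \<sigma> \<sigma>' b) = \<KK> \<sigma>' \<sigma> (star b)"
proof (rule full_induct[OF hilbert_module_axioms full, where P = "\<lambda>b. star (\<KK> \<sigma> \<sigma>' b) = \<KK> \<sigma>' \<sigma> (star b)"])
  have st: "continuous_on UNIV (star :: 'z::unital_cstar_algebra \<Rightarrow> 'z)"
    by (intro linear_continuous_on bounded_linear_star)
  show "closed {b. star (\<KK> \<sigma> \<sigma>' b) = \<KK> \<sigma>' \<sigma> (star b)}"
    by (intro closed_eq continuous_on_compose2[OF st \<KK>_continuous[OF assms]]
        continuous_on_compose2[OF \<KK>_continuous[OF assms(2,1)] st]) auto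
  fix x y assume xy: "x \<in> mcarrier E" "y \<in> mcarrier E"
  show "star (\<KK> \<sigma> \<sigma>' (minner E x y)) = \<KK> \<sigma>' \<sigma> (star (minner E x y))"
    using xy assms by (simp add: si_star F.si_star K_closed flip: K_inner)
qed (use assms in \<open>auto simp: \<KK>_linear star_add\<close>)

lemma \<KK>_cov:
  assumes "\<sigma> \<in> S" "\<sigma>' \<in> S" shows "\<KK> \<sigma> \<sigma>' (\<alpha> t b) = u t * \<KK> \<sigma> \<sigma>' b * star (u t)"
proof (rule full_induct[OF hilbert_module_axioms full, where P = "\<lambda>b. \<KK> \<sigma> \<sigma>' (\<alpha> t b) = u t * \<KK> \<sigma> \<sigma>' b * star (u t)"])
  show "closed {b. \<KK> \<sigma> \<sigma>' (\<alpha> t b) = u t * \<KK> \<sigma> \<sigma>' b * star (u t)}"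
    by (intro closed_eq continuous_on_compose2[OF \<KK>_continuous[OF assms] star_hom_continuous[OF \<alpha>_hom]]
        continuous_on_mult continuous_on_const \<KK>_continuous[OF assms]) auto
  fix x y assume xy: "x \<in> mcarrier E" "y \<in> mcarrier E"
  have "minner F (\<phi> (u' t) (K \<sigma> x)) (\<phi> (u' t) (K \<sigma>' y)) = minner F (K \<sigma> x) (K \<sigma>' y)"
    using xy assms by (simp add: F.la_adj K_closed u_unitary \<phi>_one flip: F.la_mult)
  then show "\<KK> \<sigma> \<sigma>' (\<alpha> t (minner E x y)) = u t * \<KK> \<sigma> \<sigma>' (minner E x y) * star (u t)"
    using xy assms by (simp add: \<alpha>_inner K_closed K_cov F.si_act F.si_act_left star_star mult.assoc
        flip: K_inner)
qed (use assms in \<open>auto simp: \<KK>_linear star_hom_0[OF \<alpha>_hom] \<alpha>_simps distrib_left distrib_right\<close>)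

text \<open>The triple \<open>(b, \<sigma>, c)\<close> stands for \<open>b \<ii>(\<sigma>) c\<close>; \<open>\<kappa> a\<close> is the form \<open>\<langle>b \<ii>(\<sigma>) c, a b' \<ii>(\<sigma>') c'\<rangle>\<close>.\<close>

definition I :: "('b \<times> 's \<times> 'c) set" where "I = UNIV \<times> S \<times> UNIV"

definition \<kappa> :: "'b \<Rightarrow> 'b \<times> 's \<times> 'c \<Rightarrow> 'b \<times> 's \<times> 'c \<Rightarrow> 'c" where
  "\<kappa> a = (\<lambda>(b, \<sigma>, c) (b', \<sigma>', c'). star c * \<KK> \<sigma> \<sigma>' (star b * a * b') * c')"

definition P0 :: "(('b \<times> 's \<times> 'c) list, 'c) hmod" where
  "P0 = list_module I (\<lambda>z (b, \<sigma>, c). (b, \<sigma>, z *\<^sub>C c)) (\<lambda>(b, \<sigma>, c) a. (b, \<sigma>, c * a)) (\<kappa> 1)"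

definition lact :: "'b \<Rightarrow> 'b \<times> 's \<times> 'c \<Rightarrow> 'b \<times> 's \<times> 'c" where
  "lact a = (\<lambda>(b, \<sigma>, c). (a * b, \<sigma>, c))"

definition vact :: "'g \<Rightarrow> 'b \<times> 's \<times> 'c \<Rightarrow> 'b \<times> 's \<times> 'c" where
  "vact t = (\<lambda>(b, \<sigma>, c). (\<alpha> t b, \<sigma>, u t * c))"

definition xact :: "'e \<Rightarrow> 'b \<times> 's \<times> 'c \<Rightarrow> 'f" where
  "xact x = (\<lambda>(b, \<sigma>, c). mact F (K \<sigma> (mact E x b)) c)"

lemma P0_carrier: "mcarrier P0 = lists I"
  by (simp add: P0_def)

lemma P0_inner: "minner P0 s t = (\<Sum>p\<leftarrow>s. \<Sum>q\<leftarrow>t. \<kappa> 1 p q)"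
  by (simp add: P0_def)

lemma lact_closed: "p \<in> I \<Longrightarrow> lact a p \<in> I"
  by (auto simp: I_def lact_def)

lemma vact_closed: "p \<in> I \<Longrightarrow> vact t p \<in> I"
  by (auto simp: I_def vact_def)

lemma map_closed: "(\<And>p. p \<in> I \<Longrightarrow> h p \<in> I) \<Longrightarrow> s \<in> mcarrier P0 \<Longrightarrow> map h s \<in> mcarrier P0"
  by (auto simp: P0_carrier)

lemma \<kappa>_linear:
  assumes "p \<in> I" "q \<in> I"
  shows "\<kappa> (a + b) p q = \<kappa> a p q + \<kappa> b p q" "\<kappa> (a - b) p q = \<kappa> a p q - \<kappa> b p q"
    "\<kappa> (r *\<^sub>R a) p q = r *\<^sub>R \<kappa> a p q" "\<kappa> (z *\<^sub>C a) p q = z *\<^sub>C \<kappa> a p q"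
  using assms
  by (auto simp: \<kappa>_def I_def \<KK>_linear distrib_left distrib_right left_diff_distrib right_diff_distrib
      scaleC_mult_left scaleC_mult_right)

lemma \<kappa>_lact: "\<kappa> a (lact b p) (lact c q) = \<kappa> (star b * a * c) p q"
  by (simp add: \<kappa>_def lact_def case_prod_unfold star_mult mult.assoc)

lemma \<kappa>_lact_right: "\<kappa> a p (lact c q) = \<kappa> (a * c) p q"
  by (simp add: \<kappa>_def lact_def case_prod_unfold star_mult mult.assoc)

lemma \<kappa>_vact: "p \<in> I \<Longrightarrow> q \<in> I \<Longrightarrow> \<kappa> 1 (vact t p) (vact t q) = \<kappa> 1 p q"
  by (auto simp: \<kappa>_def vact_def I_def star_mult mult.assoc u_cancel \<KK>_cov simp flip: \<alpha>_simps)

lemma xact_closed: "x \<in> mcarrier E \<Longrightarrow> p \<in> I \<Longrightarrow> xact x p \<in> mcarrier F"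
  by (auto simp: xact_def I_def K_closed)

lemma xact_inner:
  "\<lbrakk>x \<in> mcarrier E; y \<in> mcarrier E; p \<in> I; q \<in> I\<rbrakk>
    \<Longrightarrow> minner F (xact x p) (xact y q) = \<kappa> (minner E x y) p q"
  by (auto simp: xact_def I_def \<kappa>_def F.si_act F.si_act_left K_closed K_inner si_act si_act_left mult.assoc)

sublocale P0: semi_inner_module P0
  unfolding P0_def
proof (rule list_module_semi_inner)
  fix s :: "('b \<times> 's \<times> 'c) list" assume s: "s \<in> lists I"
  let ?b = "\<lambda>i. fst (s ! i)" and ?\<sigma> = "\<lambda>i. fst (snd (s ! i))" and ?c = "\<lambda>i. snd (snd (s ! i))"
  have "\<forall>i<length s. ?\<sigma> i \<in> S" using s by (auto simp: I_def in_lists_conv_set mem_Times_iff)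
  moreover have "(\<forall>i<n. \<sigma> i \<in> S) \<longrightarrow>
      positive (\<Sum>i<n. \<Sum>j<n. star (c i) * \<KK> (\<sigma> i) (\<sigma> j) (star (b i) * b j) * c j)"
    for n :: nat and \<sigma> b c
    using cpd by (simp add: cpd_kernel_def)
  ultimately have "positive (\<Sum>i<length s. \<Sum>j<length s. star (?c i) * \<KK> (?\<sigma> i) (?\<sigma> j) (star (?b i) * ?b j) * ?c j)"
    by (rule rev_mp)
  then show "positive (\<Sum>p\<leftarrow>s. \<Sum>q\<leftarrow>s. \<kappa> 1 p q)"
    by (simp add: sum_list_index \<kappa>_def case_prod_unfold)
qed (auto simp: I_def \<kappa>_def scaleC_mult_right star_mult star_star \<KK>_star mult.assoc)

abbreviation "\<F> \<equiv> P0.cM"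

sublocale \<F>: hilbert_module \<F>
  by (rule P0.completion_hilbert)

lemma emb_map:
  assumes h: "\<And>p. p \<in> I \<Longrightarrow> h p \<in> I"
    "\<And>z b \<sigma> c. \<sigma> \<in> S \<Longrightarrow> h (b, \<sigma>, z *\<^sub>C c) = (\<lambda>(b, \<sigma>, c). (b, \<sigma>, z *\<^sub>C c)) (h (b, \<sigma>, c))"
    "\<And>a b \<sigma> c. \<sigma> \<in> S \<Longrightarrow> h (b, \<sigma>, c * a) = (\<lambda>(b, \<sigma>, c). (b, \<sigma>, c * a)) (h (b, \<sigma>, c))"
    and C: "C \<ge> 0" "\<And>s. s \<in> lists I \<Longrightarrow> mnorm P0 (map h s) \<le> C * mnorm P0 s"
  shows "module_map P0 \<F> (\<lambda>s. P0.emb (map h s)) C"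
proof -
  have "map h (mscale P0 z s) = mscale P0 z (map h s)" "map h (mact P0 s a) = mact P0 (map h s) a"
    if "s \<in> lists I" for s z a
    using that h(2,3) by (auto simp: P0_def I_def case_prod_unfold)
  then have "module_map P0 P0 (map h) C"
    using C map_closed[OF h(1)] by (auto simp: module_map_def P0_carrier) (simp add: P0_def)
  from module_map_comp[OF this P0.emb_module_map] show ?thesis by simp
qed

lemma lact_mnorm:
  assumes s: "s \<in> lists I" shows "mnorm P0 (map (lact a) s) \<le> norm a * mnorm P0 s"
proof -
  define fm where "fm x = (\<Sum>p\<leftarrow>s. \<Sum>q\<leftarrow>s. \<kappa> x p q)" for x
  have sI: "p \<in> I" if "p \<in> set s" for p using s that by auto
  have fm_diff: "fm (x - y) = fm x - fm y" for x y
  proof -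
    have "fm (x - y) + fm y = fm x"
      unfolding fm_def sum_list_addf[symmetric] by (intro sum_list_cong) (simp add: \<kappa>_linear sI)
    then show ?thesis by (simp add: eq_diff_eq)
  qed
  have fm_scale: "fm (r *\<^sub>R x) = r *\<^sub>R fm x" for r x
    unfolding fm_def scaleR_scaleC scaleC_sum_list by (intro sum_list_cong) (simp add: \<kappa>_linear sI)
  have fm_lact: "minner P0 (map (lact d) s) (map (lact d) s) = fm (star d * d)" for d
    by (simp add: P0_inner fm_def comp_def \<kappa>_lact)
  have pos: "positive (fm (star d * d))" for d
    unfolding fm_lact[symmetric]
    by (intro P0.si_positive map_closed lact_closed) (simp_all add: P0_carrier s)
  obtain d where d: "(norm a)\<^sup>2 *\<^sub>R 1 - star a * a = star d * d"
    using positive_norm_square_diff[of a] by (auto simp: positive_def)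
  have "positive ((norm a)\<^sup>2 *\<^sub>R fm 1 - fm (star a * a))"
    using pos[of d] unfolding d[symmetric] by (simp only: fm_diff fm_scale)
  then have "norm (fm (star a * a)) \<le> norm ((norm a)\<^sup>2 *\<^sub>R fm 1)"
    by (intro positive_norm_mono pos)
  then have "norm (minner P0 (map (lact a) s) (map (lact a) s)) \<le> (norm a * mnorm P0 s)\<^sup>2"
    by (simp add: fm_lact power_mult_distrib P0.mnorm_square) (simp add: P0_inner fm_def)
  then show ?thesis by (subst P0.mnorm_le_iff) auto
qed

lemma lact_module_map: "module_map P0 \<F> (\<lambda>s. P0.emb (map (lact a) s)) (norm a)"
  by (rule emb_map) (auto simp: lact_closed lact_mnorm, auto simp: lact_def)

lemma map_vact_inner:
  assumes "s \<in> mcarrier P0" "s' \<in> mcarrier P0"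
  shows "minner P0 (map (vact t) s) (map (vact t) s') = minner P0 s s'"
  unfolding P0_inner
  by (simp add: comp_def, intro sum_list_cong \<kappa>_vact) (use assms in \<open>auto simp: P0_carrier\<close>)

lemma vact_module_map: "module_map P0 \<F> (\<lambda>s. P0.emb (map (vact t) s)) 1"
  by (rule emb_map) (auto simp: vact_closed mnorm_def map_vact_inner P0_carrier,
      auto simp: vact_def scaleC_mult_right mult.assoc)

definition \<pi> :: "'b \<Rightarrow> ('b, 's, 'c) dilation_space \<Rightarrow> ('b, 's, 'c) dilation_space" where
  "\<pi> a = P0.ext \<F> (\<lambda>s. P0.emb (map (lact a) s))"

definition v :: "'g \<Rightarrow> ('b, 's, 'c) dilation_space \<Rightarrow> ('b, 's, 'c) dilation_space" where
  "v t = P0.ext \<F> (\<lambda>s. P0.emb (map (vact t) s))"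

lemma \<pi>_module_map: "module_map \<F> \<F> (\<pi> a) (norm a)"
  and \<pi>_emb: "s \<in> mcarrier P0 \<Longrightarrow> \<pi> a (P0.emb s) = P0.emb (map (lact a) s)"
  unfolding \<pi>_def by (rule P0.ext_module_map[OF P0.completion_hilbert lact_module_map], assumption?)+

lemma v_module_map: "module_map \<F> \<F> (v t) 1"
  and v_emb: "s \<in> mcarrier P0 \<Longrightarrow> v t (P0.emb s) = P0.emb (map (vact t) s)"
  unfolding v_def by (rule P0.ext_module_map[OF P0.completion_hilbert vact_module_map], assumption?)+

lemmas \<pi>_mtends = module_map_mtends[OF \<F>.semi_inner_module_axioms \<F>.semi_inner_module_axioms \<pi>_module_map]
  and v_mtends = module_map_mtends[OF \<F>.semi_inner_module_axioms \<F>.semi_inner_module_axioms v_module_map]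

lemma \<pi>_closed: "x \<in> mcarrier \<F> \<Longrightarrow> \<pi> a x \<in> mcarrier \<F>"
  by (rule module_mapD(2)[OF \<pi>_module_map])

lemma v_closed: "x \<in> mcarrier \<F> \<Longrightarrow> v t x \<in> mcarrier \<F>"
  by (rule module_mapD(2)[OF v_module_map])

lemma \<F>_eqI:
  assumes "z \<in> mcarrier \<F>"
    and "\<And>X. mtends \<F> X z sequentially \<Longrightarrow> mtends \<F> (\<lambda>n. f (X n)) (f z) sequentially"
    and "\<And>X. mtends \<F> X z sequentially \<Longrightarrow> mtends \<F> (\<lambda>n. g (X n)) (g z) sequentially"
    and "\<And>s. s \<in> mcarrier P0 \<Longrightarrow> f (P0.emb s) = g (P0.emb s)"
  shows "f z = g z"
  using P0.completion_eqI[OF P0.completion_hilbert assms] .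

lemma left_action_\<pi>: "left_action \<F> \<pi>"
proof -
  have adj: "is_adjoint \<F> (\<pi> a) (\<pi> (star a))" for a
    unfolding is_adjoint_def
  proof (intro conjI ballI)
    fix y z assume yz: "y \<in> mcarrier \<F>" "z \<in> mcarrier \<F>"
    show "minner \<F> (\<pi> a y) z = minner \<F> y (\<pi> (star a) z)"
    proof (rule P0.completion_inner_eqI[OF yz])
      fix s t assume st: "s \<in> mcarrier P0" "t \<in> mcarrier P0"
      have "minner P0 (map (lact a) s) t = minner P0 s (map (lact (star a)) t)"
        by (simp add: P0_inner comp_def) (simp add: \<kappa>_def lact_def case_prod_unfold star_mult mult.assoc)
      then show "minner \<F> (\<pi> a (P0.emb s)) (P0.emb t) = minner \<F> (P0.emb s) (\<pi> (star a) (P0.emb t))"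
        using st by (simp add: \<pi>_emb P0.emb_inner map_closed lact_closed)
    qed (auto intro!: \<F>.mtends_inner \<pi>_mtends)
  qed (auto simp: \<pi>_closed)
  show ?thesis
    unfolding left_action_def
  proof (intro conjI allI ballI)
    show "adjointable \<F> (\<pi> a)" for a using adj by (auto simp: adjointable_def)
    fix x assume x: "x \<in> mcarrier \<F>"
    show "\<pi> (star a) x = adj \<F> (\<pi> a) x" for a using \<F>.is_adjoint_adj[OF adj x] by simp
    show "\<pi> (a * b) x = \<pi> a (\<pi> b x)" for a b
    proof (rule \<F>_eqI[OF x, where f = "\<pi> (a * b)" and g = "\<lambda>x. \<pi> a (\<pi> b x)"])
      fix s assume s: "s \<in> mcarrier P0"
      have "map (lact (a * b)) s = map (lact a) (map (lact b) s)"
        by (simp add: lact_def case_prod_unfold mult.assoc)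
      then show "\<pi> (a * b) (P0.emb s) = \<pi> a (\<pi> b (P0.emb s))"
        using s by (simp add: \<pi>_emb map_closed lact_closed del: map_map)
    qed (auto intro!: \<pi>_mtends)
    show "\<pi> (c *\<^sub>C a) x = mscale \<F> c (\<pi> a x)" for c a
    proof (rule \<F>_eqI[OF x, where f = "\<pi> (c *\<^sub>C a)" and g = "\<lambda>x. mscale \<F> c (\<pi> a x)"])
      fix s assume s: "s \<in> mcarrier P0"
      have m: "map (lact a) s \<in> mcarrier P0" for a using s by (intro map_closed lact_closed)
      have "P0.emb (map (lact (c *\<^sub>C a)) s) = P0.emb (mscale P0 c (map (lact a) s))"
      proof (rule P0.emb_eqI)
        fix z assume z: "z \<in> mcarrier P0"
        have "minner P0 z (map (lact (c *\<^sub>C a)) s) = c *\<^sub>C minner P0 z (map (lact a) s)"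
          unfolding P0_inner
          by (simp add: comp_def \<kappa>_lact_right scaleC_sum_list, intro sum_list_cong \<kappa>_linear)
            (use s z in \<open>auto simp: P0_carrier\<close>)
        then show "minner P0 z (map (lact (c *\<^sub>C a)) s) = minner P0 z (mscale P0 c (map (lact a) s))"
          using z m by (simp add: P0.si_scale)
      qed (use m in auto)
      then show "\<pi> (c *\<^sub>C a) (P0.emb s) = mscale \<F> c (\<pi> a (P0.emb s))"
        using s m by (simp add: \<pi>_emb module_mapD(4)[OF P0.emb_module_map])
    qed (auto intro!: \<pi>_mtends \<F>.mtends_scale)
    show "\<pi> (a + b) x = madd \<F> (\<pi> a x) (\<pi> b x)" for a b
    proof (rule \<F>_eqI[OF x, where f = "\<pi> (a + b)" and g = "\<lambda>x. madd \<F> (\<pi> a x) (\<pi> b x)"])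
      fix s assume s: "s \<in> mcarrier P0"
      have m: "map (lact a) s \<in> mcarrier P0" for a using s by (intro map_closed lact_closed)
      have "P0.emb (map (lact (a + b)) s) = P0.emb (madd P0 (map (lact a) s) (map (lact b) s))"
      proof (rule P0.emb_eqI)
        fix z assume z: "z \<in> mcarrier P0"
        have "minner P0 z (map (lact (a + b)) s) = minner P0 z (map (lact a) s) + minner P0 z (map (lact b) s)"
          unfolding P0_inner
          by (simp add: comp_def \<kappa>_lact_right flip: sum_list_addf, intro sum_list_cong \<kappa>_linear)
            (use s z in \<open>auto simp: P0_carrier\<close>)
        then show "minner P0 z (map (lact (a + b)) s) = minner P0 z (madd P0 (map (lact a) s) (map (lact b) s))"
          using z m by (simp add: P0.si_add)
      qed (use m in auto)
      then show "\<pi> (a + b) (P0.emb s) = madd \<F> (\<pi> a (P0.emb s)) (\<pi> b (P0.emb s))"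
        using s m by (simp add: \<pi>_emb module_mapD(6)[OF P0.emb_module_map])
    qed (auto intro!: \<pi>_mtends \<F>.mtends_add)
  qed
qed

lemma v_rep: "unitary_rep_on \<F> v"
  and v_adj: "y \<in> mcarrier \<F> \<Longrightarrow> adj \<F> (v t) y = v (- t) y"
proof -
  have "unitary_rep_on \<F> v \<and> (\<forall>t y. y \<in> mcarrier \<F> \<longrightarrow> adj \<F> (v t) y = v (- t) y)"
  proof (intro conjI allI impI)
    note rule = P0.unitary_rep_on_completionI[OF v_module_map]
    have 1: "minner \<F> (v t (P0.emb s)) (v t (P0.emb s')) = minner P0 s s'"
      if "s \<in> mcarrier P0" "s' \<in> mcarrier P0" for t s s'
      using that by (simp add: v_emb P0.emb_inner map_closed vact_closed map_vact_inner)
    have 2: "v 0 (P0.emb s) = P0.emb s" if "s \<in> mcarrier P0" for s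
    proof -
      have "vact 0 = id" by (auto simp: vact_def fun_eq_iff \<alpha>_0 unitary_rep_0[OF u])
      then show ?thesis using that by (simp add: v_emb)
    qed
    have 3: "v (t + t') (P0.emb s) = v t (v t' (P0.emb s))" if "s \<in> mcarrier P0" for t t' s
    proof -
      have "map (vact (t + t')) s = map (vact t) (map (vact t') s)"
        by (simp add: vact_def case_prod_unfold \<alpha>_add u_add mult.assoc)
      then show ?thesis using that by (simp add: v_emb map_closed vact_closed del: map_map)
    qed
    have 4: "((\<lambda>t. minner \<F> (v t0 (P0.emb s)) (v t (P0.emb s))) \<longlongrightarrow> minner P0 s s) (at t0)"
      if s: "s \<in> mcarrier P0" for s t0
    proof -
      have ut: "(u \<longlongrightarrow> u t0) (at t0)" using u by (simp add: unitary_rep_def continuous_on_def)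
      have "((\<lambda>t. \<Sum>p\<leftarrow>s. \<Sum>q\<leftarrow>s. \<kappa> 1 (vact t0 p) (vact t q)) \<longlongrightarrow> (\<Sum>p\<leftarrow>s. \<Sum>q\<leftarrow>s. \<kappa> 1 (vact t0 p) (vact t0 q))) (at t0)"
      proof (intro tendsto_sum_list)
        fix p q assume "p \<in> set s" "q \<in> set s"
        then have "p \<in> I" "q \<in> I" using s by (auto simp: P0_carrier)
        then obtain b \<sigma> c b' \<sigma>' c' where pq: "p = (b, \<sigma>, c)" "q = (b', \<sigma>', c')" "\<sigma> \<in> S" "\<sigma>' \<in> S"
          by (auto simp: I_def)
        show "((\<lambda>t. \<kappa> 1 (vact t0 p) (vact t q)) \<longlongrightarrow> \<kappa> 1 (vact t0 p) (vact t0 q)) (at t0)"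
          unfolding pq(1,2) \<kappa>_def vact_def prod.case
          by (intro tendsto_mult tendsto_const ut bounded_linear.tendsto[OF \<KK>_bounded[OF pq(3,4)]] \<alpha>_continuous)
      qed
      then show ?thesis using s map_vact_inner[of s s t0]
        by (simp add: v_emb P0.emb_inner map_closed vact_closed) (simp add: P0_inner comp_def)
    qed
    show "unitary_rep_on \<F> v" by (rule rule(1)) (fact 1 2 3 4)+
    show "adj \<F> (v t) y = v (- t) y" if "y \<in> mcarrier \<F>" for t y
      by (rule rule(2)) (fact 1 2 3 4 that)+
  qed
  then show "unitary_rep_on \<F> v" "y \<in> mcarrier \<F> \<Longrightarrow> adj \<F> (v t) y = v (- t) y" by auto
qed

lemma v_unitary:
  assumes "f \<in> mcarrier \<F>"
  shows "v (s + t) f = v s (v t f)" "v (- t) (v t f) = f" "v 0 f = f"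
    "f' \<in> mcarrier \<F> \<Longrightarrow> minner \<F> (v t f) (v t f') = minner \<F> f f'"
proof -
  show add: "v (s + t) f = v s (v t f)" for s t using v_rep assms by (simp add: unitary_rep_on_def)
  have op: "unitary_op \<F> (v t)" for t using v_rep by (simp add: unitary_rep_on_def)
  show inv: "v (- t) (v t f) = f" for t
  proof -
    have "adj \<F> (v t) (v t f) = f" using op[of t] assms by (simp add: unitary_op_def)
    then show ?thesis by (simp add: v_adj v_closed assms)
  qed
  show "v 0 f = f" using inv[of 0] add[of 0 0] by simp
  show "f' \<in> mcarrier \<F> \<Longrightarrow> minner \<F> (v t f) (v t f') = minner \<F> f f'"
    by (rule \<F>.unitary_op_isometric[OF op assms])
qed

lemma \<pi>_covariant:
  assumes f: "f \<in> mcarrier \<F>" shows "\<pi> (\<alpha> t b) f = v t (\<pi> b (v (- t) f))"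
proof (rule \<F>_eqI[OF f, where f = "\<pi> (\<alpha> t b)" and g = "\<lambda>f. v t (\<pi> b (v (- t) f))"])
  fix s assume s: "s \<in> mcarrier P0"
  have \<alpha>: "\<alpha> t (\<alpha> (- t) a) = a" for a by (simp add: \<alpha>_0 flip: \<alpha>_add)
  have "map (lact (\<alpha> t b)) s = map (vact t) (map (lact b) (map (vact (- t)) s))"
    by (simp add: lact_def vact_def case_prod_unfold \<alpha>_simps u_cancel \<alpha>)
  then show "\<pi> (\<alpha> t b) (P0.emb s) = v t (\<pi> b (v (- t) (P0.emb s)))"
    using s by (simp add: v_emb \<pi>_emb map_closed vact_closed lact_closed del: map_map)
qed (auto intro!: \<pi>_mtends v_mtends)

sublocale D: tensor_setup E \<eta> \<F> \<pi>
  by unfold_locales (rule left_action_\<pi>)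

definition \<ii> :: "'s \<Rightarrow> ('b, 's, 'c) dilation_space" where "\<ii> \<sigma> = P0.emb [(1, \<sigma>, 1)]"

lemma single_closed: "\<sigma> \<in> S \<Longrightarrow> [(b, \<sigma>, c)] \<in> mcarrier P0"
  by (simp add: P0_carrier I_def)

lemma v_\<ii>: "\<sigma> \<in> S \<Longrightarrow> v t (\<ii> \<sigma>) = mact \<F> (\<ii> \<sigma>) (u t)"
  using module_mapD(5)[OF P0.emb_module_map, of "[(1, \<sigma>, 1)]" "u t"]
  by (simp add: \<ii>_def v_emb single_closed vact_def \<alpha>_one) (simp add: P0_def)

text \<open>\<open>nu x f\<close> is the value of the isometry at \<open>x \<odot> f\<close>.\<close>

definition nu :: "'e \<Rightarrow> ('b, 's, 'c) dilation_space \<Rightarrow> 'f" where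
  "nu x = P0.ext F (\<lambda>s. msum_list F (map (xact x) s))"

lemma xact_sum_inner:
  assumes "x \<in> mcarrier E" "y \<in> mcarrier E" "s \<in> mcarrier P0" "s' \<in> mcarrier P0"
  shows "minner F (msum_list F (map (xact x) s)) (msum_list F (map (xact y) s'))
    = minner P0 s (map (lact (minner E x y)) s')"
proof -
  have "set (map (xact x) s) \<subseteq> mcarrier F" "set (map (xact y) s') \<subseteq> mcarrier F"
    using assms xact_closed by (auto simp: P0_carrier)
  then show ?thesis
    by (simp add: F.inner_msum_list2 P0_inner comp_def \<kappa>_lact_right, intro sum_list_cong xact_inner)
      (use assms in \<open>auto simp: P0_carrier\<close>)
qed

lemma xact_module_map:
  assumes x: "x \<in> mcarrier E"
  shows "module_map P0 F (\<lambda>s. msum_list F (map (xact x) s)) (mnorm E x)"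
  unfolding P0_def
proof (rule F.list_module_map)
  fix s assume s: "s \<in> lists I"
  have "norm (minner P0 s (map (lact (minner E x x)) s)) \<le> mnorm P0 s * mnorm P0 (map (lact (minner E x x)) s)"
    using s by (intro P0.cauchy_schwarz map_closed lact_closed) (auto simp: P0_carrier)
  also have "\<dots> \<le> mnorm P0 s * (norm (minner E x x) * mnorm P0 s)"
    by (intro mult_left_mono lact_mnorm s) simp
  finally have "norm (minner F (msum_list F (map (xact x) s)) (msum_list F (map (xact x) s))) \<le> (mnorm E x * mnorm P0 s)\<^sup>2"
    using x s
    by (simp add: xact_sum_inner P0_carrier power_mult_distrib mnorm_square)
      (simp add: power2_eq_square mult_ac)
  then show "mnorm F (msum_list F (map (xact x) s)) \<le> mnorm E x
      * mnorm (list_module I (\<lambda>z (b, \<sigma>, c). (b, \<sigma>, z *\<^sub>C c)) (\<lambda>(b, \<sigma>, c) a. (b, \<sigma>, c * a)) (\<kappa> 1)) s"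
    unfolding P0_def[symmetric] by (subst F.mnorm_le_iff) auto
qed (use x xact_closed in \<open>auto simp: xact_def I_def K_closed F.act_scale_right F.act_act\<close>)

lemma nu_module_map: "x \<in> mcarrier E \<Longrightarrow> module_map \<F> F (nu x) (mnorm E x)"
  and nu_emb: "x \<in> mcarrier E \<Longrightarrow> s \<in> mcarrier P0 \<Longrightarrow> nu x (P0.emb s) = msum_list F (map (xact x) s)"
  unfolding nu_def using P0.ext_module_map[OF F.hilbert_module_axioms xact_module_map] by auto

lemma nu_closed: "x \<in> mcarrier E \<Longrightarrow> f \<in> mcarrier \<F> \<Longrightarrow> nu x f \<in> mcarrier F"
  by (rule module_mapD(2)[OF nu_module_map])

lemma nu_mtends: "x \<in> mcarrier E \<Longrightarrow> mtends \<F> X f Q \<Longrightarrow> mtends F (\<lambda>n. nu x (X n)) (nu x f) Q"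
  by (rule module_map_mtends[OF \<F>.semi_inner_module_axioms F.semi_inner_module_axioms nu_module_map])

lemma nu_inner:
  assumes x: "x \<in> mcarrier E" "y \<in> mcarrier E" and f: "f \<in> mcarrier \<F>" "h \<in> mcarrier \<F>"
  shows "minner F (nu x f) (nu y h) = minner \<F> f (\<pi> (minner E x y) h)"
proof (rule P0.completion_inner_eqI[OF f])
  fix s t assume "s \<in> mcarrier P0" "t \<in> mcarrier P0"
  then show "minner F (nu x (P0.emb s)) (nu y (P0.emb t)) = minner \<F> (P0.emb s) (\<pi> (minner E x y) (P0.emb t))"
    using x by (simp add: nu_emb xact_sum_inner \<pi>_emb P0.emb_inner map_closed lact_closed)
qed (auto intro!: \<F>.mtends_inner F.mtends_inner \<pi>_mtends nu_mtends x)

lemma nu_covariant: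
  assumes x: "x \<in> mcarrier E" and f: "f \<in> mcarrier \<F>"
  shows "nu (\<eta> t x) (v t f) = \<phi> (u' t) (nu x f)"
proof (rule P0.completion_eqI[OF F.hilbert_module_axioms f,
      where f = "\<lambda>f. nu (\<eta> t x) (v t f)" and g = "\<lambda>f. \<phi> (u' t) (nu x f)"])
  fix s assume s: "s \<in> mcarrier P0"
  have "xact (\<eta> t x) (vact t p) = \<phi> (u' t) (xact x p)" if "p \<in> I" for p
    using that x
    by (auto simp: xact_def vact_def I_def K_cov K_closed F.act_act u_cancel
        module_mapD(5)[OF F.la_module_map] simp flip: \<eta>_act)
  then have "map (xact (\<eta> t x)) (map (vact t) s) = map (\<phi> (u' t)) (map (xact x) s)"
    using s by (auto simp: P0_carrier)
  moreover have "\<phi> (u' t) (msum_list F (map (xact x) s)) = msum_list F (map (\<phi> (u' t)) (map (xact x) s))"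
    using s x xact_closed
    by (intro F.la_msum_list)
      (auto simp: P0_carrier)
  ultimately show "nu (\<eta> t x) (v t (P0.emb s)) = \<phi> (u' t) (nu x (P0.emb s))"
    using s x by (simp add: nu_emb v_emb map_closed vact_closed del: map_map)
qed (auto intro!: nu_mtends v_mtends x
      F.la_mtends)

definition \<nu> where "\<nu> = D.P.ext F (\<lambda>s. msum_list F (map (\<lambda>(x, f). nu x f) s))"

lemma nu_sum_inner:
  assumes "s \<in> mcarrier D.P" "t \<in> mcarrier D.P"
  shows "minner F (msum_list F (map (\<lambda>(x, f). nu x f) s)) (msum_list F (map (\<lambda>(x, f). nu x f) t)) = minner D.P s t"
proof -
  have sub: "set (map (\<lambda>(x, f). nu x f) s) \<subseteq> mcarrier F" if "s \<in> mcarrier D.P" for s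
    using that by (auto simp: D.P_carrier nu_closed)
  show ?thesis
    unfolding F.inner_msum_list2[OF sub[OF assms(1)] sub[OF assms(2)]]
    by (simp add: comp_def formal_tensors_list_module, intro sum_list_cong)
      (auto simp: tensor_form_def intro!: nu_inner elim: D.P_memD[OF assms(1)] D.P_memD[OF assms(2)])
qed

lemma nu_sum_module_map: "module_map D.P F (\<lambda>s. msum_list F (map (\<lambda>(x, f). nu x f) s)) 1"
proof (rule isometric_module_map[OF D.P.semi_inner_module_axioms F.hilbert_module_axioms])
  show "(\<lambda>s. msum_list F (map (\<lambda>(x, f). nu x f) s)) \<in> mcarrier D.P \<rightarrow> mcarrier F"
    by (auto intro!: F.msum_list_closed nu_closed dest: D.P_memD)
qed (rule nu_sum_inner)

lemma \<nu>_module_map: "module_map D.T F \<nu> 1"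
  and \<nu>_emb: "s \<in> mcarrier D.P \<Longrightarrow> \<nu> (D.P.emb s) = msum_list F (map (\<lambda>(x, f). nu x f) s)"
  unfolding \<nu>_def D.T_eq by (rule D.P.ext_module_map[OF F.hilbert_module_axioms nu_sum_module_map], assumption?)+

lemmas \<nu>_mtends = module_map_mtends[OF D.T.semi_inner_module_axioms F.semi_inner_module_axioms \<nu>_module_map]

lemma \<nu>_inner:
  assumes "y \<in> mcarrier D.T" "z \<in> mcarrier D.T"
  shows "minner F (\<nu> y) (\<nu> z) = minner D.T y z"
  unfolding D.T_eq
proof (rule D.P.completion_inner_eqI[OF assms[unfolded D.T_eq]])
  fix s t assume "s \<in> mcarrier D.P" "t \<in> mcarrier D.P"
  then show "minner F (\<nu> (D.P.emb s)) (\<nu> (D.P.emb t)) = minner D.P.cM (D.P.emb s) (D.P.emb t)"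
    by (simp add: \<nu>_emb nu_sum_inner D.P.emb_inner)
qed (auto intro!: F.mtends_inner \<nu>_mtends D.T.mtends_inner simp flip: D.T_eq)

lemma \<nu>_isometry: "isometry_on D.T F \<nu>"
  using \<nu>_module_map \<nu>_inner by (auto simp: isometry_on_def module_map_def)

lemma \<nu>_tens: "x \<in> mcarrier E \<Longrightarrow> f \<in> mcarrier \<F> \<Longrightarrow> \<nu> (D.tens x f) = nu x f"
  by (simp add: D.tens_eq \<nu>_emb D.P_carrier F.add_zero nu_closed)

lemma \<nu>_\<ii>: "x \<in> mcarrier E \<Longrightarrow> \<sigma> \<in> S \<Longrightarrow> \<nu> (D.tens x (\<ii> \<sigma>)) = K \<sigma> x"
  by (simp add: \<nu>_tens \<ii>_def single_closed nu_emb xact_def act_one F.act_one F.add_zero K_closed)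

definition wact :: "'g \<Rightarrow> 'e \<times> ('b, 's, 'c) dilation_space \<Rightarrow> 'e \<times> ('b, 's, 'c) dilation_space" where
  "wact t = (\<lambda>(x, f). (\<eta> t x, v t f))"

definition w where "w t = D.P.ext D.T (\<lambda>s. D.P.emb (map (wact t) s))"

lemma map_wact_closed: "s \<in> mcarrier D.P \<Longrightarrow> map (wact t) s \<in> mcarrier D.P"
  by (force simp: D.P_carrier wact_def v_closed)

lemma map_wact_inner:
  assumes "s \<in> mcarrier D.P" "s' \<in> mcarrier D.P"
  shows "minner D.P (map (wact t) s) (map (wact t) s') = minner D.P s s'"
proof -
  have *: "tensor_form E \<F> \<pi> (wact t p) (wact t q) = tensor_form E \<F> \<pi> p q"
    if "p \<in> mcarrier E \<times> mcarrier \<F>" "q \<in> mcarrier E \<times> mcarrier \<F>" for p q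
    using that by (auto simp: tensor_form_def wact_def \<pi>_covariant v_closed v_unitary \<pi>_closed simp flip: \<alpha>_inner)
  show ?thesis
    by (simp add: comp_def formal_tensors_list_module, intro sum_list_cong *)
      (use assms in \<open>simp_all add: D.P_carrier in_listsD\<close>)
qed

lemma wact_module_map: "module_map D.P D.T (\<lambda>s. D.P.emb (map (wact t) s)) 1"
  by (rule isometric_module_map[OF D.P.semi_inner_module_axioms D.T.hilbert_module_axioms])
    (auto simp: D.T_eq map_wact_closed map_wact_inner D.P.emb_inner)

lemma w_module_map: "module_map D.T D.T (w t) 1"
  and w_emb: "s \<in> mcarrier D.P \<Longrightarrow> w t (D.P.emb s) = D.P.emb (map (wact t) s)"
  unfolding w_def
  using D.P.ext_module_map[OF D.T.hilbert_module_axioms wact_module_map] by (auto simp: D.T_eq)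

lemma w_tens: "x \<in> mcarrier E \<Longrightarrow> f \<in> mcarrier \<F> \<Longrightarrow> w t (D.tens x f) = D.tens (\<eta> t x) (v t f)"
  by (simp add: D.tens_eq w_emb D.P_carrier wact_def)

lemma v_continuous: "f \<in> mcarrier \<F> \<Longrightarrow> mtends \<F> (\<lambda>t. v t f) (v t0 f) (at t0)"
  using v_rep unfolding unitary_rep_on_def mcontinuous_def mtends_def by (auto simp: v_closed)

lemma w_rep: "unitary_rep_on D.T w"
proof -
  have "unitary_rep_on D.P.cM w"
  proof (rule D.P.unitary_rep_on_completionI[OF w_module_map[unfolded D.T_eq]])
    fix s s' t assume "s \<in> mcarrier D.P" "s' \<in> mcarrier D.P"
    then show "minner D.P.cM (w t (D.P.emb s)) (w t (D.P.emb s')) = minner D.P s s'"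
      by (simp add: w_emb D.P.emb_inner map_wact_closed map_wact_inner)
  next
    fix s assume s: "s \<in> mcarrier D.P"
    then have "map (wact 0) s = s"
      by (intro map_idI) (auto simp: D.P_carrier wact_def \<eta>_0 v_unitary)
    then show "w 0 (D.P.emb s) = D.P.emb s" using s by (simp add: w_emb)
  next
    fix s t t' assume s: "s \<in> mcarrier D.P"
    then have "map (wact (t + t')) s = map (wact t) (map (wact t') s)"
      by (auto simp: D.P_carrier wact_def \<eta>_add v_unitary)
    then show "w (t + t') (D.P.emb s) = w t (w t' (D.P.emb s))"
      using s by (simp add: w_emb map_wact_closed del: map_map)
  next
    fix s t0 assume s: "s \<in> mcarrier D.P"
    have "((\<lambda>t. \<Sum>p\<leftarrow>s. \<Sum>q\<leftarrow>s. tensor_form E \<F> \<pi> (wact t0 p) (wact t q))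
        \<longlongrightarrow> (\<Sum>p\<leftarrow>s. \<Sum>q\<leftarrow>s. tensor_form E \<F> \<pi> (wact t0 p) (wact t0 q))) (at t0)"
    proof (intro tendsto_sum_list)
      fix p q assume "p \<in> set s" "q \<in> set s"
      then have "p \<in> mcarrier E \<times> mcarrier \<F>" "q \<in> mcarrier E \<times> mcarrier \<F>"
        using s by (auto simp: D.P_carrier)
      then obtain x f y h where pq: "p = (x, f)" "q = (y, h)" "x \<in> mcarrier E" "f \<in> mcarrier \<F>"
        "y \<in> mcarrier E" "h \<in> mcarrier \<F>"
        by blast
      show "((\<lambda>t. tensor_form E \<F> \<pi> (wact t0 p) (wact t q))
          \<longlongrightarrow> tensor_form E \<F> \<pi> (wact t0 p) (wact t0 q)) (at t0)"
        unfolding pq(1,2) tensor_form_def wact_def prod.case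
        by (intro D.M.la_tendsto v_closed v_continuous mtends_inner mtends_const \<eta>_mtends \<eta>_closed pq)
    qed
    then show "((\<lambda>t. minner D.P.cM (w t0 (D.P.emb s)) (w t (D.P.emb s))) \<longlongrightarrow> minner D.P s s) (at t0)"
      using s map_wact_inner[OF s s, of t0]
      by (simp add: w_emb D.P.emb_inner map_wact_closed) (simp add: formal_tensors_list_module comp_def)
  qed
  then show ?thesis by (simp add: D.T_eq)
qed

lemma \<nu>_covariant:
  assumes z: "z \<in> mcarrier D.T" shows "\<nu> (w t z) = \<phi> (u' t) (\<nu> z)"
proof (rule D.P.completion_eqI[OF F.hilbert_module_axioms z[unfolded D.T_eq],
      where f = "\<lambda>z. \<nu> (w t z)" and g = "\<lambda>z. \<phi> (u' t) (\<nu> z)"])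
  fix s assume s: "s \<in> mcarrier D.P"
  have "map (\<lambda>(x, f). nu x f) (map (wact t) s) = map (\<phi> (u' t)) (map (\<lambda>(x, f). nu x f) s)"
    using s by (auto simp: D.P_carrier wact_def nu_covariant)
  moreover have "\<phi> (u' t) (msum_list F (map (\<lambda>(x, f). nu x f) s))
      = msum_list F (map (\<phi> (u' t)) (map (\<lambda>(x, f). nu x f) s))"
    using s
    by (intro F.la_msum_list)
      (auto simp: D.P_carrier nu_closed)
  ultimately show "\<nu> (w t (D.P.emb s)) = \<phi> (u' t) (\<nu> (D.P.emb s))"
    using s by (simp add: w_emb \<nu>_emb map_wact_closed del: map_map)
next
  note wt = module_map_mtends[OF D.T.semi_inner_module_axioms D.T.semi_inner_module_axioms w_module_map]
  show "mtends F (\<lambda>n. \<nu> (w t (X n))) (\<nu> (w t z)) sequentially" if "mtends D.P.cM X z sequentially" for X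
    using that by (intro \<nu>_mtends wt) (simp add: D.T_eq)
  show "mtends F (\<lambda>n. \<phi> (u' t) (\<nu> (X n))) (\<phi> (u' t) (\<nu> z)) sequentially" if "mtends D.P.cM X z sequentially" for X
    using that
    by (intro F.la_mtends \<nu>_mtends)
      (simp add: D.T_eq)
qed

theorem kernel_imp_dilation: "covariant_dilation u' u \<eta> S E F \<phi> K \<F> \<pi> \<ii> \<nu> v w"
proof -
  have i: "\<ii> \<sigma> \<in> mcarrier \<F>" if "\<sigma> \<in> S" for \<sigma> using that by (auto simp: \<ii>_def single_closed)
  have "w t (D.tens x (mact \<F> (\<pi> b (\<ii> \<sigma>)) c)) = D.tens (\<eta> t x) (v t (mact \<F> (\<pi> b (\<ii> \<sigma>)) c))"
    if "x \<in> mcarrier E" "\<sigma> \<in> S" for x \<sigma> b c t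
    using that i by (intro w_tens \<F>.si_act_closed \<pi>_closed) auto
  moreover have "\<pi> (\<alpha> t b) f = v t (\<pi> b (adj \<F> (v t) f))" if "f \<in> mcarrier \<F>" for t b f
    using that by (simp add: v_adj \<pi>_covariant)
  ultimately show ?thesis
    unfolding covariant_dilation_def Let_def cstar_correspondence_def
    using P0.completion_hilbert left_action_\<pi> i \<nu>_isometry \<nu>_\<ii> v_rep w_rep v_\<ii> \<nu>_covariant
    by (auto simp: \<alpha>_def)
qed

end

theorem theorem2p4:
  fixes u :: "'g::{topological_group_add, t2_space} \<Rightarrow> 'c::unital_cstar_algebra"
    and u' :: "'g \<Rightarrow> 'd::unital_cstar_algebra"
    and E :: "('e, 'b::unital_cstar_algebra) hmod"
    and F :: "('f, 'c) hmod"
    and \<phi> :: "'d \<Rightarrow> 'f \<Rightarrow> 'f"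
    and S :: "'s set"
    and K :: "'s \<Rightarrow> 'e \<Rightarrow> 'f"
    and \<eta> :: "'g \<Rightarrow> 'e \<Rightarrow> 'e"
  assumes "locally_compact_space (euclidean :: 'g topology)"
    and "unitary_rep u"
    and "unitary_rep u'"
    and "hilbert_module E"
    and "full E"
    and "cstar_correspondence F \<phi>"
    and "\<And>\<sigma>. \<sigma> \<in> S \<Longrightarrow> K \<sigma> \<in> mcarrier E \<rightarrow> mcarrier F"
    and "dynamical_system \<eta> E"
  shows "((\<exists>\<KK> :: 's \<Rightarrow> 's \<Rightarrow> 'b \<Rightarrow> 'c.
             cpd_kernel S \<KK> \<and> kernel_family S \<KK> E F K \<and> covariant_family u' u \<eta> S E F \<phi> K)
          \<longleftrightarrow>
          (\<exists>(\<F> :: (('b, 's, 'c) dilation_space, 'c) hmod) \<pi> \<ii> \<nu> v w'.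
             covariant_dilation u' u \<eta> S E F \<phi> K \<F> \<pi> \<ii> \<nu> v w'))
       \<and>
         ((\<exists>(\<F> :: ('m, 'c) hmod) \<pi> \<ii> \<nu> v w'.
             covariant_dilation u' u \<eta> S E F \<phi> K \<F> \<pi> \<ii> \<nu> v w')
          \<longrightarrow>
          (\<exists>\<KK> :: 's \<Rightarrow> 's \<Rightarrow> 'b \<Rightarrow> 'c.
             cpd_kernel S \<KK> \<and> kernel_family S \<KK> E F K \<and> covariant_family u' u \<eta> S E F \<phi> K))"
proof -
  have dilation: "\<exists>(\<F> :: (('b, 's, 'c) dilation_space, 'c) hmod) \<pi> \<ii> \<nu> v w'.
      covariant_dilation u' u \<eta> S E F \<phi> K \<F> \<pi> \<ii> \<nu> v w'"
    if "cpd_kernel S \<KK>" "kernel_family S \<KK> E F K" "covariant_family u' u \<eta> S E F \<phi> K"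
    for \<KK> :: "'s \<Rightarrow> 's \<Rightarrow> 'b \<Rightarrow> 'c"
  proof -
    interpret covariant_kernel E \<eta> F \<phi> u u' S K \<KK>
      using assms that
      by (auto simp: covariant_kernel_def covariant_kernel_axioms_def full_dynamical_system_def
          full_dynamical_system_axioms_def left_module_def left_module_axioms_def cstar_correspondence_def)
    show ?thesis using kernel_imp_dilation by blast
  qed
  show ?thesis
    by (intro conjI iffI impI; elim exE conjE)
      (rule dilation dilation_imp_kernel[OF assms(2,4,5,8,6)]; assumption)+
qed

end
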